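(* Let $d\ge 1$, let $n \geq 2$ be an integer and let $G$ be a weakly continuous Riemannian metric on $\mathrm{Imm}(S^1,\mathbb{R}^d)$ with the following property: for every metric ball $B(c_0,r)$ in $\mathrm{Imm}(S^1,\mathbb{R}^d)$ (with respect to the geodesic distance of $G$) there exists a constant $C'$ such that \[ \int_{S^1} |h|^2 + |D_s^n h|^2 \,\mathrm{d}s \leq C'\, G_c(h,h) \] holds for all $c \in B(c_0,r)$ and all $h \in T_c\mathrm{Imm}(S^1,\mathbb{R}^d)$. Then, given a metric ball $B(c_0,r)$ in $\mathrm{Imm}(S^1,\mathbb{R}^d)$, there exists a constant $C$ such that \[ C^{-1} \| h \|_{H^n(d\theta)} \leq \| h \|_{H^n(ds)} \leq C \| h \|_{H^n(d\theta)} \] holds for all $c \in B(c_0,r)$ and all $h \in H^n(S^1,\mathbb{R})$.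
   Context: $\mathrm{Imm}(S^1,\mathbb{R}^d)=\{c\in C^\infty(S^1,\mathbb{R}^d): c'(\theta)\neq 0 \text{ for all } \theta\}$ is the Fréchet manifold of smooth immersed closed curves, an open subset of $C^\infty(S^1,\mathbb{R}^d)$ with the $C^\infty$-topology; its tangent space at $c$ is $T_c\mathrm{Imm}(S^1,\mathbb{R}^d)= C^\infty(S^1,\mathbb{R}^d)$. For a curve $c$, $h'=\partial_\theta h$, $D_s = \frac{1}{|c'|}\partial_\theta$ is the arc length derivative and $\mathrm{d}s=|c'|\,\mathrm{d}\theta$ is arc length integration; both depend on $c$. The norms are \[ \|h\|^2_{H^n(d\theta)}=\int_{S^1}|h|^2+|\partial_\theta^n h|^2\,\mathrm{d}\theta,\qquad \|h\|^2_{H^n(ds)}=\int_{S^1}|h|^2+|D_s^n h|^2\,\mathrm{d}s . \] A weakly continuous Riemannian metric on $M=\mathrm{Imm}(S^1,\mathbb{R}^d)$ is a family $G_c$ of symmetric positive definite bilinear forms on $T_cM$ such that $G: TM\times_M TM\to\mathbb{R}$ is continuous. Its geodesic distance $\mathrm{dist}(c_1,c_2)$ is the infimum of the lengths $L(\gamma)=\int_0^1\sqrt{G_{\gamma(t)}(\dot\gamma(t),\dot\gamma(t))}\,\mathrm{d}t$ over piecewise smooth paths $\gamma:[0,1]\to M$ from $c_1$ to $c_2$ (equal to $+\infty$ if there is no such path), and $B(c_0,r)=\{c:\mathrm{dist}(c_0,c)<r\}$. *)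

theory Defs
  imports "HOL-Analysis.Analysis"
begin

text \<open>
  The circle is $\mathbf{R}/2\pi\mathbf{Z}$; functions on it are $2\pi$-periodic functions on
  the real line, and integrals over it are Lebesgue integrals over $[0,2\pi]$.
\<close>

definition periodic :: "(real \<Rightarrow> 'a) \<Rightarrow> bool" where
  "periodic f \<longleftrightarrow> (\<forall>\<theta>. f (\<theta> + 2 * pi) = f \<theta>)"

definition ddt :: "(real \<Rightarrow> 'a::real_normed_vector) \<Rightarrow> real \<Rightarrow> 'a" where
  "ddt f = (\<lambda>\<theta>. vector_derivative f (at \<theta>))"

definition Cinf :: "(real \<Rightarrow> 'a::real_normed_vector) set" where
  "Cinf = {f. periodic f \<and> (\<forall>k. (ddt ^^ k) f differentiable_on UNIV)}"

definition Imm :: "(real \<Rightarrow> 'a::real_normed_vector) set" where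
  "Imm = {c \<in> Cinf. \<forall>\<theta>. ddt c \<theta> \<noteq> 0}"

text \<open>
  The Fr\'echet topology of \<open>Cinf\<close>: the subbasic sets are the open balls of the seminorms
  $\sup_\theta |\partial_\theta^k f(\theta)|$. By periodicity the suprema are attained, so that
  a pointwise strict bound is a strict bound on the supremum.
\<close>

definition Cinf_topology :: "(real \<Rightarrow> 'a::real_normed_vector) topology" where
  "Cinf_topology = topology_generated_by
     {{g \<in> Cinf. \<forall>\<theta>. norm ((ddt ^^ k) g \<theta> - (ddt ^^ k) f \<theta>) < \<epsilon>} | f k \<epsilon>.
        f \<in> Cinf \<and> 0 < \<epsilon>}"

text \<open>
  Weakly continuous Riemannian metrics. Every tangent space of \<open>Imm\<close> is \<open>Cinf\<close>, and the fibre
  product of the tangent bundle with itself is $\mathrm{Imm} \times C^\infty \times C^\infty$.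
  Linearity in the second argument follows from symmetry.
\<close>

definition weakly_continuous_metric ::
  "((real \<Rightarrow> 'a::real_normed_vector) \<Rightarrow> (real \<Rightarrow> 'a) \<Rightarrow> (real \<Rightarrow> 'a) \<Rightarrow> real) \<Rightarrow> bool" where
  "weakly_continuous_metric G \<longleftrightarrow>
     (\<forall>c\<in>Imm. \<forall>h\<in>Cinf. \<forall>k\<in>Cinf. G c h k = G c k h) \<and>
     (\<forall>c\<in>Imm. \<forall>h\<in>Cinf. \<forall>k\<in>Cinf. \<forall>l\<in>Cinf. G c (\<lambda>\<theta>. h \<theta> + k \<theta>) l = G c h l + G c k l) \<and>
     (\<forall>c\<in>Imm. \<forall>h\<in>Cinf. \<forall>l\<in>Cinf. \<forall>a. G c (\<lambda>\<theta>. a *\<^sub>R h \<theta>) l = a * G c h l) \<and>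
     (\<forall>c\<in>Imm. \<forall>h\<in>Cinf. h \<noteq> (\<lambda>\<theta>. 0) \<longrightarrow> 0 < G c h h) \<and>
     continuous_map
       (prod_topology (subtopology Cinf_topology Imm) (prod_topology Cinf_topology Cinf_topology))
       euclideanreal (\<lambda>(c, h, k). G c h k)"

text \<open>Curves in the Fr\'echet space \<open>Cinf\<close>: difference quotients converge in \<open>Cinf_topology\<close>.\<close>

definition has_path_derivative ::
  "(real \<Rightarrow> real \<Rightarrow> 'a::real_normed_vector) \<Rightarrow> (real \<Rightarrow> 'a) \<Rightarrow> real \<Rightarrow> real set \<Rightarrow> bool" where
  "has_path_derivative \<gamma> v t I \<longleftrightarrow>
     limitin Cinf_topology (\<lambda>s \<theta>. (\<gamma> s \<theta> - \<gamma> t \<theta>) /\<^sub>R (s - t)) v (at t within I)"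

text \<open>\<open>\<Gamma> k\<close> is the \<open>k\<close>-th derivative; it is one-sided at the end points of an interval \<open>I\<close>.\<close>

definition smooth_path_on :: "real set \<Rightarrow> (real \<Rightarrow> real \<Rightarrow> 'a::real_normed_vector) \<Rightarrow> bool" where
  "smooth_path_on I \<gamma> \<longleftrightarrow>
     (\<exists>\<Gamma>. \<Gamma> 0 = \<gamma> \<and> (\<forall>k. \<forall>t\<in>I. has_path_derivative (\<Gamma> k) (\<Gamma> (Suc k) t) t I))"

text \<open>
  Continuity at the break points is implied, because both adjacent closed pieces contain them.
\<close>

definition piecewise_smooth_path :: "(real \<Rightarrow> real \<Rightarrow> 'a::real_normed_vector) \<Rightarrow> bool" where
  "piecewise_smooth_path \<gamma> \<longleftrightarrow>
     (\<forall>t\<in>{0..1}. \<gamma> t \<in> Imm) \<and>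
     (\<exists>m \<tau>. \<tau> 0 = 0 \<and> \<tau> m = 1 \<and>
        (\<forall>i<m. \<tau> i < \<tau> (Suc i) \<and> smooth_path_on {\<tau> i..\<tau> (Suc i)} \<gamma>))"

text \<open>The velocity is unspecified at the finitely many break points where it does not exist.\<close>

definition velocity :: "(real \<Rightarrow> real \<Rightarrow> 'a::real_normed_vector) \<Rightarrow> real \<Rightarrow> real \<Rightarrow> 'a" where
  "velocity \<gamma> t = (SOME v. has_path_derivative \<gamma> v t {0..1})"

definition path_len ::
  "((real \<Rightarrow> 'a::real_normed_vector) \<Rightarrow> (real \<Rightarrow> 'a) \<Rightarrow> (real \<Rightarrow> 'a) \<Rightarrow> real) \<Rightarrow>
   (real \<Rightarrow> real \<Rightarrow> 'a) \<Rightarrow> real" where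
  "path_len G \<gamma> = (LINT t:{0..1}|lebesgue. sqrt (G (\<gamma> t) (velocity \<gamma> t) (velocity \<gamma> t)))"

text \<open>The infimum over the empty set is \<open>\<infinity>\<close> in the extended reals.\<close>

definition geodesic_dist ::
  "((real \<Rightarrow> 'a::real_normed_vector) \<Rightarrow> (real \<Rightarrow> 'a) \<Rightarrow> (real \<Rightarrow> 'a) \<Rightarrow> real) \<Rightarrow>
   (real \<Rightarrow> 'a) \<Rightarrow> (real \<Rightarrow> 'a) \<Rightarrow> ereal" where
  "geodesic_dist G c1 c2 =
     (INF \<gamma>\<in>{\<gamma>. piecewise_smooth_path \<gamma> \<and> \<gamma> 0 = c1 \<and> \<gamma> 1 = c2}. ereal (path_len G \<gamma>))"

definition metric_ball ::
  "((real \<Rightarrow> 'a::real_normed_vector) \<Rightarrow> (real \<Rightarrow> 'a) \<Rightarrow> (real \<Rightarrow> 'a) \<Rightarrow> real) \<Rightarrow>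
   (real \<Rightarrow> 'a) \<Rightarrow> real \<Rightarrow> (real \<Rightarrow> 'a) set" where
  "metric_ball G c0 r = {c \<in> Imm. geodesic_dist G c0 c < ereal r}"

text \<open>
  Real-valued Sobolev functions, represented by periodic functions; nothing below depends on the
  choice of representative, up to null sets. The operator \<open>weak_ddt\<close> picks a representative of
  the weak derivative, which is unique almost everywhere when it exists.
\<close>

definition has_weak_derivative :: "(real \<Rightarrow> real) \<Rightarrow> (real \<Rightarrow> real) \<Rightarrow> bool" where
  "has_weak_derivative f g \<longleftrightarrow>
     periodic f \<and> set_integrable lebesgue {0..2*pi} f \<and>
     periodic g \<and> set_integrable lebesgue {0..2*pi} g \<and>
     (\<forall>\<phi>\<in>Cinf. (LINT \<theta>:{0..2*pi}|lebesgue. f \<theta> * ddt \<phi> \<theta>)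
                = - (LINT \<theta>:{0..2*pi}|lebesgue. g \<theta> * \<phi> \<theta>))"

definition weak_ddt :: "(real \<Rightarrow> real) \<Rightarrow> real \<Rightarrow> real" where
  "weak_ddt f = (SOME g. has_weak_derivative f g)"

definition L2_circle :: "(real \<Rightarrow> real) set" where
  "L2_circle = {f. periodic f \<and> f \<in> borel_measurable lebesgue \<and>
                   set_integrable lebesgue {0..2*pi} (\<lambda>\<theta>. (f \<theta>)\<^sup>2)}"

definition Sobolev :: "nat \<Rightarrow> (real \<Rightarrow> real) set" where
  "Sobolev n = {h. (\<forall>k\<le>n. (weak_ddt ^^ k) h \<in> L2_circle) \<and>
                   (\<forall>k<n. has_weak_derivative ((weak_ddt ^^ k) h) ((weak_ddt ^^ Suc k) h))}"

text \<open>
  The arc length derivative along \<open>c\<close>, for a derivative operator \<open>D\<close>: \<open>ddt\<close> on smooth functions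
  and \<open>weak_ddt\<close> on Sobolev functions.
\<close>

definition arc_deriv ::
  "((real \<Rightarrow> 'b::real_normed_vector) \<Rightarrow> real \<Rightarrow> 'b) \<Rightarrow> (real \<Rightarrow> 'a::real_normed_vector) \<Rightarrow>
   (real \<Rightarrow> 'b) \<Rightarrow> real \<Rightarrow> 'b" where
  "arc_deriv D c h = (\<lambda>\<theta>. D h \<theta> /\<^sub>R norm (ddt c \<theta>))"

definition arc_integral :: "(real \<Rightarrow> 'a::real_normed_vector) \<Rightarrow> (real \<Rightarrow> real) \<Rightarrow> real" where
  "arc_integral c f = (LINT \<theta>:{0..2*pi}|lebesgue. f \<theta> * norm (ddt c \<theta>))"

definition Hn_norm_dtheta :: "nat \<Rightarrow> (real \<Rightarrow> real) \<Rightarrow> real" where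
  "Hn_norm_dtheta n h =
     sqrt (LINT \<theta>:{0..2*pi}|lebesgue. \<bar>h \<theta>\<bar>\<^sup>2 + \<bar>(weak_ddt ^^ n) h \<theta>\<bar>\<^sup>2)"

definition Hn_norm_ds :: "nat \<Rightarrow> (real \<Rightarrow> 'a::real_normed_vector) \<Rightarrow> (real \<Rightarrow> real) \<Rightarrow> real" where
  "Hn_norm_ds n c h =
     sqrt (arc_integral c (\<lambda>\<theta>. \<bar>h \<theta>\<bar>\<^sup>2 + \<bar>(arc_deriv weak_ddt c ^^ n) h \<theta>\<bar>\<^sup>2))"

end

theory Submission
  imports Defs
begin

text \<open>
  Along a path in a metric ball the hypothesis bounds $\|v\|_{L^2(ds)}$ and
  $\|D_s^n v\|_{L^2(ds)}$ of the velocity $v$ by its $G$-norm. Integration by parts makes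
  $k \mapsto \|D_s^k v\|_{L^2(ds)}$ logarithmically convex, which bounds the intermediate
  derivatives with constants independent of the curve. Therefore a number of seminorms $N$ of the
  curve satisfy $N(v) \le K \sqrt{G_c(v,v)}\,(\kappa + N(c))$, and a Gronwall argument bounds
  $\ln(\kappa + N)$ on the ball. This is applied in turn to the length, to $|c'(\theta)|$ (with
  $\kappa = 0$, so that also $1/|c'|$ is bounded), to $|\partial_\theta^k c(\theta)|$ for
  $2 \le k < n$ and to $\|\partial_\theta^n c\|_{L^2(d\theta)}$. With these bounds the two norms
  are compared for smooth functions by expanding $\partial_\theta^n$ and $D_s^n$ in terms of each
  other; the top derivative of $c$ is only square integrable, but it occurs only as a factor of the
  first derivative of $h$, which is bounded. Smooth functions are dense in $H^n$, which gives the
  general case.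
\<close>

subsection \<open>Smooth periodic functions\<close>

text \<open>The inequalities for arc length derivatives must have constants that do not involve the
  curve, since control of the curve is what they are meant to give. For derivatives of order at
  least one this is possible: integrated against \<open>ds\<close> they have mean zero on a closed
  curve, so a pointwise bound costs only an upper bound on the length, and that bound follows from
  integral estimates alone. This fixes the order in which the quantities are treated.

  Growth along a path is read off from pointwise Lipschitz constants: a seminorm changes at most at
  the rate of its value on the velocity. Nothing has to be differentiated, neither a norm at its
  zeros nor an integral with a parameter, and one-sided derivatives at break points do no harm. The
  hypothesis holds only inside the ball, so the paths used must stay there; they do, because
  stopping a path does not lengthen it.

  On the Sobolev side every weak derivative is a choice of representative. Iterated operators are
  therefore compared through expansions with smooth coefficients that hold almost
  everywhere.\<close>

fun times_differentiable :: "nat \<Rightarrow> (real \<Rightarrow> 'a::real_normed_vector) \<Rightarrow> bool" where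
  "times_differentiable 0 f \<longleftrightarrow> f differentiable_on UNIV"
| "times_differentiable (Suc k) f \<longleftrightarrow> f differentiable_on UNIV \<and> times_differentiable k (ddt f)"

text \<open>The recursion peels off the innermost derivative, so closure properties can be shown by
  induction on k with the function generalized; \<open>Cinf\<close> speaks of iterates.\<close>

lemma times_differentiable_iff:
  "times_differentiable k f \<longleftrightarrow> (\<forall>j\<le>k. (ddt ^^ j) f differentiable_on UNIV)"
proof (induction k arbitrary: f)
  case (Suc k)
  have "(\<forall>j\<le>Suc k. (ddt ^^ j) f differentiable_on UNIV) \<longleftrightarrow>
      f differentiable_on UNIV \<and> (\<forall>j\<le>k. (ddt ^^ Suc j) f differentiable_on UNIV)"
    by (metis (no_types, lifting) Suc_le_mono bot_nat_0.extremum funpow_0 not0_implies_Suc)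
  then show ?case
    by (simp add: Suc.IH funpow_swap1)
qed simp

lemma Cinf_iff: "f \<in> Cinf \<longleftrightarrow> periodic f \<and> (\<forall>k. times_differentiable k f)"
  by (auto simp: Cinf_def times_differentiable_iff)

lemma ddt_eqI:
  assumes "\<And>\<theta>. (f has_vector_derivative f' \<theta>) (at \<theta>)"
  shows "ddt f = f'"
  unfolding ddt_def using assms by (auto intro!: ext vector_derivative_at)

lemma times_differentiable_SucI:
  assumes "\<And>\<theta>. (f has_vector_derivative f' \<theta>) (at \<theta>)" "times_differentiable k f'"
  shows "times_differentiable (Suc k) f"
  using assms ddt_eqI[of f f']
  by (auto simp: differentiable_on_def intro: differentiableI_vector)

lemma times_differentiable_Suc_imp: "times_differentiable (Suc k) f \<Longrightarrow> times_differentiable k f"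
  by (auto simp: times_differentiable_iff)

lemma times_differentiable_imp_vector_derivative:
  assumes "times_differentiable k f"
  shows "(f has_vector_derivative ddt f \<theta>) (at \<theta>)"
proof -
  have "f differentiable_on UNIV" using assms by (cases k) auto
  then show ?thesis
    unfolding ddt_def by (simp add: differentiable_on_def vector_derivative_works)
qed

lemma times_differentiable_const: "times_differentiable k (\<lambda>\<theta>. a)"
proof (induction k arbitrary: a)
  case (Suc k)
  show ?case by (rule times_differentiable_SucI[of _ "\<lambda>_. 0"]) (auto simp: Suc)
qed simp

lemma times_differentiable_add:
  "times_differentiable k f \<Longrightarrow> times_differentiable k g \<Longrightarrow> times_differentiable k (\<lambda>\<theta>. f \<theta> + g \<theta>)"
proof (induction k arbitrary: f g)
  case 0
  then show ?case by (auto intro: derivative_intros)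
next
  case (Suc k)
  show ?case
    by (rule times_differentiable_SucI[of _ "\<lambda>\<theta>. ddt f \<theta> + ddt g \<theta>"])
      (use Suc in \<open>auto intro!: has_vector_derivative_add
        times_differentiable_imp_vector_derivative[of "Suc k"]\<close>)
qed

text \<open>One induction serves products, scalar multiples and inner products.\<close>

lemma times_differentiable_bilinear:
  assumes "bounded_bilinear B"
  shows "times_differentiable k f \<Longrightarrow> times_differentiable k g \<Longrightarrow>
    times_differentiable k (\<lambda>\<theta>. B (f \<theta>) (g \<theta>))"
proof (induction k arbitrary: f g)
  case 0
  then show ?case
    using bounded_bilinear.FDERIV[OF assms]
    unfolding times_differentiable.simps differentiable_on_def differentiable_def by blast
next
  case (Suc k)
  show ?case
  proof (rule times_differentiable_SucI[of _ "\<lambda>\<theta>. B (f \<theta>) (ddt g \<theta>) + B (ddt f \<theta>) (g \<theta>)"])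
    show "((\<lambda>\<theta>. B (f \<theta>) (g \<theta>)) has_vector_derivative
        B (f \<theta>) (ddt g \<theta>) + B (ddt f \<theta>) (g \<theta>)) (at \<theta>)" for \<theta>
      using Suc.prems
      by (intro bounded_bilinear.has_vector_derivative[OF assms]
            times_differentiable_imp_vector_derivative)
    show "times_differentiable k (\<lambda>\<theta>. B (f \<theta>) (ddt g \<theta>) + B (ddt f \<theta>) (g \<theta>))"
      using Suc.prems times_differentiable_Suc_imp[of k f] times_differentiable_Suc_imp[of k g]
      by (intro times_differentiable_add Suc.IH) auto
  qed
qed

lemma Cinf_periodic: "f \<in> Cinf \<Longrightarrow> periodic f"
  by (simp add: Cinf_iff)

lemma Cinf_vector_derivative:
  "f \<in> Cinf \<Longrightarrow> (f has_vector_derivative ddt f \<theta>) (at \<theta> within S)"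
  by (meson Cinf_iff has_vector_derivative_at_within times_differentiable_imp_vector_derivative)

lemma Cinf_continuous_on: "f \<in> Cinf \<Longrightarrow> continuous_on S f"
  by (meson Cinf_vector_derivative continuous_at_imp_continuous_on has_vector_derivative_continuous)

lemma ddt_Cinf [intro]:
  assumes "f \<in> Cinf"
  shows "ddt f \<in> Cinf"
proof -
  have "periodic (ddt f)"
    unfolding periodic_def
  proof
    fix \<theta>
    have "((\<lambda>x. f (x + 2 * pi)) has_vector_derivative ddt f (\<theta> + 2 * pi)) (at \<theta>)"
      using vector_diff_chain_at[of "\<lambda>x. x + 2 * pi" 1 \<theta> f "ddt f (\<theta> + 2 * pi)"]
        Cinf_vector_derivative[OF assms] has_vector_derivative_add_const[of "\<lambda>x. x" "2 * pi" 1]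
      by (simp add: o_def)
    then have "(f has_vector_derivative ddt f (\<theta> + 2 * pi)) (at \<theta>)"
      using Cinf_periodic[OF assms] by (simp add: periodic_def)
    then show "ddt f (\<theta> + 2 * pi) = ddt f \<theta>"
      using Cinf_vector_derivative[OF assms] vector_derivative_unique_at by blast
  qed
  moreover have "times_differentiable k (ddt f)" for k
    using assms by (metis Cinf_iff times_differentiable.simps(2))
  ultimately show ?thesis by (simp add: Cinf_iff)
qed

lemma ddt_pow_Cinf [intro]: "f \<in> Cinf \<Longrightarrow> (ddt ^^ k) f \<in> Cinf"
  by (induction k) auto

lemma const_Cinf [intro, simp]: "(\<lambda>\<theta>. a) \<in> Cinf"
  by (simp add: Cinf_iff times_differentiable_const periodic_def)

lemma bilinear_Cinf:
  "bounded_bilinear B \<Longrightarrow> f \<in> Cinf \<Longrightarrow> g \<in> Cinf \<Longrightarrow> (\<lambda>\<theta>. B (f \<theta>) (g \<theta>)) \<in> Cinf"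
  by (auto simp: Cinf_iff times_differentiable_bilinear periodic_def)

lemmas mult_Cinf [intro] = bilinear_Cinf[OF bounded_bilinear_mult]
lemmas scaleR_Cinf [intro] = bilinear_Cinf[OF bounded_bilinear_scaleR]
lemmas inner_Cinf [intro] = bilinear_Cinf[OF bounded_bilinear_inner]

lemma add_Cinf [intro]: "f \<in> Cinf \<Longrightarrow> g \<in> Cinf \<Longrightarrow> (\<lambda>\<theta>. f \<theta> + g \<theta>) \<in> Cinf"
  by (auto simp: Cinf_iff times_differentiable_add periodic_def)

lemma scaleR_const_Cinf [intro]: "f \<in> Cinf \<Longrightarrow> (\<lambda>\<theta>. a *\<^sub>R f \<theta>) \<in> Cinf"
  using scaleR_Cinf[OF const_Cinf] .

lemma minus_Cinf [intro]: "f \<in> Cinf \<Longrightarrow> (\<lambda>\<theta>. - f \<theta>) \<in> Cinf"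
  using scaleR_const_Cinf[of f "-1"] by simp

lemma diff_Cinf [intro]: "f \<in> Cinf \<Longrightarrow> g \<in> Cinf \<Longrightarrow> (\<lambda>\<theta>. f \<theta> - g \<theta>) \<in> Cinf"
  using add_Cinf[OF _ minus_Cinf] by force

lemma sum_Cinf [intro]: "(\<And>i. i \<in> I \<Longrightarrow> f i \<in> Cinf) \<Longrightarrow> (\<lambda>\<theta>. \<Sum>i\<in>I. f i \<theta>) \<in> Cinf"
  by (induction I rule: infinite_finite_induct) auto

lemma ddt_const [simp]: "ddt (\<lambda>\<theta>. a) = (\<lambda>\<theta>. 0)"
  by (rule ddt_eqI) auto

lemma ddt_add: "f \<in> Cinf \<Longrightarrow> g \<in> Cinf \<Longrightarrow> ddt (\<lambda>\<theta>. f \<theta> + g \<theta>) = (\<lambda>\<theta>. ddt f \<theta> + ddt g \<theta>)"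
  by (intro ddt_eqI has_vector_derivative_add Cinf_vector_derivative)

lemma ddt_sum:
  "(\<And>i. i \<in> I \<Longrightarrow> f i \<in> Cinf) \<Longrightarrow> ddt (\<lambda>\<theta>. \<Sum>i\<in>I. f i \<theta>) = (\<lambda>\<theta>. \<Sum>i\<in>I. ddt (f i) \<theta>)"
  by (induction I rule: infinite_finite_induct) (auto simp: ddt_add sum_Cinf)

lemma ddt_bilinear:
  assumes "bounded_bilinear B" "f \<in> Cinf" "g \<in> Cinf"
  shows "ddt (\<lambda>\<theta>. B (f \<theta>) (g \<theta>)) = (\<lambda>\<theta>. B (f \<theta>) (ddt g \<theta>) + B (ddt f \<theta>) (g \<theta>))"
  using assms by (intro ddt_eqI bounded_bilinear.has_vector_derivative) (auto intro: Cinf_vector_derivative)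

lemmas ddt_mult = ddt_bilinear[OF bounded_bilinear_mult]
lemmas ddt_scaleR = ddt_bilinear[OF bounded_bilinear_scaleR]
lemmas ddt_inner = ddt_bilinear[OF bounded_bilinear_inner]

lemma ddt_scaleR_const: "f \<in> Cinf \<Longrightarrow> ddt (\<lambda>\<theta>. a *\<^sub>R f \<theta>) = (\<lambda>\<theta>. a *\<^sub>R ddt f \<theta>)"
  by (subst ddt_scaleR) auto

lemma ddt_diff:
  "f \<in> Cinf \<Longrightarrow> g \<in> Cinf \<Longrightarrow> ddt (\<lambda>\<theta>. f \<theta> - g \<theta>) = (\<lambda>\<theta>. ddt f \<theta> - ddt g \<theta>)"
  by (intro ddt_eqI has_vector_derivative_diff Cinf_vector_derivative)

lemma ddt_pow_add:
  "f \<in> Cinf \<Longrightarrow> g \<in> Cinf \<Longrightarrow>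
    (ddt ^^ k) (\<lambda>\<theta>. f \<theta> + g \<theta>) = (\<lambda>\<theta>. (ddt ^^ k) f \<theta> + (ddt ^^ k) g \<theta>)"
  by (induction k) (auto simp: ddt_add ddt_pow_Cinf)

lemma ddt_pow_diff:
  "f \<in> Cinf \<Longrightarrow> g \<in> Cinf \<Longrightarrow>
    (ddt ^^ k) (\<lambda>\<theta>. f \<theta> - g \<theta>) = (\<lambda>\<theta>. (ddt ^^ k) f \<theta> - (ddt ^^ k) g \<theta>)"
  by (induction k) (auto simp: ddt_diff ddt_pow_Cinf)

lemma ddt_pow_scaleR_const:
  "f \<in> Cinf \<Longrightarrow> (ddt ^^ k) (\<lambda>\<theta>. a *\<^sub>R f \<theta>) = (\<lambda>\<theta>. a *\<^sub>R (ddt ^^ k) f \<theta>)"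
  by (induction k) (auto simp: ddt_scaleR_const ddt_pow_Cinf)

section \<open>Periodicity and compactness of one period\<close>

lemma periodic_shift_int:
  assumes "periodic f"
  shows "f (\<theta> + 2 * pi * of_int m) = f \<theta>"
proof -
  have nat: "f (x + 2 * pi * real j) = f x" for x j
  proof (induction j)
    case (Suc j)
    have "f (x + 2 * pi * real (Suc j)) = f (x + 2 * pi * real j + 2 * pi)"
      by (simp add: algebra_simps)
    then show ?case using Suc assms by (simp add: periodic_def)
  qed simp
  show ?thesis
  proof (cases "m \<ge> 0")
    case True
    then show ?thesis using nat[of \<theta> "nat m"] by simp
  next
    case False
    then show ?thesis using nat[of "\<theta> + 2 * pi * of_int m" "nat (- m)"] by simp
  qed
qed

text \<open>The interval is closed at both ends because it is the compact domain on which suprema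
  are attained and integrals are taken.\<close>

lemma periodic_representative:
  assumes "periodic f"
  obtains x where "x \<in> {0..2*pi}" "f x = f \<theta>"
proof -
  define m where "m = \<lfloor>\<theta> / (2 * pi)\<rfloor>"
  have "of_int m \<le> \<theta> / (2*pi)" "\<theta> / (2*pi) \<le> of_int m + 1"
    unfolding m_def by linarith+
  then have "\<theta> + 2 * pi * of_int (- m) \<in> {0..2*pi}"
    by (simp add: field_simps)
  then show ?thesis
    using that periodic_shift_int[OF assms] by blast
qed

lemma Cinf_bounded:
  assumes "f \<in> Cinf"
  obtains K where "0 < K" "\<And>\<theta>. norm (f \<theta>) \<le> K"
proof -
  have "bounded (f ` {0..2*pi})"
    by (intro compact_imp_bounded compact_continuous_image Cinf_continuous_on assms) simp
  then obtain K where "0 < K" and K: "\<And>\<theta>. \<theta> \<in> {0..2*pi} \<Longrightarrow> norm (f \<theta>) \<le> K"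
    by (auto simp: bounded_pos)
  then show ?thesis
    using that periodic_representative[OF Cinf_periodic[OF assms]] by metis
qed

lemma periodic_compose: "periodic f \<Longrightarrow> periodic (\<lambda>\<theta>. F (f \<theta>))"
  by (simp add: periodic_def)

text \<open>The derivative of 1/a is a polynomial in a' and 1/a itself, so each order of
  differentiability of 1/a yields the next.\<close>

lemma inverse_Cinf:
  fixes a :: "real \<Rightarrow> real"
  assumes a: "a \<in> Cinf" and nz: "\<And>\<theta>. a \<theta> \<noteq> 0"
  shows "(\<lambda>\<theta>. inverse (a \<theta>)) \<in> Cinf"
    and "ddt (\<lambda>\<theta>. inverse (a \<theta>)) = (\<lambda>\<theta>. - (ddt a \<theta> * (inverse (a \<theta>) * inverse (a \<theta>))))"
proof -
  have d: "((\<lambda>\<theta>. inverse (a \<theta>)) has_vector_derivative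
      - (ddt a \<theta> * (inverse (a \<theta>) * inverse (a \<theta>)))) (at \<theta>)" for \<theta>
    using DERIV_inverse'[of a "ddt a \<theta>" \<theta> UNIV] nz Cinf_vector_derivative[OF a]
    by (simp add: has_real_derivative_iff_has_vector_derivative mult_ac)
  then show "ddt (\<lambda>\<theta>. inverse (a \<theta>)) = (\<lambda>\<theta>. - (ddt a \<theta> * (inverse (a \<theta>) * inverse (a \<theta>))))"
    by (rule ddt_eqI)
  have "times_differentiable k (\<lambda>\<theta>. inverse (a \<theta>))" for k
  proof (induction k)
    case 0
    then show ?case using d by (auto simp: differentiable_on_def intro: differentiableI_vector)
  next
    case (Suc k)
    have "times_differentiable k (\<lambda>\<theta>. (- 1) * (ddt a \<theta> * (inverse (a \<theta>) * inverse (a \<theta>))))"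
      using Suc ddt_Cinf[OF a]
      by (intro times_differentiable_bilinear[OF bounded_bilinear_mult] times_differentiable_const)
        (auto simp: Cinf_iff)
    then show ?case by (intro times_differentiable_SucI[OF d]) simp
  qed
  then show "(\<lambda>\<theta>. inverse (a \<theta>)) \<in> Cinf"
    using Cinf_periodic[OF a] by (simp add: Cinf_iff periodic_compose[where F = inverse])
qed

section \<open>The speed of an immersed curve and its reciprocal\<close>

definition speed :: "(real \<Rightarrow> 'a::real_normed_vector) \<Rightarrow> real \<Rightarrow> real" where
  "speed c = (\<lambda>\<theta>. norm (ddt c \<theta>))"

lemma speed_pos: "c \<in> Imm \<Longrightarrow> 0 < speed c \<theta>"
  by (simp add: Imm_def speed_def)

lemma speed_Cinf:
  fixes c :: "real \<Rightarrow> 'a::real_inner"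
  assumes c: "c \<in> Imm"
  shows "speed c \<in> Cinf"
    and "ddt (speed c) = (\<lambda>\<theta>. (ddt (ddt c) \<theta> \<bullet> ddt c \<theta>) * inverse (speed c \<theta>))"
proof -
  have cC: "c \<in> Cinf" using c by (simp add: Imm_def)
  have d: "(speed c has_vector_derivative (ddt (ddt c) \<theta> \<bullet> ddt c \<theta>) * inverse (speed c \<theta>)) (at \<theta>)"
    for \<theta>
  proof -
    have "(ddt c has_derivative (\<lambda>x. x *\<^sub>R ddt (ddt c) \<theta>)) (at \<theta>)"
      using Cinf_vector_derivative[OF ddt_Cinf[OF cC]] by (simp add: has_vector_derivative_def)
    moreover have "ddt c \<theta> \<noteq> 0" using c by (simp add: Imm_def)
    ultimately have "((\<lambda>\<theta>. norm (ddt c \<theta>)) has_derivative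
        (\<lambda>x. (x *\<^sub>R ddt (ddt c) \<theta>) \<bullet> sgn (ddt c \<theta>))) (at \<theta>)"
      using has_derivative_compose[OF _ has_derivative_norm] by blast
    moreover have "ddt (ddt c) \<theta> \<bullet> sgn (ddt c \<theta>) =
        (ddt (ddt c) \<theta> \<bullet> ddt c \<theta>) * inverse (speed c \<theta>)"
      by (simp add: sgn_div_norm speed_def)
    ultimately show ?thesis by (simp add: has_vector_derivative_def speed_def)
  qed
  then show "ddt (speed c) = (\<lambda>\<theta>. (ddt (ddt c) \<theta> \<bullet> ddt c \<theta>) * inverse (speed c \<theta>))"
    by (rule ddt_eqI)
  have nz: "speed c \<theta> \<noteq> 0" for \<theta> using speed_pos[OF c, of \<theta>] by simp
  \<comment> \<open>Both derivatives are built from c', c'' and 1/|c'|, so the two functions are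
    carried through one induction.\<close>
  have "times_differentiable k (speed c) \<and> times_differentiable k (\<lambda>\<theta>. inverse (speed c \<theta>))" for k
  proof (induction k)
    case 0
    have "speed c differentiable_on UNIV"
      using d by (auto simp: differentiable_on_def intro: differentiableI_vector)
    then show ?case using nz by (auto intro: derivative_intros)
  next
    case (Suc k)
    have "times_differentiable k (\<lambda>\<theta>. ddt (ddt c) \<theta> \<bullet> ddt c \<theta>)"
      using inner_Cinf[OF ddt_Cinf[OF ddt_Cinf[OF cC]] ddt_Cinf[OF cC]] by (simp add: Cinf_iff)
    then have 1: "times_differentiable k (\<lambda>\<theta>. (ddt (ddt c) \<theta> \<bullet> ddt c \<theta>) * inverse (speed c \<theta>))"
      using Suc by (intro times_differentiable_bilinear[OF bounded_bilinear_mult]) auto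
    have "((\<lambda>\<theta>. inverse (speed c \<theta>)) has_vector_derivative
      (- 1) * ((ddt (ddt c) \<theta> \<bullet> ddt c \<theta>) * inverse (speed c \<theta>) * (inverse (speed c \<theta>) * inverse (speed c \<theta>))))
      (at \<theta>)" for \<theta>
      using DERIV_inverse'[OF iffD2[OF has_real_derivative_iff_has_vector_derivative d] nz, of \<theta>]
      by (simp add: has_real_derivative_iff_has_vector_derivative mult_ac)
    moreover have "times_differentiable k (\<lambda>\<theta>. (- 1) *
        ((ddt (ddt c) \<theta> \<bullet> ddt c \<theta>) * inverse (speed c \<theta>) * (inverse (speed c \<theta>) * inverse (speed c \<theta>))))"
      using times_differentiable_bilinear[OF bounded_bilinear_mult times_differentiable_const
          times_differentiable_bilinear[OF bounded_bilinear_mult 1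
            times_differentiable_bilinear[OF bounded_bilinear_mult Suc[THEN conjunct2] Suc[THEN conjunct2]]]]
      by blast
    ultimately have "times_differentiable (Suc k) (\<lambda>\<theta>. inverse (speed c \<theta>))"
      by (rule times_differentiable_SucI)
    then show ?case
      using times_differentiable_SucI[OF d 1] by simp
  qed
  moreover have "periodic (speed c)"
    unfolding speed_def using Cinf_periodic[OF ddt_Cinf[OF cC]] by (rule periodic_compose)
  ultimately show "speed c \<in> Cinf" by (simp add: Cinf_iff)
qed

lemma inverse_speed_Cinf:
  fixes c :: "real \<Rightarrow> 'a::real_inner"
  assumes "c \<in> Imm"
  shows "(\<lambda>\<theta>. inverse (speed c \<theta>)) \<in> Cinf"
    and "ddt (\<lambda>\<theta>. inverse (speed c \<theta>)) =
      (\<lambda>\<theta>. - (ddt (speed c) \<theta> * (inverse (speed c \<theta>) * inverse (speed c \<theta>))))"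
  using inverse_Cinf[OF speed_Cinf(1)[OF assms]] speed_pos[OF assms] by (metis less_irrefl)+

subsection \<open>Changing the parametrization of derivatives\<close>

text \<open>A common form for \<open>ddt\<close> (weight 1) and for the arc length derivative
  (weight 1/|c'|), so that one expansion formula serves both directions of the comparison.\<close>

definition wder :: "(real \<Rightarrow> real) \<Rightarrow> (real \<Rightarrow> 'b::real_normed_vector) \<Rightarrow> real \<Rightarrow> 'b" where
  "wder \<alpha> f = (\<lambda>\<theta>. \<alpha> \<theta> *\<^sub>R ddt f \<theta>)"

lemma wder_one: "wder (\<lambda>\<theta>. 1) = ddt"
  by (simp add: wder_def fun_eq_iff)

lemma arc_deriv_ddt_eq_wder: "arc_deriv ddt c = wder (\<lambda>\<theta>. inverse (speed c \<theta>))"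
  by (simp add: arc_deriv_def wder_def speed_def fun_eq_iff)

lemma wder_pow_Cinf: "\<alpha> \<in> Cinf \<Longrightarrow> f \<in> Cinf \<Longrightarrow> (wder \<alpha> ^^ k) f \<in> Cinf"
  by (induction k) (auto simp: wder_def intro!: scaleR_Cinf)

text \<open>
  The coefficients of $(\alpha\partial)^k = \sum_j q_{k,j} (\delta\partial)^j$ where
  $\alpha = \beta\delta$.
\<close>

fun coef :: "(real \<Rightarrow> real) \<Rightarrow> (real \<Rightarrow> real) \<Rightarrow> nat \<Rightarrow> nat \<Rightarrow> real \<Rightarrow> real" where
  "coef \<alpha> \<beta> 0 j = (\<lambda>\<theta>. if j = 0 then 1 else 0)"
| "coef \<alpha> \<beta> (Suc k) j =
     (\<lambda>\<theta>. \<alpha> \<theta> * ddt (coef \<alpha> \<beta> k j) \<theta> + \<beta> \<theta> * (if j = 0 then 0 else coef \<alpha> \<beta> k (j - 1) \<theta>))"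

lemma coef_Cinf: "\<alpha> \<in> Cinf \<Longrightarrow> \<beta> \<in> Cinf \<Longrightarrow> coef \<alpha> \<beta> k j \<in> Cinf"
proof (induction k arbitrary: j)
  case (Suc k)
  then show ?case by (cases "j = 0") (auto intro!: add_Cinf mult_Cinf ddt_Cinf)
qed simp

lemma coef_eq_0: "k < j \<Longrightarrow> coef \<alpha> \<beta> k j = (\<lambda>\<theta>. 0)"
  by (induction k arbitrary: j) auto

text \<open>The operator differentiates first and so kills constants: no expansion of positive order
  has a term of order zero.\<close>

lemma coef_Suc_0: "coef \<alpha> \<beta> (Suc k) 0 = (\<lambda>\<theta>. 0)"
  by (induction k) auto

text \<open>The vectors \<open>x j\<close> are arbitrary, so that the identity applies to classical
  derivatives and also, almost everywhere, to weak ones.\<close>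

lemma coef_sum_Suc:
  "(\<Sum>j\<le>k. (\<alpha> \<theta> * ddt (coef \<alpha> \<beta> k j) \<theta>) *\<^sub>R x j + (\<beta> \<theta> * coef \<alpha> \<beta> k j \<theta>) *\<^sub>R x (Suc j)) =
    (\<Sum>j\<le>Suc k. coef \<alpha> \<beta> (Suc k) j \<theta> *\<^sub>R (x j :: 'b::real_vector))"
proof -
  have "(\<Sum>j\<le>k. (\<beta> \<theta> * coef \<alpha> \<beta> k j \<theta>) *\<^sub>R x (Suc j)) =
      (\<Sum>j\<le>Suc k. (\<beta> \<theta> * (if j = 0 then 0 else coef \<alpha> \<beta> k (j - 1) \<theta>)) *\<^sub>R x j)"
    by (subst sum.atMost_Suc_shift) simp
  moreover have "(\<Sum>j\<le>k. (\<alpha> \<theta> * ddt (coef \<alpha> \<beta> k j) \<theta>) *\<^sub>R x j) =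
      (\<Sum>j\<le>Suc k. (\<alpha> \<theta> * ddt (coef \<alpha> \<beta> k j) \<theta>) *\<^sub>R x j)"
    by (simp add: coef_eq_0)
  ultimately show ?thesis
    by (simp only: sum.distrib coef.simps scaleR_add_left)
qed

text \<open>Product rule: when \<alpha>\<partial> falls on a coefficient the order j stays, and when
  it falls on the j-th derivative, \<alpha> = \<beta>\<delta> turns it into \<beta> times the
  derivative of order j + 1.\<close>

lemma wder_pow_expand:
  assumes \<alpha>: "\<alpha> \<in> Cinf" and \<beta>: "\<beta> \<in> Cinf" and \<delta>: "\<delta> \<in> Cinf"
    and eq: "\<And>\<theta>. \<alpha> \<theta> = \<beta> \<theta> * \<delta> \<theta>" and f: "f \<in> Cinf"
  shows "(wder \<alpha> ^^ k) f = (\<lambda>\<theta>. \<Sum>j\<le>k. coef \<alpha> \<beta> k j \<theta> *\<^sub>R (wder \<delta> ^^ j) f \<theta>)"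
proof (induction k)
  case (Suc k)
  let ?q = "coef \<alpha> \<beta>" and ?D = "\<lambda>j. (wder \<delta> ^^ j) f"
  have Cinf: "?q k j \<in> Cinf" "?D j \<in> Cinf" for j
    by (auto intro: coef_Cinf wder_pow_Cinf assms)
  have "(wder \<alpha> ^^ Suc k) f = wder \<alpha> (\<lambda>\<theta>. \<Sum>j\<le>k. ?q k j \<theta> *\<^sub>R ?D j \<theta>)"
    using Suc by simp
  also have "\<dots> = (\<lambda>\<theta>. \<Sum>j\<le>k. (\<alpha> \<theta> * ddt (?q k j) \<theta>) *\<^sub>R ?D j \<theta> + (\<beta> \<theta> * ?q k j \<theta>) *\<^sub>R ?D (Suc j) \<theta>)"
  proof
    fix \<theta>
    have "ddt (\<lambda>\<theta>. \<Sum>j\<le>k. ?q k j \<theta> *\<^sub>R ?D j \<theta>) = (\<lambda>\<theta>. \<Sum>j\<le>k. ddt (\<lambda>\<theta>. ?q k j \<theta> *\<^sub>R ?D j \<theta>) \<theta>)"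
      by (rule ddt_sum) (intro scaleR_Cinf Cinf)
    also have "\<dots> = (\<lambda>\<theta>. \<Sum>j\<le>k. ?q k j \<theta> *\<^sub>R ddt (?D j) \<theta> + ddt (?q k j) \<theta> *\<^sub>R ?D j \<theta>)"
      by (simp only: ddt_scaleR[OF Cinf])
    finally have "wder \<alpha> (\<lambda>\<theta>. \<Sum>j\<le>k. ?q k j \<theta> *\<^sub>R ?D j \<theta>) \<theta> =
        (\<Sum>j\<le>k. \<alpha> \<theta> *\<^sub>R (?q k j \<theta> *\<^sub>R ddt (?D j) \<theta> + ddt (?q k j) \<theta> *\<^sub>R ?D j \<theta>))"
      by (simp only: wder_def[of \<alpha>] scaleR_sum_right)
    also have "\<dots> = (\<Sum>j\<le>k. (\<alpha> \<theta> * ddt (?q k j) \<theta>) *\<^sub>R ?D j \<theta> + (\<beta> \<theta> * ?q k j \<theta>) *\<^sub>R ?D (Suc j) \<theta>)"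
      by (intro sum.cong refl) (simp add: wder_def[of \<delta>] eq scaleR_add_right mult_ac)
    finally show "wder \<alpha> (\<lambda>\<theta>. \<Sum>j\<le>k. ?q k j \<theta> *\<^sub>R ?D j \<theta>) \<theta> = \<dots>" .
  qed
  also have "\<dots> = (\<lambda>\<theta>. \<Sum>j\<le>Suc k. ?q (Suc k) j \<theta> *\<^sub>R ?D j \<theta>)"
    by (rule ext) (rule coef_sum_Suc)
  finally show ?case .
qed simp

subsection \<open>Uniform bounds with a weight on the top derivative\<close>

text \<open>Orders below m are bounded by constants and only order m by a multiple of w. With w = 1
  + |top derivative of c| this records that the top derivative of the curve enters at most linearly,
  which is what keeps the later growth estimates linear.\<close>

fun unif_bdd ::
  "'i set \<Rightarrow> nat \<Rightarrow> ('i \<Rightarrow> real \<Rightarrow> real) \<Rightarrow> ('i \<Rightarrow> real \<Rightarrow> 'b::real_normed_vector) \<Rightarrow> bool" where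
  "unif_bdd X 0 w f \<longleftrightarrow> (\<exists>K. \<forall>c\<in>X. \<forall>\<theta>. norm (f c \<theta>) \<le> K * w c \<theta>)"
| "unif_bdd X (Suc m) w f \<longleftrightarrow>
     (\<exists>K. \<forall>c\<in>X. \<forall>\<theta>. norm (f c \<theta>) \<le> K) \<and> unif_bdd X m w (\<lambda>c. ddt (f c))"

abbreviation "unit_weight \<equiv> (\<lambda>c \<theta>. 1 :: real)"

lemma unif_bdd_0_pos:
  assumes "unif_bdd X 0 w f" "\<And>c \<theta>. 1 \<le> w c \<theta>"
  obtains K where "0 < K" "\<And>c \<theta>. c \<in> X \<Longrightarrow> norm (f c \<theta>) \<le> K * w c \<theta>"
proof -
  obtain K where K: "\<forall>c\<in>X. \<forall>\<theta>. norm (f c \<theta>) \<le> K * w c \<theta>" using assms(1) by auto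
  have "norm (f c \<theta>) \<le> (\<bar>K\<bar> + 1) * w c \<theta>" if "c \<in> X" for c \<theta>
  proof -
    have "K * w c \<theta> \<le> (\<bar>K\<bar> + 1) * w c \<theta>"
      using assms(2)[of c \<theta>] by (intro mult_right_mono) auto
    then show ?thesis using K that by (meson order_trans)
  qed
  moreover have "0 < \<bar>K\<bar> + 1" by simp
  ultimately show ?thesis using that by blast
qed

lemma unif_bdd_weight:
  assumes "\<And>c \<theta>. 1 \<le> w c \<theta>"
  shows "unif_bdd X m unit_weight f \<Longrightarrow> unif_bdd X m w f"
proof (induction m arbitrary: f)
  case 0
  obtain K where "0 < K" and K: "\<And>c \<theta>. c \<in> X \<Longrightarrow> norm (f c \<theta>) \<le> K * 1"
    using unif_bdd_0_pos[OF 0] by (metis order_refl)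
  have "norm (f c \<theta>) \<le> K * w c \<theta>" if "c \<in> X" for c \<theta>
    using K[OF that, of \<theta>] mult_left_mono[OF assms[of c \<theta>], of K] \<open>0 < K\<close> by linarith
  then show ?case by auto
qed auto

text \<open>Giving up one order removes the weight.\<close>

lemma unif_bdd_SucD: "unif_bdd X (Suc m) w f \<Longrightarrow> unif_bdd X m unit_weight f"
  by (induction m arbitrary: f) auto

lemma unif_bdd_lower:
  assumes "unif_bdd X m w f" "k < m"
  shows "unif_bdd X k unit_weight f"
proof -
  have "k < m \<Longrightarrow> unif_bdd X m w f \<Longrightarrow> unif_bdd X k unit_weight f"
  proof (induction m arbitrary: w)
    case (Suc m)
    have "unif_bdd X m unit_weight f" using unif_bdd_SucD Suc.prems(2) .
    then show ?case using Suc.IH[of unit_weight] Suc.prems(1) by (cases "k = m") simp_all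
  qed simp
  then show ?thesis using assms by blast
qed

lemma unif_bdd_unit_mono: "unif_bdd X m unit_weight f \<Longrightarrow> k \<le> m \<Longrightarrow> unif_bdd X k unit_weight f"
  using unif_bdd_lower[of X m unit_weight f k] by (cases "k = m") simp_all

lemma unif_bdd_cong:
  assumes "\<And>c. c \<in> X \<Longrightarrow> f c = g c"
  shows "unif_bdd X m w f \<longleftrightarrow> unif_bdd X m w g"
  using assms
proof (induction m arbitrary: f g)
  case (Suc m)
  then have "unif_bdd X m w (\<lambda>c. ddt (f c)) \<longleftrightarrow> unif_bdd X m w (\<lambda>c. ddt (g c))"
    by (intro Suc.IH) simp
  then show ?case using Suc.prems by simp
qed simp

lemma unif_bdd_const: "(\<And>c \<theta>. 1 \<le> w c \<theta>) \<Longrightarrow> unif_bdd X m w (\<lambda>c \<theta>. a)"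
proof (rule unif_bdd_weight)
  show "unif_bdd X m unit_weight (\<lambda>c \<theta>. a)"
  proof (induction m arbitrary: a)
    case (Suc m)
    then show ?case by simp blast
  qed auto
qed

lemma unif_bdd_add:
  assumes "\<And>c. c \<in> X \<Longrightarrow> f c \<in> Cinf" "\<And>c. c \<in> X \<Longrightarrow> g c \<in> Cinf"
  shows "unif_bdd X m w f \<Longrightarrow> unif_bdd X m w g \<Longrightarrow> unif_bdd X m w (\<lambda>c \<theta>. f c \<theta> + g c \<theta>)"
  using assms
proof (induction m arbitrary: f g)
  case 0
  then obtain K L where "\<forall>c\<in>X. \<forall>\<theta>. norm (f c \<theta>) \<le> K * w c \<theta>" "\<forall>c\<in>X. \<forall>\<theta>. norm (g c \<theta>) \<le> L * w c \<theta>"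
    by auto
  then have "\<forall>c\<in>X. \<forall>\<theta>. norm (f c \<theta> + g c \<theta>) \<le> (K + L) * w c \<theta>"
    by (simp add: distrib_right norm_triangle_le add_mono)
  then show ?case by auto
next
  case (Suc m)
  then obtain K L where "\<forall>c\<in>X. \<forall>\<theta>. norm (f c \<theta>) \<le> K" "\<forall>c\<in>X. \<forall>\<theta>. norm (g c \<theta>) \<le> L" by auto
  then have "\<forall>c\<in>X. \<forall>\<theta>. norm (f c \<theta> + g c \<theta>) \<le> K + L"
    by (simp add: norm_triangle_le add_mono)
  moreover have "unif_bdd X m w (\<lambda>c \<theta>. ddt (f c) \<theta> + ddt (g c) \<theta>)"
    using Suc.prems by (intro Suc.IH) auto
  then have "unif_bdd X m w (\<lambda>c. ddt (\<lambda>\<theta>. f c \<theta> + g c \<theta>))"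
    by (rule unif_bdd_cong[THEN iffD2, rotated]) (simp add: ddt_add Suc.prems)
  ultimately show ?case by auto
qed

text \<open>Only one factor carries the weight. Its m-th derivative meets the other factor
  undifferentiated, so weights never multiply.\<close>

lemma unif_bdd_bilinear:
  assumes B: "bounded_bilinear B" and w: "\<And>c \<theta>. 1 \<le> w c \<theta>"
    and "unif_bdd X m w f" "unif_bdd X m unit_weight g"
    and "\<And>c. c \<in> X \<Longrightarrow> f c \<in> Cinf" "\<And>c. c \<in> X \<Longrightarrow> g c \<in> Cinf"
  shows "unif_bdd X m w (\<lambda>c \<theta>. B (f c \<theta>) (g c \<theta>))"
proof -
  obtain M where "0 < M" and M: "\<And>x y. norm (B x y) \<le> norm x * norm y * M"
    using bounded_bilinear.pos_bounded[OF B] by blast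
  have bound: "norm (B x y) \<le> (K * L * M) * v" if "norm x \<le> K * v" "norm y \<le> L" for x y K L v
  proof -
    have "norm x * norm y * M \<le> (K * v) * L * M"
      using that \<open>0 < M\<close> by (intro mult_right_mono mult_mono) (auto intro: order_trans[OF norm_ge_zero])
    then show ?thesis using M[of x y] by (simp add: mult_ac)
  qed
  have "unif_bdd X m w f \<Longrightarrow> unif_bdd X m unit_weight g \<Longrightarrow> (\<And>c. c \<in> X \<Longrightarrow> f c \<in> Cinf) \<Longrightarrow>
     (\<And>c. c \<in> X \<Longrightarrow> g c \<in> Cinf) \<Longrightarrow> (\<And>c \<theta>. 1 \<le> w c \<theta>) \<Longrightarrow>
     unif_bdd X m w (\<lambda>c \<theta>. B (f c \<theta>) (g c \<theta>))"
  proof (induction m arbitrary: f g w)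
    case 0
    then obtain K L where "\<forall>c\<in>X. \<forall>\<theta>. norm (f c \<theta>) \<le> K * w c \<theta>" "\<forall>c\<in>X. \<forall>\<theta>. norm (g c \<theta>) \<le> L"
      by auto
    then have "\<forall>c\<in>X. \<forall>\<theta>. norm (B (f c \<theta>) (g c \<theta>)) \<le> (K * L * M) * w c \<theta>"
      using bound by simp
    then show ?case unfolding unif_bdd.simps by blast
  next
    case (Suc m)
    then obtain K L where "\<forall>c\<in>X. \<forall>\<theta>. norm (f c \<theta>) \<le> K * 1" "\<forall>c\<in>X. \<forall>\<theta>. norm (g c \<theta>) \<le> L" by auto
    then have "\<forall>c\<in>X. \<forall>\<theta>. norm (B (f c \<theta>) (g c \<theta>)) \<le> (K * L * M) * 1"
      using bound[where v = 1] by simp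
    then have 1: "\<exists>K. \<forall>c\<in>X. \<forall>\<theta>. norm (B (f c \<theta>) (g c \<theta>)) \<le> K" by auto
    \<comment> \<open>In this half of the product rule f is needed only to order m, where it carries
      no weight yet.\<close>
    have "unif_bdd X m unit_weight (\<lambda>c \<theta>. B (f c \<theta>) (ddt (g c) \<theta>))"
      using Suc.prems(2-4) unif_bdd_SucD[OF Suc.prems(1)] by (intro Suc.IH) auto
    then have "unif_bdd X m w (\<lambda>c \<theta>. B (f c \<theta>) (ddt (g c) \<theta>))"
      using Suc.prems(5) by (rule unif_bdd_weight[rotated])
    moreover have "unif_bdd X m w (\<lambda>c \<theta>. B (ddt (f c) \<theta>) (g c \<theta>))"
      using Suc.prems(1,3-5) unif_bdd_SucD[OF Suc.prems(2)] by (intro Suc.IH) auto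
    ultimately have "unif_bdd X m w (\<lambda>c \<theta>. B (f c \<theta>) (ddt (g c) \<theta>) + B (ddt (f c) \<theta>) (g c \<theta>))"
      using Suc.prems(3,4) by (intro unif_bdd_add bilinear_Cinf[OF B] ddt_Cinf) auto
    then have "unif_bdd X m w (\<lambda>c. ddt (\<lambda>\<theta>. B (f c \<theta>) (g c \<theta>)))"
      by (rule unif_bdd_cong[THEN iffD2, rotated]) (simp add: ddt_bilinear[OF B] Suc.prems)
    then show ?case using 1 by simp
  qed
  then show ?thesis using assms by blast
qed

lemmas unif_bdd_mult = unif_bdd_bilinear[OF bounded_bilinear_mult]

lemma unif_bdd_mult':
  fixes f g :: "'i \<Rightarrow> real \<Rightarrow> real"
  assumes "\<And>c \<theta>. 1 \<le> w c \<theta>" "unif_bdd X m unit_weight f" "unif_bdd X m w g"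
    "\<And>c. c \<in> X \<Longrightarrow> f c \<in> Cinf" "\<And>c. c \<in> X \<Longrightarrow> g c \<in> Cinf"
  shows "unif_bdd X m w (\<lambda>c \<theta>. f c \<theta> * g c \<theta>)"
  using unif_bdd_mult[OF assms(1,3,2,5,4)] by (simp add: mult.commute)

text \<open>The derivatives of |c'| and of 1/|c'| are linear in the top derivative of the curve,
  with factors of lower order. The weight of \<open>ddt\<close> is therefore inherited unchanged;
  the bound a from below enters through the reciprocal.\<close>

lemma unif_bdd_speed:
  fixes X :: "(real \<Rightarrow> 'a::real_inner) set"
  assumes X: "X \<subseteq> Imm" and a: "0 < a" "\<And>c \<theta>. c \<in> X \<Longrightarrow> a \<le> speed c \<theta>"
    and w: "\<And>c \<theta>. 1 \<le> w c \<theta>" and bdd: "unif_bdd X m w ddt"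
  shows "unif_bdd X m w speed \<and> unif_bdd X m w (\<lambda>c \<theta>. inverse (speed c \<theta>))"
proof -
  have cC: "c \<in> X \<Longrightarrow> c \<in> Cinf" and cI: "c \<in> X \<Longrightarrow> c \<in> Imm" for c using X by (auto simp: Imm_def)
  have inv: "norm (inverse (speed c \<theta>)) \<le> inverse a" if "c \<in> X" for c \<theta>
    using a(1) a(2)[OF that, of \<theta>] by (simp add: le_imp_inverse_le)
  have "unif_bdd X m w ddt \<Longrightarrow> (\<And>c \<theta>. 1 \<le> w c \<theta>) \<Longrightarrow>
      unif_bdd X m w speed \<and> unif_bdd X m w (\<lambda>c \<theta>. inverse (speed c \<theta>))"
  proof (induction m arbitrary: w)
    case 0
    have "norm (inverse (speed c \<theta>)) \<le> inverse a * w c \<theta>" if "c \<in> X" for c \<theta>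
      using inv[OF that, of \<theta>] mult_left_mono[OF 0(2)[of c \<theta>], of "inverse a"] a(1)
      unfolding mult_1_right by (meson inverse_nonnegative_iff_nonnegative less_imp_le order_trans)
    then show ?case using 0 by (auto simp: speed_def simp del: norm_inverse)
  next
    case (Suc m)
    have IH: "unif_bdd X m unit_weight speed" "unif_bdd X m unit_weight (\<lambda>c \<theta>. inverse (speed c \<theta>))"
      using Suc.IH[of unit_weight] unif_bdd_SucD[OF Suc.prems(1)] by auto
    have "unif_bdd X m w (\<lambda>c \<theta>. (ddt (ddt c) \<theta> \<bullet> ddt c \<theta>))"
      using Suc.prems unif_bdd_SucD[OF Suc.prems(1)]
      by (intro unif_bdd_bilinear[OF bounded_bilinear_inner] ddt_Cinf cC) auto
    then have "unif_bdd X m w (\<lambda>c \<theta>. (ddt (ddt c) \<theta> \<bullet> ddt c \<theta>) * inverse (speed c \<theta>))"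
      using IH Suc.prems by (intro unif_bdd_mult inner_Cinf ddt_Cinf inverse_speed_Cinf cC cI) auto
    then have 1: "unif_bdd X m w (\<lambda>c. ddt (speed c))"
      by (rule unif_bdd_cong[THEN iffD2, rotated]) (use cI speed_Cinf in auto)
    have "unif_bdd X m w (\<lambda>c \<theta>. (-1) * (ddt (speed c) \<theta> * (inverse (speed c \<theta>) * inverse (speed c \<theta>))))"
      using IH 1 Suc.prems
      by (intro unif_bdd_mult unif_bdd_mult' unif_bdd_const mult_Cinf const_Cinf ddt_Cinf
          speed_Cinf inverse_speed_Cinf cI) auto
    then have "unif_bdd X m w (\<lambda>c. ddt (\<lambda>\<theta>. inverse (speed c \<theta>)))"
      by (rule unif_bdd_cong[THEN iffD2, rotated]) (use cI inverse_speed_Cinf in auto)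
    moreover have "\<exists>K. \<forall>c\<in>X. \<forall>\<theta>. norm (speed c \<theta>) \<le> K"
      using Suc.prems by (auto simp: speed_def)
    ultimately show ?case using 1 inv by (auto simp del: norm_inverse)
  qed
  then show ?thesis using bdd w by blast
qed

text \<open>Passing from k to k + 1 either differentiates a coefficient or raises j, so
  \<open>coef _ _ k j\<close> contains at most k - j derivatives of the weights. For j > k it
  vanishes, and truncated subtraction does no harm.\<close>

lemma unif_bdd_coef:
  assumes \<alpha>: "\<And>c. c \<in> X \<Longrightarrow> \<alpha> c \<in> Cinf" and \<beta>: "\<And>c. c \<in> X \<Longrightarrow> \<beta> c \<in> Cinf"
  shows "unif_bdd X (m + k - j) unit_weight \<alpha> \<Longrightarrow> unif_bdd X (m + k - j) unit_weight \<beta> \<Longrightarrow>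
    unif_bdd X m unit_weight (\<lambda>c. coef (\<alpha> c) (\<beta> c) k j)"
proof (induction k arbitrary: j m)
  case 0
  then show ?case by (cases "j = 0") (auto intro: unif_bdd_const)
next
  case (Suc k)
  show ?case
  proof (cases "j \<le> Suc k")
    case False
    then show ?thesis using unif_bdd_const[of unit_weight X m 0] by (simp add: coef_eq_0 del: coef.simps)
  next
    case j: True
    have m: "unif_bdd X m unit_weight \<alpha>" "unif_bdd X m unit_weight \<beta>"
      using j by (auto intro!: unif_bdd_unit_mono[OF Suc.prems(1)] unif_bdd_unit_mono[OF Suc.prems(2)])
    have Cinf: "coef (\<alpha> c) (\<beta> c) k i \<in> Cinf" if "c \<in> X" for c i
      using \<alpha> \<beta> that by (intro coef_Cinf) auto
    have "unif_bdd X m unit_weight (\<lambda>c. ddt (coef (\<alpha> c) (\<beta> c) k j))"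
    proof (cases "j \<le> k")
      case True
      then show ?thesis using Suc.IH[of "Suc m" j] Suc.prems by simp
    next
      case False
      then show ?thesis using unif_bdd_const[of unit_weight X m 0] by (simp add: coef_eq_0)
    qed
    moreover have "unif_bdd X m unit_weight (\<lambda>c \<theta>. if j = 0 then 0 else coef (\<alpha> c) (\<beta> c) k (j - 1) \<theta>)"
    proof (cases "j = 0")
      case False
      then have "m + k - (j - 1) = m + Suc k - j" by simp
      then show ?thesis using Suc.IH[of m "j - 1"] Suc.prems False by simp
    qed (auto intro: unif_bdd_const)
    moreover have "(\<lambda>\<theta>. if j = 0 then 0 else coef (\<alpha> c) (\<beta> c) k (j - 1) \<theta>) \<in> Cinf" if "c \<in> X" for c
      using Cinf[OF that] by (cases "j = 0") auto
    ultimately show ?thesis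
      unfolding coef.simps using m \<alpha> \<beta> Cinf by (intro unif_bdd_add unif_bdd_mult mult_Cinf ddt_Cinf) auto
  qed
qed

text \<open>Since the coefficient of order zero vanishes, the recursion for j = 1 has a single term:
  it starts at \<beta> and maps q to \<alpha> q'. The k-th derivatives of the weights thus appear
  without being multiplied by each other.\<close>

lemma unif_bdd_coef_1:
  assumes \<alpha>: "\<And>c. c \<in> X \<Longrightarrow> \<alpha> c \<in> Cinf" and \<beta>: "\<And>c. c \<in> X \<Longrightarrow> \<beta> c \<in> Cinf"
    and w: "\<And>c \<theta>. 1 \<le> w c \<theta>"
  shows "unif_bdd X (m + k) w \<alpha> \<Longrightarrow> unif_bdd X (m + k) w \<beta> \<Longrightarrow>
    unif_bdd X m w (\<lambda>c. coef (\<alpha> c) (\<beta> c) (Suc k) 1)"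
proof (induction k arbitrary: m)
  case 0
  then show ?case by simp
next
  case (Suc k)
  have "unif_bdd X m unit_weight \<alpha>"
    by (rule unif_bdd_lower[OF Suc.prems(1)]) simp
  moreover have "unif_bdd X m w (\<lambda>c. ddt (coef (\<alpha> c) (\<beta> c) (Suc k) 1))"
    using Suc.IH[of "Suc m"] Suc.prems by simp
  ultimately have "unif_bdd X m w (\<lambda>c \<theta>. \<alpha> c \<theta> * ddt (coef (\<alpha> c) (\<beta> c) (Suc k) 1) \<theta>)"
    using \<alpha> \<beta> w by (intro unif_bdd_mult' ddt_Cinf coef_Cinf) auto
  then show ?case
    by (subst coef.simps) (simp add: coef_Suc_0 del: coef.simps)
qed

lemma wder_pow_bound:
  assumes \<alpha>: "\<And>c. c \<in> X \<Longrightarrow> \<alpha> c \<in> Cinf" and \<beta>: "\<And>c. c \<in> X \<Longrightarrow> \<beta> c \<in> Cinf"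
    and \<delta>: "\<And>c. c \<in> X \<Longrightarrow> \<delta> c \<in> Cinf" and eq: "\<And>c \<theta>. c \<in> X \<Longrightarrow> \<alpha> c \<theta> = \<beta> c \<theta> * \<delta> c \<theta>"
    and w: "\<And>c \<theta>. 1 \<le> w c \<theta>"
    and bdd: "unif_bdd X k w \<alpha>" "unif_bdd X k w \<beta>"
  shows "\<exists>K>0. \<forall>c\<in>X. \<forall>f\<in>Cinf. \<forall>\<theta>. norm ((wder (\<alpha> c) ^^ Suc k) f \<theta> :: 'b::real_normed_vector) \<le>
    K * (w c \<theta> * norm (wder (\<delta> c) f \<theta>) + (\<Sum>j\<in>{2..Suc k}. norm ((wder (\<delta> c) ^^ j) f \<theta>)))"
proof -
  let ?q = "\<lambda>j c. coef (\<alpha> c) (\<beta> c) (Suc k) j"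
  have "unif_bdd X 0 w (?q 1)" using unif_bdd_coef_1[OF \<alpha> \<beta> w, where m = 0 and k = k] bdd by simp
  then obtain K1 where K1: "0 < K1" "\<And>c \<theta>. c \<in> X \<Longrightarrow> norm (?q 1 c \<theta>) \<le> K1 * w c \<theta>"
    by (rule unif_bdd_0_pos) (use w in auto)
  have "\<exists>K>0. \<forall>c\<in>X. \<forall>\<theta>. norm (?q j c \<theta>) \<le> K" if "j \<in> {2..Suc k}" for j
  proof -
    \<comment> \<open>For j at least 2 at most k - 1 derivatives of \<alpha> and \<beta> occur,
      which is below the weighted order.\<close>
    have "unif_bdd X 0 unit_weight (?q j)"
      using that by (intro unif_bdd_coef \<alpha> \<beta> unif_bdd_lower[OF bdd(1)] unif_bdd_lower[OF bdd(2)]) auto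
    then obtain K where "0 < K" "\<And>c \<theta>. c \<in> X \<Longrightarrow> norm (?q j c \<theta>) \<le> K * 1"
      by (rule unif_bdd_0_pos) auto
    then show ?thesis unfolding mult_1_right by blast
  qed
  then obtain L where L: "\<And>j. j \<in> {2..Suc k} \<Longrightarrow> 0 < L j"
    "\<And>j c \<theta>. j \<in> {2..Suc k} \<Longrightarrow> c \<in> X \<Longrightarrow> norm (?q j c \<theta>) \<le> L j"
    by metis
  define K where "K = K1 + (\<Sum>j\<in>{2..Suc k}. L j)"
  have "0 \<le> (\<Sum>j\<in>{2..Suc k}. L j)" using L(1) by (intro sum_nonneg) (simp add: less_imp_le)
  then have K: "K1 \<le> K" "0 < K" using K1(1) by (auto simp: K_def)
  have LK: "L j \<le> K" if "j \<in> {2..Suc k}" for j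
    using K1(1) member_le_sum[OF that, of L] L(1) by (auto simp: K_def less_imp_le)
  have "norm ((wder (\<alpha> c) ^^ Suc k) f \<theta>) \<le>
      K * (w c \<theta> * norm (wder (\<delta> c) f \<theta>) + (\<Sum>j\<in>{2..Suc k}. norm ((wder (\<delta> c) ^^ j) f \<theta>)))"
    if c: "c \<in> X" and f: "f \<in> Cinf" for c \<theta> and f :: "real \<Rightarrow> 'b"
  proof -
    let ?D = "\<lambda>j. (wder (\<delta> c) ^^ j) f \<theta>"
    have "{..Suc k} = insert 0 (insert 1 {2..Suc k})" by auto
    then have "(wder (\<alpha> c) ^^ Suc k) f \<theta> = ?q 1 c \<theta> *\<^sub>R ?D 1 + (\<Sum>j\<in>{2..Suc k}. ?q j c \<theta> *\<^sub>R ?D j)"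
      using wder_pow_expand[OF \<alpha>[OF c] \<beta>[OF c] \<delta>[OF c] eq[OF c] f, of "Suc k"]
      by (simp add: coef_Suc_0 del: coef.simps)
    moreover have "norm (?q 1 c \<theta> *\<^sub>R ?D 1) \<le> K * (w c \<theta> * norm (?D 1))"
    proof -
      have "norm (?q 1 c \<theta>) \<le> K * w c \<theta>"
        using K1(2)[OF c, of \<theta>] K mult_right_mono[of K1 K "w c \<theta>"] w[of c \<theta>] by linarith
      then have "norm (?q 1 c \<theta>) * norm (?D 1) \<le> (K * w c \<theta>) * norm (?D 1)"
        by (rule mult_right_mono) simp
      then show ?thesis by (simp del: coef.simps)
    qed
    moreover have "norm (\<Sum>j\<in>{2..Suc k}. ?q j c \<theta> *\<^sub>R ?D j) \<le> (\<Sum>j\<in>{2..Suc k}. K * norm (?D j))"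
    proof (rule sum_norm_le)
      fix j assume j: "j \<in> {2..Suc k}"
      have "norm (?q j c \<theta>) \<le> K" using L(2)[OF j c, of \<theta>] LK[OF j] by linarith
      then have "norm (?q j c \<theta>) * norm (?D j) \<le> K * norm (?D j)"
        by (rule mult_right_mono) simp
      then show "norm (?q j c \<theta> *\<^sub>R ?D j) \<le> K * norm (?D j)" by (simp del: coef.simps)
    qed
    ultimately have "norm ((wder (\<alpha> c) ^^ Suc k) f \<theta>) \<le>
        K * (w c \<theta> * norm (?D 1)) + (\<Sum>j\<in>{2..Suc k}. K * norm (?D j))"
      by (simp only: norm_triangle_le add_mono)
    then show ?thesis
      by (simp only: distrib_left sum_distrib_left) simp
  qed
  then show ?thesis using K(2) by blast
qed

lemma unif_bdd_ddt:
  assumes "\<And>j. 1 \<le> j \<Longrightarrow> j \<le> k \<Longrightarrow> \<exists>K. \<forall>c\<in>X. \<forall>\<theta>. norm ((ddt ^^ j) c \<theta>) \<le> K"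
  shows "unif_bdd X k (\<lambda>c \<theta>. 1 + norm ((ddt ^^ Suc k) c \<theta>)) ddt"
proof -
  \<comment> \<open>The offset i is needed because the recursion of \<open>unif_bdd\<close> replaces
    the family of first derivatives by higher ones.\<close>
  have "(\<And>j. j < k \<Longrightarrow> \<exists>K. \<forall>c\<in>X. \<forall>\<theta>. norm ((ddt ^^ Suc (j + i)) c \<theta>) \<le> K) \<Longrightarrow>
    unif_bdd X k (\<lambda>c \<theta>. 1 + norm ((ddt ^^ Suc (k + i)) c \<theta>)) (\<lambda>c. (ddt ^^ Suc i) c)" for i
  proof (induction k arbitrary: i)
    case 0
    then show ?case by (auto intro: exI[of _ 1])
  next
    case (Suc k)
    have "unif_bdd X k (\<lambda>c \<theta>. 1 + norm ((ddt ^^ Suc (k + Suc i)) c \<theta>)) (\<lambda>c. (ddt ^^ Suc (Suc i)) c)"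
      by (rule Suc.IH) (use Suc.prems[of "Suc _"] in simp)
    moreover have "\<exists>K. \<forall>c\<in>X. \<forall>\<theta>. norm ((ddt ^^ Suc i) c \<theta>) \<le> K" using Suc.prems[of 0] by simp
    ultimately show ?case by simp
  qed
  moreover have "\<exists>K. \<forall>c\<in>X. \<forall>\<theta>. norm ((ddt ^^ Suc (j + 0)) c \<theta>) \<le> K" if "j < k" for j
    using assms[of "Suc j"] that by simp
  ultimately have "unif_bdd X k (\<lambda>c \<theta>. 1 + norm ((ddt ^^ Suc (k + 0)) c \<theta>)) (\<lambda>c. (ddt ^^ Suc 0) c)"
    by blast
  then show ?thesis by simp
qed

text \<open>
  The weight \<open>1 + norm ((ddt ^^ Suc k) c \<theta>)\<close> multiplies only the first derivative of \<open>f\<close>, because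
  the top derivative of the curve enters the expansions linearly and only through \<open>coef _ _ _ 1\<close>.
\<close>

lemma arc_deriv_comparison:
  fixes X :: "(real \<Rightarrow> 'a::real_inner) set"
  assumes X: "X \<subseteq> Imm" and a: "0 < a" "\<And>c \<theta>. c \<in> X \<Longrightarrow> a \<le> speed c \<theta>"
    and bdd: "\<And>j. 1 \<le> j \<Longrightarrow> j \<le> k \<Longrightarrow> \<exists>K. \<forall>c\<in>X. \<forall>\<theta>. norm ((ddt ^^ j) c \<theta>) \<le> K"
  shows "\<exists>K>0. \<forall>c\<in>X. \<forall>f\<in>Cinf. \<forall>\<theta>. norm ((ddt ^^ Suc k) f \<theta> :: 'b::real_normed_vector) \<le>
      K * ((1 + norm ((ddt ^^ Suc k) c \<theta>)) * norm (arc_deriv ddt c f \<theta>) +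
        (\<Sum>j\<in>{2..Suc k}. norm ((arc_deriv ddt c ^^ j) f \<theta>)))"
    and "\<exists>K>0. \<forall>c\<in>X. \<forall>f\<in>Cinf. \<forall>\<theta>. norm ((arc_deriv ddt c ^^ Suc k) f \<theta> :: 'b) \<le>
      K * ((1 + norm ((ddt ^^ Suc k) c \<theta>)) * norm (ddt f \<theta>) +
        (\<Sum>j\<in>{2..Suc k}. norm ((ddt ^^ j) f \<theta>)))"
proof -
  let ?w = "\<lambda>c \<theta>. 1 + norm ((ddt ^^ Suc k) c \<theta>)"
  have w: "1 \<le> ?w c \<theta>" for c :: "real \<Rightarrow> 'a" and \<theta> by simp
  have sp: "unif_bdd X k ?w speed" "unif_bdd X k ?w (\<lambda>c \<theta>. inverse (speed c \<theta>))"
    using unif_bdd_speed[OF X a w unif_bdd_ddt[OF bdd]] by auto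
  have C: "speed c \<in> Cinf" "(\<lambda>\<theta>. inverse (speed c \<theta>)) \<in> Cinf" "speed c \<theta> \<noteq> 0" if "c \<in> X" for c \<theta>
    using that X speed_Cinf inverse_speed_Cinf speed_pos[of c \<theta>] by auto
  \<comment> \<open>Here \<alpha> = 1 is split as |c'| times 1/|c'|. In the opposite direction
    below, \<alpha> = \<beta> = 1/|c'| and \<delta> = 1.\<close>
  show "\<exists>K>0. \<forall>c\<in>X. \<forall>f\<in>Cinf. \<forall>\<theta>. norm ((ddt ^^ Suc k) f \<theta> :: 'b) \<le>
      K * ((1 + norm ((ddt ^^ Suc k) c \<theta>)) * norm (arc_deriv ddt c f \<theta>) +
        (\<Sum>j\<in>{2..Suc k}. norm ((arc_deriv ddt c ^^ j) f \<theta>)))"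
    using wder_pow_bound[of X "\<lambda>c \<theta>. 1" speed "\<lambda>c \<theta>. inverse (speed c \<theta>)" ?w k, where 'b = 'b] C sp w
      unif_bdd_const[of ?w X k "1::real", OF w]
    by (simp add: arc_deriv_ddt_eq_wder wder_one)
  show "\<exists>K>0. \<forall>c\<in>X. \<forall>f\<in>Cinf. \<forall>\<theta>. norm ((arc_deriv ddt c ^^ Suc k) f \<theta> :: 'b) \<le>
      K * ((1 + norm ((ddt ^^ Suc k) c \<theta>)) * norm (ddt f \<theta>) +
        (\<Sum>j\<in>{2..Suc k}. norm ((ddt ^^ j) f \<theta>)))"
    using wder_pow_bound[of X "\<lambda>c \<theta>. inverse (speed c \<theta>)" "\<lambda>c \<theta>. inverse (speed c \<theta>)" "\<lambda>c \<theta>. 1" ?w k,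
        where 'b = 'b] C sp w
    by (simp add: arc_deriv_ddt_eq_wder wder_one)
qed

subsection \<open>Square integrable functions on the circle\<close>

lemma integrable_mult_L2:
  fixes f g :: "'x \<Rightarrow> real"
  assumes [measurable]: "f \<in> borel_measurable M" "g \<in> borel_measurable M"
    and i: "integrable M (\<lambda>x. (f x)\<^sup>2)" "integrable M (\<lambda>x. (g x)\<^sup>2)"
  shows "integrable M (\<lambda>x. f x * g x)"
proof (rule Bochner_Integration.integrable_bound)
  show "integrable M (\<lambda>x. (f x)\<^sup>2 + (g x)\<^sup>2)" using i by simp
  have "\<bar>f x * g x\<bar> \<le> (f x)\<^sup>2 + (g x)\<^sup>2" for x
  proof -
    have "2 * (\<bar>f x\<bar> * \<bar>g x\<bar>) \<le> (f x)\<^sup>2 + (g x)\<^sup>2"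
      using sum_squares_bound[of "\<bar>f x\<bar>" "\<bar>g x\<bar>"] by (simp add: mult.assoc)
    moreover have "0 \<le> \<bar>f x\<bar> * \<bar>g x\<bar>" by simp
    ultimately show ?thesis unfolding abs_mult by linarith
  qed
  then show "AE x in M. norm (f x * g x) \<le> norm ((f x)\<^sup>2 + (g x)\<^sup>2)"
    by (intro AE_I2) (metis abs_ge_self order_trans real_norm_def)
qed simp

lemma integrable_add_L2:
  fixes f g :: "'x \<Rightarrow> real"
  assumes "f \<in> borel_measurable M" "g \<in> borel_measurable M"
    and "integrable M (\<lambda>x. (f x)\<^sup>2)" "integrable M (\<lambda>x. (g x)\<^sup>2)"
  shows "integrable M (\<lambda>x. (f x + g x)\<^sup>2)"
  using integrable_mult_L2[OF assms] assms by (simp add: power2_sum mult.assoc)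

text \<open>The quadratic polynomial t -> \<integral>(t f + g)^2 is nonnegative; it is evaluated at
  its minimum -B/A.\<close>

lemma Cauchy_Schwarz_integral:
  fixes f g :: "'x \<Rightarrow> real"
  assumes "f \<in> borel_measurable M" "g \<in> borel_measurable M"
    and i: "integrable M (\<lambda>x. (f x)\<^sup>2)" "integrable M (\<lambda>x. (g x)\<^sup>2)"
  shows "(\<integral>x. f x * g x \<partial>M)\<^sup>2 \<le> (\<integral>x. (f x)\<^sup>2 \<partial>M) * (\<integral>x. (g x)\<^sup>2 \<partial>M)"
proof -
  note fg = integrable_mult_L2[OF assms]
  define A B C where "A = (\<integral>x. (f x)\<^sup>2 \<partial>M)" and "B = (\<integral>x. f x * g x \<partial>M)" and "C = (\<integral>x. (g x)\<^sup>2 \<partial>M)"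
  have q: "0 \<le> t\<^sup>2 * A + 2 * t * B + C" for t
  proof -
    have "0 \<le> (\<integral>x. (t * f x + g x)\<^sup>2 \<partial>M)" by simp
    also have "\<dots> = (\<integral>x. t\<^sup>2 * (f x)\<^sup>2 + 2 * t * (f x * g x) + (g x)\<^sup>2 \<partial>M)"
      by (simp add: power2_sum power_mult_distrib algebra_simps)
    also have "\<dots> = t\<^sup>2 * A + 2 * t * B + C"
      using i fg by (simp add: A_def B_def C_def)
    finally show ?thesis .
  qed
  have "0 \<le> A" by (simp add: A_def)
  show ?thesis
  proof (cases "A = 0")
    case True
    have "B = 0"
    proof (rule ccontr)
      assume "B \<noteq> 0"
      \<comment> \<open>With A = 0 the polynomial is affine in t, and at this t it takes the value
        -1.\<close>
      then show False using q[of "- (C + 1) / (2 * B)"] True by (simp add: field_simps)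
    qed
    then show ?thesis using True by (simp add: A_def B_def)
  next
    case False
    then have "0 < A" using \<open>0 \<le> A\<close> by simp
    then have "B\<^sup>2 \<le> A * C"
      using q[of "- B / A"] by (simp add: power2_eq_square field_simps)
    then show ?thesis by (simp add: A_def B_def C_def)
  qed
qed

lemma Minkowski_integral:
  fixes f g :: "'x \<Rightarrow> real"
  assumes "f \<in> borel_measurable M" "g \<in> borel_measurable M"
    and i: "integrable M (\<lambda>x. (f x)\<^sup>2)" "integrable M (\<lambda>x. (g x)\<^sup>2)"
  shows "sqrt (\<integral>x. (f x + g x)\<^sup>2 \<partial>M) \<le> sqrt (\<integral>x. (f x)\<^sup>2 \<partial>M) + sqrt (\<integral>x. (g x)\<^sup>2 \<partial>M)"
proof -
  note fg = integrable_mult_L2[OF assms]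
  define A B C where "A = (\<integral>x. (f x)\<^sup>2 \<partial>M)" and "B = (\<integral>x. f x * g x \<partial>M)" and "C = (\<integral>x. (g x)\<^sup>2 \<partial>M)"
  have pos: "0 \<le> A" "0 \<le> C" by (simp_all add: A_def C_def)
  have "(\<integral>x. (f x + g x)\<^sup>2 \<partial>M) = (\<integral>x. (f x)\<^sup>2 + (g x)\<^sup>2 + 2 * (f x * g x) \<partial>M)"
    by (simp add: power2_sum mult.assoc)
  also have "\<dots> = A + C + 2 * B"
    using i fg by (simp add: A_def B_def C_def)
  also have "B \<le> sqrt A * sqrt C"
    using Cauchy_Schwarz_integral[OF assms] by (metis A_def B_def C_def real_le_rsqrt real_sqrt_mult)
  then have "A + C + 2 * B \<le> (sqrt A + sqrt C)\<^sup>2"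
    using pos by (simp add: power2_sum)
  finally show ?thesis
    unfolding A_def[symmetric] C_def[symmetric] by (intro real_le_lsqrt) (auto simp: pos)
qed

section \<open>Integration over one period\<close>

abbreviation circ :: "real measure" where "circ \<equiv> lebesgue_on {0..2*pi}"

lemma set_integrable_circ:
  fixes f :: "real \<Rightarrow> real"
  shows "set_integrable lebesgue {0..2*pi} f \<longleftrightarrow> integrable circ f"
  by (simp add: set_integrable_def integrable_restrict_space)

lemma set_lebesgue_integral_circ:
  fixes f :: "real \<Rightarrow> real"
  shows "(LINT \<theta>:{0..2*pi}|lebesgue. f \<theta>) = (\<integral>\<theta>. f \<theta> \<partial>circ)"
  by (simp add: set_lebesgue_integral_def integral_restrict_space)

lemma integrable_circ:
  fixes f :: "real \<Rightarrow> real"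
  assumes "continuous_on {0..2*pi} f"
  shows "integrable circ f"
  using absolutely_integrable_continuous_real[OF assms] set_integrable_circ by blast

lemma integral_circ:
  fixes f :: "real \<Rightarrow> real"
  assumes "continuous_on {0..2*pi} f"
  shows "(\<integral>\<theta>. f \<theta> \<partial>circ) = integral {0..2*pi} f"
  using set_lebesgue_integral_eq_integral(2)[OF absolutely_integrable_continuous_real[OF assms]]
  by (simp add: set_lebesgue_integral_circ)

lemma measurable_circ: "continuous_on {0..2*pi} (f :: real \<Rightarrow> real) \<Longrightarrow> f \<in> borel_measurable circ"
  using integrable_circ by (rule borel_measurable_integrable)

lemma finite_measure_circ: "finite_measure circ"
  by (rule finite_measureI) (simp add: emeasure_restrict_space)

lemma Cinf_norm_continuous [continuous_intros]:
  "f \<in> Cinf \<Longrightarrow> continuous_on S (\<lambda>\<theta>. norm (f \<theta>))"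
  by (intro continuous_on_norm Cinf_continuous_on)

lemma integral_circ_ddt:
  fixes f :: "real \<Rightarrow> real"
  assumes "f \<in> Cinf"
  shows "(\<integral>\<theta>. ddt f \<theta> \<partial>circ) = 0"
proof -
  have "(ddt f has_integral (f (2*pi) - f 0)) {0..2*pi}"
    using Cinf_vector_derivative[OF assms] by (intro fundamental_theorem_of_calculus) auto
  moreover have "f (2 * pi) = f 0"
    using Cinf_periodic[OF assms] by (metis add_0 periodic_def)
  ultimately show ?thesis
    by (simp add: integral_circ Cinf_continuous_on ddt_Cinf assms integral_unique)
qed

lemma norm_diff_le_integral_circ:
  fixes f :: "real \<Rightarrow> real"
  assumes f: "f \<in> Cinf" and x: "x \<in> {0..2*pi}" "y \<in> {0..2*pi}"
  shows "\<bar>f x - f y\<bar> \<le> (\<integral>\<theta>. \<bar>ddt f \<theta>\<bar> \<partial>circ)"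
proof -
  have "\<bar>f x - f y\<bar> \<le> (\<integral>\<theta>. \<bar>ddt f \<theta>\<bar> \<partial>circ)" if "y \<le> x" "x \<in> {0..2*pi}" "y \<in> {0..2*pi}" for x y
  proof -
    have c: "continuous_on S (ddt f)" for S by (intro Cinf_continuous_on ddt_Cinf f)
    have "(ddt f has_integral (f x - f y)) {y..x}"
      using Cinf_vector_derivative[OF f] that by (intro fundamental_theorem_of_calculus) auto
    then have "\<bar>f x - f y\<bar> = \<bar>integral {y..x} (ddt f)\<bar>" by (simp add: integral_unique)
    also have "\<dots> \<le> integral {y..x} (\<lambda>\<theta>. \<bar>ddt f \<theta>\<bar>)"
      using integral_norm_bound_integral[of "ddt f" "{y..x}" "\<lambda>\<theta>. \<bar>ddt f \<theta>\<bar>"]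
      by (simp add: integrable_continuous_real c continuous_on_rabs)
    also have "\<dots> \<le> integral {0..2*pi} (\<lambda>\<theta>. \<bar>ddt f \<theta>\<bar>)"
      using that by (intro integral_subset_le integrable_continuous_real continuous_on_rabs c) auto
    also have "\<dots> = (\<integral>\<theta>. \<bar>ddt f \<theta>\<bar> \<partial>circ)"
      by (intro integral_circ[symmetric] continuous_on_rabs c)
    finally show ?thesis .
  qed
  from this[of y x] this[of x y] show ?thesis using x by (cases "y \<le> x") (auto simp: abs_minus_commute)
qed

subsection \<open>Interpolation and Sobolev inequalities on closed curves\<close>

text \<open>A discrete maximum principle. At the first index where the maximum M is attained, if it
  is interior, the left neighbour is strictly smaller, and log-convexity forces M = 0. Avoiding
  logarithms admits sequences with zeros.\<close>

lemma log_convex_le_max: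
  fixes x :: "nat \<Rightarrow> real"
  assumes "\<And>k. 0 \<le> x k" "\<And>k. (x (Suc k))\<^sup>2 \<le> x k * x (Suc (Suc k))" and k: "k \<le> n"
  shows "x k \<le> max (x 0) (x n)"
proof -
  define M where "M = Max (x ` {..n})"
  have le: "x j \<le> M" if "j \<le> n" for j
    unfolding M_def using that by (intro Max_ge) auto
  have "M \<in> x ` {..n}" unfolding M_def by (intro Max_in) auto
  then have ex: "\<exists>j. j \<le> n \<and> x j = M" by auto
  define j where "j = (LEAST j. j \<le> n \<and> x j = M)"
  have j: "j \<le> n" "x j = M" using LeastI_ex[OF ex] by (auto simp: j_def)
  have "M \<le> max (x 0) (x n)"
  proof (cases "j = 0 \<or> j = n")
    case True
    then show ?thesis using j by auto
  next
    case False
    then obtain i where i: "j = Suc i" "j < n" using j(1) by (metis le_neq_implies_less not0_implies_Suc)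
    have "x i \<noteq> M" using not_less_Least[of i "\<lambda>j. j \<le> n \<and> x j = M"] i by (auto simp: j_def)
    then have "x i < M" using le[of i] i by simp
    have "M\<^sup>2 \<le> x i * x (Suc (Suc i))" using assms(2)[of i] j i by simp
    also have "\<dots> \<le> x i * M" using le[of "Suc (Suc i)"] i assms(1) by (intro mult_left_mono) auto
    finally have "M * M \<le> x i * M" by (simp add: power2_eq_square)
    then have "M \<le> 0" using \<open>x i < M\<close> by (simp add: mult_le_cancel_right)
    then show ?thesis using assms(1)[of 0] by linarith
  qed
  then show ?thesis using le[OF k] by linarith
qed

text \<open>The weight a stands for the speed of a curve and D for its arc length derivative. The
  choice a = 1 gives the same inequalities for the parameter \<theta>.\<close>

context
  fixes a :: "real \<Rightarrow> real"
  assumes a: "a \<in> Cinf" and a_pos: "\<And>\<theta>. 0 < a \<theta>"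
begin

private abbreviation (input) "D \<equiv> wder (\<lambda>\<theta>. inverse (a \<theta>))"

lemma wder_inverse_Cinf:
  assumes "f \<in> Cinf"
  shows "(D ^^ k) f \<in> Cinf"
proof -
  have "(\<lambda>\<theta>. inverse (a \<theta>)) \<in> Cinf" using a a_pos by (intro inverse_Cinf) (auto simp: less_imp_neq[THEN not_sym])
  then show ?thesis using assms by (intro wder_pow_Cinf)
qed

lemma weight_wder: "a \<theta> *\<^sub>R D f \<theta> = ddt f \<theta>"
  using a_pos[of \<theta>] by (simp add: wder_def)

lemma weight_sqrt: "x * sqrt (a \<theta>) * (y * sqrt (a \<theta>)) = x * y * a \<theta>"
proof -
  have "x * sqrt (a \<theta>) * (y * sqrt (a \<theta>)) = x * y * (sqrt (a \<theta>) * sqrt (a \<theta>))" by (simp only: mult_ac)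
  then show ?thesis using a_pos[of \<theta>] by (simp add: less_imp_le)
qed

lemma weighted_square_integrable:
  assumes "f \<in> Cinf"
  shows "integrable circ (\<lambda>\<theta>. (norm (f \<theta>))\<^sup>2 * a \<theta>)"
  using assms a by (intro integrable_circ continuous_intros Cinf_continuous_on)

text \<open>The derivative of the inner product of f and Df integrates to zero over the closed
  curve, so the integral of |Df|^2 equals minus that of f against D(Df). Cauchy-Schwarz follows,
  with the weight divided into two square roots.\<close>

lemma weighted_log_convex:
  fixes f :: "real \<Rightarrow> 'b::real_inner"
  assumes f: "f \<in> Cinf"
  shows "(\<integral>\<theta>. (norm (D f \<theta>))\<^sup>2 * a \<theta> \<partial>circ)\<^sup>2 \<le>
    (\<integral>\<theta>. (norm (f \<theta>))\<^sup>2 * a \<theta> \<partial>circ) * (\<integral>\<theta>. (norm (D (D f) \<theta>))\<^sup>2 * a \<theta> \<partial>circ)"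
proof -
  have Df: "D f \<in> Cinf" "D (D f) \<in> Cinf"
    using wder_inverse_Cinf[OF f, of 1] wder_inverse_Cinf[OF f, of 2] by (simp_all add: numeral_2_eq_2)
  note cont = Cinf_continuous_on[OF f] Cinf_continuous_on[OF Df(1)] Cinf_continuous_on[OF Df(2)]
    Cinf_continuous_on[OF a]
  have "ddt (\<lambda>\<theta>. f \<theta> \<bullet> D f \<theta>) = (\<lambda>\<theta>. (norm (D f \<theta>))\<^sup>2 * a \<theta> + (f \<theta> \<bullet> D (D f) \<theta>) * a \<theta>)"
    unfolding ddt_inner[OF f Df(1)]
    by (simp add: weight_wder[symmetric, of f] weight_wder[symmetric, of "D f"] power2_norm_eq_inner fun_eq_iff mult.commute)
  then have "0 = (\<integral>\<theta>. (norm (D f \<theta>))\<^sup>2 * a \<theta> + (f \<theta> \<bullet> D (D f) \<theta>) * a \<theta> \<partial>circ)"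
    using integral_circ_ddt[OF inner_Cinf[OF f Df(1)]] by simp
  also have "\<dots> = (\<integral>\<theta>. (norm (D f \<theta>))\<^sup>2 * a \<theta> \<partial>circ) + (\<integral>\<theta>. (f \<theta> \<bullet> D (D f) \<theta>) * a \<theta> \<partial>circ)"
    by (intro Bochner_Integration.integral_add integrable_circ continuous_intros cont)
  finally have "0 = (\<integral>\<theta>. (norm (D f \<theta>))\<^sup>2 * a \<theta> \<partial>circ) + (\<integral>\<theta>. (f \<theta> \<bullet> D (D f) \<theta>) * a \<theta> \<partial>circ)" .
  moreover have pos: "0 \<le> (\<integral>\<theta>. (norm (D f \<theta>))\<^sup>2 * a \<theta> \<partial>circ)"
    using a_pos by (intro integral_nonneg_AE) (auto simp: less_imp_le)
  ultimately have "(\<integral>\<theta>. (norm (D f \<theta>))\<^sup>2 * a \<theta> \<partial>circ) = \<bar>\<integral>\<theta>. (f \<theta> \<bullet> D (D f) \<theta>) * a \<theta> \<partial>circ\<bar>"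
    by linarith
  also have "\<dots> \<le> (\<integral>\<theta>. (norm (f \<theta>) * sqrt (a \<theta>)) * (norm (D (D f) \<theta>) * sqrt (a \<theta>)) \<partial>circ)"
  proof (rule order_trans[OF integral_abs_bound integral_mono])
    fix \<theta>
    have "\<bar>f \<theta> \<bullet> D (D f) \<theta>\<bar> * a \<theta> \<le> norm (f \<theta>) * norm (D (D f) \<theta>) * a \<theta>"
      using a_pos[of \<theta>] by (intro mult_right_mono Cauchy_Schwarz_ineq2) simp
    then show "\<bar>(f \<theta> \<bullet> D (D f) \<theta>) * a \<theta>\<bar> \<le> (norm (f \<theta>) * sqrt (a \<theta>)) * (norm (D (D f) \<theta>) * sqrt (a \<theta>))"
      using a_pos[of \<theta>] unfolding weight_sqrt by (simp add: abs_mult)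
  qed (intro integrable_circ continuous_intros cont)+
  finally have "(\<integral>\<theta>. (norm (D f \<theta>))\<^sup>2 * a \<theta> \<partial>circ)\<^sup>2 \<le>
      (\<integral>\<theta>. (norm (f \<theta>) * sqrt (a \<theta>)) * (norm (D (D f) \<theta>) * sqrt (a \<theta>)) \<partial>circ)\<^sup>2"
    using pos by (rule power_mono)
  also have "\<dots> \<le> (\<integral>\<theta>. (norm (f \<theta>) * sqrt (a \<theta>))\<^sup>2 \<partial>circ) * (\<integral>\<theta>. (norm (D (D f) \<theta>) * sqrt (a \<theta>))\<^sup>2 \<partial>circ)"
    by (intro Cauchy_Schwarz_integral measurable_circ integrable_circ continuous_intros cont)
  finally show ?thesis
    using a_pos by (simp add: power_mult_distrib less_imp_le)
qed

text \<open>Log-convexity in k together with the maximum principle gives the constant one, whatever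
  the weight.\<close>

lemma weighted_interpolation:
  fixes f :: "real \<Rightarrow> 'b::real_inner"
  assumes f: "f \<in> Cinf" and k: "k \<le> n"
  shows "(\<integral>\<theta>. (norm ((D ^^ k) f \<theta>))\<^sup>2 * a \<theta> \<partial>circ) \<le>
    (\<integral>\<theta>. ((norm (f \<theta>))\<^sup>2 + (norm ((D ^^ n) f \<theta>))\<^sup>2) * a \<theta> \<partial>circ)"
proof -
  let ?x = "\<lambda>k. (\<integral>\<theta>. (norm ((D ^^ k) f \<theta>))\<^sup>2 * a \<theta> \<partial>circ)"
  have pos: "0 \<le> ?x k" for k using a_pos by (intro integral_nonneg_AE) (auto simp: less_imp_le)
  have "?x k \<le> max (?x 0) (?x n)"
    using weighted_log_convex[OF wder_inverse_Cinf[OF f]] by (intro log_convex_le_max pos k) simp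
  also have "\<dots> \<le> ?x 0 + ?x n" using pos[of 0] pos[of n] by linarith
  also have "\<dots> = (\<integral>\<theta>. (norm (f \<theta>))\<^sup>2 * a \<theta> + (norm ((D ^^ n) f \<theta>))\<^sup>2 * a \<theta> \<partial>circ)"
    by (subst Bochner_Integration.integral_add) (auto intro: weighted_square_integrable f wder_inverse_Cinf)
  finally show ?thesis by (simp add: distrib_right)
qed

text \<open>The vector Df need not vanish anywhere, but its component in a fixed direction does,
  being the derivative of a periodic function up to the factor a. From that zero the component is
  recovered by integrating its derivative. No lower bound on the length enters.\<close>

lemma weighted_sup_bound:
  fixes f :: "real \<Rightarrow> 'b::real_inner"
  assumes f: "f \<in> Cinf"
  shows "(norm (D f \<theta>))\<^sup>2 \<le> (\<integral>\<theta>. a \<theta> \<partial>circ) * (\<integral>\<theta>. (norm (D (D f) \<theta>))\<^sup>2 * a \<theta> \<partial>circ)"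
proof -
  have Df: "D f \<in> Cinf" "D (D f) \<in> Cinf"
    using wder_inverse_Cinf[OF f, of 1] wder_inverse_Cinf[OF f, of 2] by (simp_all add: numeral_2_eq_2)
  note cont = Cinf_continuous_on[OF Df(2)] Cinf_continuous_on[OF a]
  obtain x where x: "x \<in> {0..2*pi}" "D f x = D f \<theta>"
    using periodic_representative[OF Cinf_periodic[OF Df(1)]] .
  \<comment> \<open>In this direction the component of Df at x is its full norm; if Df vanishes at x
    then u = 0 and the equality still holds.\<close>
  define u where "u = sgn (D f x)"
  have u: "norm u \<le> 1" by (simp add: u_def norm_sgn)
  define \<phi> where "\<phi> = (\<lambda>\<theta>. f \<theta> \<bullet> u)"
  define \<psi> where "\<psi> = (\<lambda>\<theta>. D f \<theta> \<bullet> u)"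
  have C: "\<phi> \<in> Cinf" "\<psi> \<in> Cinf" unfolding \<phi>_def \<psi>_def using f Df by auto
  have d\<phi>: "ddt \<phi> = (\<lambda>\<theta>. a \<theta> * \<psi> \<theta>)" and d\<psi>: "ddt \<psi> = (\<lambda>\<theta>. a \<theta> * (D (D f) \<theta> \<bullet> u))"
    unfolding \<phi>_def \<psi>_def using f Df
    by (simp_all add: ddt_inner weight_wder[symmetric, of f] weight_wder[symmetric, of "D f"])
  have "\<phi> (2 * pi) = \<phi> 0" using Cinf_periodic[OF C(1)] by (metis add_0 periodic_def)
  then obtain z where z: "0 < z" "z < 2 * pi" "ddt \<phi> z = 0"
    using Rolle_deriv[of 0 "2*pi" \<phi> "\<lambda>x h. h *\<^sub>R ddt \<phi> x"] Cinf_vector_derivative[OF C(1)] Cinf_continuous_on[OF C(1)]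
    by (auto simp: has_vector_derivative_def fun_eq_iff)
  then have "\<psi> z = 0" using d\<phi> a_pos[of z] by simp
  moreover have "norm (D f x) = \<psi> x"
    by (cases "D f x = 0")
      (simp_all add: \<psi>_def u_def sgn_div_norm power2_norm_eq_inner[symmetric] power2_eq_square)
  ultimately have "norm (D f x) = \<bar>\<psi> x - \<psi> z\<bar>"
    using norm_ge_zero[of "D f x"] by linarith
  also have "\<dots> \<le> (\<integral>\<theta>. \<bar>ddt \<psi> \<theta>\<bar> \<partial>circ)"
    using x z by (intro norm_diff_le_integral_circ C) auto
  also have "\<dots> \<le> (\<integral>\<theta>. sqrt (a \<theta>) * (norm (D (D f) \<theta>) * sqrt (a \<theta>)) \<partial>circ)"
  proof (rule integral_mono)
    fix \<theta>
    have "\<bar>D (D f) \<theta> \<bullet> u\<bar> \<le> norm (D (D f) \<theta>)"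
      using Cauchy_Schwarz_ineq2[of "D (D f) \<theta>" u] mult_left_mono[OF u, of "norm (D (D f) \<theta>)"] by simp
    then have "a \<theta> * \<bar>D (D f) \<theta> \<bullet> u\<bar> \<le> a \<theta> * norm (D (D f) \<theta>)"
      using a_pos[of \<theta>] by simp
    then show "\<bar>ddt \<psi> \<theta>\<bar> \<le> sqrt (a \<theta>) * (norm (D (D f) \<theta>) * sqrt (a \<theta>))"
      using a_pos[of \<theta>] weight_sqrt[of 1 \<theta> "norm (D (D f) \<theta>)", unfolded mult_1]
      by (simp only: d\<psi> abs_mult mult.commute[of "norm _" "a \<theta>"] abs_of_pos)
  qed (intro integrable_circ continuous_intros cont Cinf_continuous_on ddt_Cinf C)+
  finally have "(norm (D f \<theta>))\<^sup>2 \<le> (\<integral>\<theta>. sqrt (a \<theta>) * (norm (D (D f) \<theta>) * sqrt (a \<theta>)) \<partial>circ)\<^sup>2"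
    by (simp add: x power_mono)
  also have "\<dots> \<le> (\<integral>\<theta>. (sqrt (a \<theta>))\<^sup>2 \<partial>circ) * (\<integral>\<theta>. (norm (D (D f) \<theta>) * sqrt (a \<theta>))\<^sup>2 \<partial>circ)"
    by (intro Cauchy_Schwarz_integral measurable_circ integrable_circ continuous_intros cont)
  finally show ?thesis
    using a_pos by (simp add: power_mult_distrib less_imp_le)
qed

text \<open>The restriction k \<ge> 1 provides the zero of each component, and k < n leaves one
  derivative to spend on the supremum.\<close>

lemma weighted_sup_interpolation:
  fixes f :: "real \<Rightarrow> 'b::real_inner"
  assumes f: "f \<in> Cinf" and k: "1 \<le> k" "k < n"
  shows "(norm ((D ^^ k) f \<theta>))\<^sup>2 \<le> (\<integral>\<theta>. a \<theta> \<partial>circ) *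
    (\<integral>\<theta>. ((norm (f \<theta>))\<^sup>2 + (norm ((D ^^ n) f \<theta>))\<^sup>2) * a \<theta> \<partial>circ)"
proof -
  obtain i where i: "k = Suc i" using k by (cases k) auto
  have "(norm ((D ^^ k) f \<theta>))\<^sup>2 \<le> (\<integral>\<theta>. a \<theta> \<partial>circ) * (\<integral>\<theta>. (norm ((D ^^ Suc k) f \<theta>))\<^sup>2 * a \<theta> \<partial>circ)"
    using weighted_sup_bound[OF wder_inverse_Cinf[OF f], of i \<theta>] i by simp
  also have "\<dots> \<le> (\<integral>\<theta>. a \<theta> \<partial>circ) *
    (\<integral>\<theta>. ((norm (f \<theta>))\<^sup>2 + (norm ((D ^^ n) f \<theta>))\<^sup>2) * a \<theta> \<partial>circ)"
    using k a_pos by (intro mult_left_mono weighted_interpolation f integral_nonneg_AE) (auto simp: less_imp_le)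
  finally show ?thesis .
qed

end

subsection \<open>Paths in the space of smooth periodic functions\<close>

lemma topspace_Cinf_topology [simp]: "topspace Cinf_topology = Cinf"
proof
  show "topspace Cinf_topology \<subseteq> Cinf"
    unfolding Cinf_topology_def topology_generated_by_topspace by blast
  show "Cinf \<subseteq> topspace Cinf_topology"
  proof
    fix f assume f: "f \<in> Cinf"
    then have "f \<in> {g \<in> Cinf. \<forall>\<theta>. norm ((ddt ^^ 0) g \<theta> - (ddt ^^ 0) f \<theta>) < 1}" by simp
    then show "f \<in> topspace Cinf_topology"
      unfolding Cinf_topology_def topology_generated_by_topspace using f zero_less_one by blast
  qed
qed

lemma openin_Cinf_topology_ball:
  "f \<in> Cinf \<Longrightarrow> 0 < \<epsilon> \<Longrightarrow>
    openin Cinf_topology {g \<in> Cinf. \<forall>\<theta>. norm ((ddt ^^ k) g \<theta> - (ddt ^^ k) f \<theta>) < \<epsilon>}"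
  unfolding Cinf_topology_def by (rule topology_generated_by_Basis) blast

lemma has_path_derivativeD:
  assumes "has_path_derivative \<gamma> v t I"
  shows "v \<in> Cinf"
    and "0 < \<epsilon> \<Longrightarrow> eventually (\<lambda>s. (\<lambda>\<theta>. (\<gamma> s \<theta> - \<gamma> t \<theta>) /\<^sub>R (s - t)) \<in> Cinf \<and>
      (\<forall>\<theta>. norm ((ddt ^^ k) (\<lambda>\<theta>. (\<gamma> s \<theta> - \<gamma> t \<theta>) /\<^sub>R (s - t)) \<theta> - (ddt ^^ k) v \<theta>) < \<epsilon>)) (at t within I)"
proof -
  show v: "v \<in> Cinf" using assms by (simp add: has_path_derivative_def limitin_def)
  assume "0 < \<epsilon>"
  moreover have "v \<in> {g \<in> Cinf. \<forall>\<theta>. norm ((ddt ^^ k) g \<theta> - (ddt ^^ k) v \<theta>) < \<epsilon>}"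
    using v \<open>0 < \<epsilon>\<close> by simp
  ultimately have "eventually (\<lambda>s. (\<lambda>\<theta>. (\<gamma> s \<theta> - \<gamma> t \<theta>) /\<^sub>R (s - t)) \<in>
      {g \<in> Cinf. \<forall>\<theta>. norm ((ddt ^^ k) g \<theta> - (ddt ^^ k) v \<theta>) < \<epsilon>}) (at t within I)"
    using assms openin_Cinf_topology_ball[OF v] unfolding has_path_derivative_def limitin_def by blast
  then show "eventually (\<lambda>s. (\<lambda>\<theta>. (\<gamma> s \<theta> - \<gamma> t \<theta>) /\<^sub>R (s - t)) \<in> Cinf \<and>
      (\<forall>\<theta>. norm ((ddt ^^ k) (\<lambda>\<theta>. (\<gamma> s \<theta> - \<gamma> t \<theta>) /\<^sub>R (s - t)) \<theta> - (ddt ^^ k) v \<theta>) < \<epsilon>)) (at t within I)"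
    by simp
qed

text \<open>Identifies \<open>velocity\<close>, which is only a choice, with a derivative found
  elsewhere. At an isolated point of I every smooth v would qualify, hence the condition on the
  filter.\<close>

lemma has_path_derivative_unique:
  assumes "has_path_derivative \<gamma> v t I" "has_path_derivative \<gamma> w t I" "at t within I \<noteq> bot"
  shows "v = w"
proof
  fix \<theta>
  have "norm (v \<theta> - w \<theta>) \<le> \<epsilon>" if "0 < \<epsilon>" for \<epsilon>
  proof -
    let ?q = "\<lambda>s. (\<lambda>\<theta>. (\<gamma> s \<theta> - \<gamma> t \<theta>) /\<^sub>R (s - t))"
    have "eventually (\<lambda>s. \<forall>\<theta>. norm (?q s \<theta> - v \<theta>) < \<epsilon> / 2) (at t within I)"
      "eventually (\<lambda>s. \<forall>\<theta>. norm (?q s \<theta> - w \<theta>) < \<epsilon> / 2) (at t within I)"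
      using has_path_derivativeD(2)[OF assms(1), of "\<epsilon>/2" 0] has_path_derivativeD(2)[OF assms(2), of "\<epsilon>/2" 0] that
      by (auto elim: eventually_mono)
    then have "eventually (\<lambda>s. norm (?q s \<theta> - v \<theta>) < \<epsilon> / 2 \<and> norm (?q s \<theta> - w \<theta>) < \<epsilon> / 2) (at t within I)"
      by eventually_elim blast
    then obtain s where "norm (?q s \<theta> - v \<theta>) < \<epsilon> / 2" "norm (?q s \<theta> - w \<theta>) < \<epsilon> / 2"
      using assms(3) eventually_happens by blast
    then have "norm ((?q s \<theta> - w \<theta>) - (?q s \<theta> - v \<theta>)) \<le> \<epsilon> / 2 + \<epsilon> / 2"
      by (intro norm_triangle_le_diff) linarith
    then show ?thesis by (simp add: norm_minus_commute)
  qed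
  then have "norm (v \<theta> - w \<theta>) \<le> 0" by (rule field_le_epsilon) simp
  then show "v \<theta> = w \<theta>" by simp
qed

lemma has_path_derivative_cong:
  assumes "eventually (\<lambda>s. \<gamma> s = \<gamma>' s) (at t within I)" "\<gamma> t = \<gamma>' t" "has_path_derivative \<gamma> v t I"
  shows "has_path_derivative \<gamma>' v t I"
  using assms unfolding has_path_derivative_def
  by (elim limitin_transform_eventually[rotated]) (auto elim: eventually_mono)

lemma has_path_derivative_filter_mono:
  assumes "has_path_derivative \<gamma> v t I" "at t within J \<le> at t within I"
  shows "has_path_derivative \<gamma> v t J"
  using assms unfolding has_path_derivative_def limitin_def by (blast intro: filter_leD)

lemma has_path_derivative_const: "has_path_derivative (\<lambda>s. c) (\<lambda>\<theta>. 0) t I"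
  by (simp add: has_path_derivative_def limitin_const)

lemma smooth_path_on_cong:
  assumes "smooth_path_on I \<gamma>" "\<And>t. t \<in> I \<Longrightarrow> \<gamma> t = \<gamma>' t"
  shows "smooth_path_on I \<gamma>'"
proof -
  obtain \<Gamma> where \<Gamma>: "\<Gamma> 0 = \<gamma>" "\<And>k t. t \<in> I \<Longrightarrow> has_path_derivative (\<Gamma> k) (\<Gamma> (Suc k) t) t I"
    using assms(1) by (auto simp: smooth_path_on_def)
  have "has_path_derivative ((\<Gamma>(0 := \<gamma>')) k) ((\<Gamma>(0 := \<gamma>')) (Suc k) t) t I" if "t \<in> I" for k t
  proof (cases k)
    case 0
    have "eventually (\<lambda>s. \<gamma> s = \<gamma>' s) (at t within I)"
      using assms(2) by (simp add: eventually_at_filter)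
    then show ?thesis using \<Gamma>(2)[OF that, of 0] assms(2)[OF that] 0 \<Gamma>(1)
      by (auto intro: has_path_derivative_cong)
  qed (use \<Gamma>(2)[OF that] in simp)
  then show ?thesis unfolding smooth_path_on_def by (intro exI[of _ "\<Gamma>(0 := \<gamma>')"]) simp
qed

lemma smooth_path_on_subset: "smooth_path_on I \<gamma> \<Longrightarrow> J \<subseteq> I \<Longrightarrow> smooth_path_on J \<gamma>"
  unfolding smooth_path_on_def by (blast intro: has_path_derivative_filter_mono at_le)

lemma smooth_path_on_const: "smooth_path_on I (\<lambda>s. c)"
  unfolding smooth_path_on_def
proof (intro exI[of _ "\<lambda>k s. if k = 0 then c else (\<lambda>\<theta>. 0)"] conjI allI ballI)
  let ?\<Gamma> = "\<lambda>(k::nat) (s::real). if k = 0 then c else (\<lambda>\<theta>. 0)"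
  show "?\<Gamma> 0 = (\<lambda>s. c)" by simp
  show "has_path_derivative (?\<Gamma> k) (?\<Gamma> (Suc k) t) t I" for k t
    by (cases "k = 0") (auto simp: has_path_derivative_const)
qed

subsection \<open>Growth of seminorms along paths\<close>

text \<open>Continuity is expressed by a single derivative order k. The bound is formulated with an
  arbitrary pointwise bound e, so that no supremum has to be handled.\<close>

definition Ck_seminorm :: "((real \<Rightarrow> 'a::real_normed_vector) \<Rightarrow> real) \<Rightarrow> bool" where
  "Ck_seminorm N \<longleftrightarrow>
    (\<forall>f\<in>Cinf. \<forall>g\<in>Cinf. N (\<lambda>\<theta>. f \<theta> + g \<theta>) \<le> N f + N g) \<and>
    (\<forall>f\<in>Cinf. \<forall>a. N (\<lambda>\<theta>. a *\<^sub>R f \<theta>) = \<bar>a\<bar> * N f) \<and>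
    (\<exists>k M. \<forall>f\<in>Cinf. \<forall>e. (\<forall>\<theta>. norm ((ddt ^^ k) f \<theta>) \<le> e) \<longrightarrow> N f \<le> M * e)"

text \<open>A local Lipschitz constant up to arbitrarily small loss. It replaces the absolute value
  of a derivative, makes sense for norms at their zeros and is one-sided at the ends of an
  interval.\<close>

definition lipschitz_at :: "(real \<Rightarrow> real) \<Rightarrow> real \<Rightarrow> real \<Rightarrow> real set \<Rightarrow> bool" where
  "lipschitz_at z L t I \<longleftrightarrow> (\<forall>L'>L. eventually (\<lambda>s. \<bar>z s - z t\<bar> \<le> L' * \<bar>s - t\<bar>) (at t within I))"

lemma lipschitz_at_mono: "lipschitz_at z L t I \<Longrightarrow> L \<le> L' \<Longrightarrow> lipschitz_at z L' t I"
  by (auto simp: lipschitz_at_def)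

lemma lipschitz_at_const: "0 \<le> L \<Longrightarrow> lipschitz_at (\<lambda>t. c) L t I"
  by (auto simp: lipschitz_at_def)

text \<open>The two curves differ by (s - t) times the difference quotient q, and q is close to v in
  the order that controls N; the triangle inequality is used both ways.\<close>

lemma Ck_seminorm_lipschitz_at:
  assumes N: "Ck_seminorm N" and v: "has_path_derivative \<gamma> v t I"
    and C: "\<And>s. s \<in> I \<Longrightarrow> \<gamma> s \<in> Cinf" and t: "t \<in> I"
  shows "lipschitz_at (\<lambda>s. N (\<gamma> s)) (N v) t I"
  unfolding lipschitz_at_def
proof (intro allI impI)
  fix L assume L: "N v < L"
  have add: "N (\<lambda>\<theta>. f \<theta> + g \<theta>) \<le> N f + N g" if "f \<in> Cinf" "g \<in> Cinf" for f g
    using N that by (auto simp: Ck_seminorm_def)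
  have scale: "N (\<lambda>\<theta>. a *\<^sub>R f \<theta>) = \<bar>a\<bar> * N f" if "f \<in> Cinf" for f a
    using N that by (auto simp: Ck_seminorm_def)
  obtain k M where M: "\<And>f e. f \<in> Cinf \<Longrightarrow> (\<And>\<theta>. norm ((ddt ^^ k) f \<theta>) \<le> e) \<Longrightarrow> N f \<le> M * e"
    using N unfolding Ck_seminorm_def by blast
  \<comment> \<open>Chosen so that M e is at most L - N v; adding 1 avoids division by zero, and the
    absolute value allows M of either sign.\<close>
  define e where "e = (L - N v) / (\<bar>M\<bar> + 1)"
  have e: "0 < e" using L by (simp add: e_def)
  have "M * e \<le> (\<bar>M\<bar> + 1) * e" using e by (intro mult_right_mono) auto
  also have "\<dots> = L - N v" using L by (simp add: e_def field_simps)
  finally have Me: "M * e \<le> L - N v" .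
  note vC = has_path_derivativeD(1)[OF v]
  have "eventually (\<lambda>s. s \<in> I \<and> s \<noteq> t) (at t within I)"
    by (simp add: eventually_at_filter)
  with has_path_derivativeD(2)[OF v e, of k]
  show "eventually (\<lambda>s. \<bar>N (\<gamma> s) - N (\<gamma> t)\<bar> \<le> L * \<bar>s - t\<bar>) (at t within I)"
  proof eventually_elim
    case (elim s)
    define q where "q = (\<lambda>\<theta>. (\<gamma> s \<theta> - \<gamma> t \<theta>) /\<^sub>R (s - t))"
    have q: "q \<in> Cinf" "\<And>\<theta>. norm ((ddt ^^ k) q \<theta> - (ddt ^^ k) v \<theta>) < e"
      using elim(1) by (auto simp: q_def)
    have s: "s \<in> I" "s \<noteq> t" using elim(2) by auto
    have "N (\<lambda>\<theta>. q \<theta> - v \<theta>) \<le> M * e"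
      using q vC by (intro M) (auto simp: ddt_pow_diff less_imp_le)
    then have Nq: "N q \<le> L"
      using add[of v "\<lambda>\<theta>. q \<theta> - v \<theta>"] vC q diff_Cinf[OF q(1) vC] Me by simp
    have "N (\<gamma> s) \<le> N (\<gamma> t) + \<bar>s - t\<bar> * N q"
    proof -
      have "\<gamma> s = (\<lambda>\<theta>. \<gamma> t \<theta> + (s - t) *\<^sub>R q \<theta>)" using s by (simp add: q_def fun_eq_iff)
      then show ?thesis
        using add[OF C[OF t] scaleR_const_Cinf[OF q(1)], of "s - t"] scale[OF q(1), of "s - t"] by metis
    qed
    moreover have "N (\<gamma> t) \<le> N (\<gamma> s) + \<bar>s - t\<bar> * N q"
    proof -
      have "\<gamma> t = (\<lambda>\<theta>. \<gamma> s \<theta> + (t - s) *\<^sub>R q \<theta>)"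
      proof
        fix \<theta>
        have "(t - s) *\<^sub>R q \<theta> = - ((s - t) *\<^sub>R q \<theta>)" by (metis minus_diff_eq scaleR_minus_left)
        then show "\<gamma> t \<theta> = \<gamma> s \<theta> + (t - s) *\<^sub>R q \<theta>" using s by (simp add: q_def)
      qed
      then show ?thesis
        using add[OF C[OF s(1)] scaleR_const_Cinf[OF q(1)], of "t - s"] scale[OF q(1), of "t - s"]
        by (metis abs_minus_commute)
    qed
    ultimately have "\<bar>N (\<gamma> s) - N (\<gamma> t)\<bar> \<le> \<bar>s - t\<bar> * N q" by linarith
    also have "\<dots> \<le> \<bar>s - t\<bar> * L" using Nq by (intro mult_left_mono) auto
    finally show ?case by (simp add: mult.commute)
  qed
qed

text \<open>A chain rule for local Lipschitz constants.\<close>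

lemma lipschitz_at_ln:
  assumes y: "lipschitz_at y L t I" and pos: "0 < y t" and L: "0 \<le> L"
  shows "lipschitz_at (\<lambda>s. ln (y s)) (L / y t) t I"
  unfolding lipschitz_at_def
proof (intro allI impI)
  fix L' assume L': "L / y t < L'"
  \<comment> \<open>The same slack e is allowed in the linearization of the logarithm and in the
    Lipschitz constant of y.\<close>
  have "((\<lambda>e. (1 / y t + e) * (L + e)) \<longlongrightarrow> (1 / y t + 0) * (L + 0)) (at_right 0)"
    by (intro tendsto_intros)
  then have "eventually (\<lambda>e. (1 / y t + e) * (L + e) < L') (at_right 0)"
    using L' by (intro order_tendstoD) auto
  then obtain e where e: "0 < e" "(1 / y t + e) * (L + e) < L'"
    using eventually_happens[OF eventually_conj[OF _ eventually_at_right_less[of "0::real"]]] by force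
  have "(ln has_derivative (\<lambda>h. h * (1 / y t))) (at (y t))"
    using DERIV_ln_divide[OF pos] unfolding has_field_derivative_def mult_commute_abs .
  then obtain d where d: "0 < d"
    "\<And>x. norm (x - y t) < d \<Longrightarrow> norm (ln x - ln (y t) - (x - y t) * (1 / y t)) \<le> e * norm (x - y t)"
    using e(1) unfolding has_derivative_within_alt by auto
  have 1: "eventually (\<lambda>s. \<bar>y s - y t\<bar> \<le> (L + e) * \<bar>s - t\<bar>) (at t within I)"
    using y e(1) by (simp add: lipschitz_at_def)
  have "((\<lambda>s. (L + e) * \<bar>s - t\<bar>) \<longlongrightarrow> (L + e) * \<bar>t - t\<bar>) (at t within I)"
    by (intro tendsto_intros)
  then have 2: "eventually (\<lambda>s. (L + e) * \<bar>s - t\<bar> < d) (at t within I)"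
    using d(1) by (intro order_tendstoD) auto
  from 1 2 show "eventually (\<lambda>s. \<bar>ln (y s) - ln (y t)\<bar> \<le> L' * \<bar>s - t\<bar>) (at t within I)"
  proof eventually_elim
    case (elim s)
    then have "\<bar>ln (y s) - ln (y t) - (y s - y t) * (1 / y t)\<bar> \<le> e * \<bar>y s - y t\<bar>"
      using d(2)[of "y s"] by simp
    moreover have "\<bar>(y s - y t) * (1 / y t)\<bar> = 1 / y t * \<bar>y s - y t\<bar>" using pos by (simp add: abs_mult)
    ultimately have "\<bar>ln (y s) - ln (y t)\<bar> \<le> (1 / y t + e) * \<bar>y s - y t\<bar>"
      unfolding distrib_right by linarith
    also have "\<dots> \<le> (1 / y t + e) * ((L + e) * \<bar>s - t\<bar>)"
      using elim(1) pos e(1) by (intro mult_left_mono) auto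
    also have "\<dots> \<le> L' * \<bar>s - t\<bar>"
      unfolding mult.assoc[symmetric] using e(2) by (intro mult_right_mono) auto
    finally show ?case .
  qed
qed

text \<open>A mean value inequality without differentiability. With an error e (v - u) the estimate
  is additive over adjacent intervals and holds near every point, so bisection
  (\<open>Bolzano\<close>) extends it to the whole interval.\<close>

lemma lipschitz_at_integral_bound:
  fixes \<phi> z :: "real \<Rightarrow> real"
  assumes ab: "a \<le> b" and \<phi>: "continuous_on {a..b} \<phi>"
    and z: "\<And>t. t \<in> {a..b} \<Longrightarrow> lipschitz_at z (\<phi> t) t {a..b}"
  shows "\<bar>z b - z a\<bar> \<le> integral {a..b} \<phi>"
proof (rule field_le_epsilon)
  fix e0 :: real assume "0 < e0"
  define e where "e = e0 / (b - a + 1)"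
  have e: "0 < e" using ab \<open>0 < e0\<close> by (simp add: e_def)
  have int: "\<phi> integrable_on {u..v}" if "a \<le> u" "v \<le> b" for u v
    using that by (intro integrable_continuous_real continuous_on_subset[OF \<phi>]) auto
  define P where "P u v \<longleftrightarrow> (a \<le> u \<longrightarrow> u \<le> v \<longrightarrow> v \<le> b \<longrightarrow> \<bar>z v - z u\<bar> \<le> integral {u..v} \<phi> + e * (v - u))" for u v
  have "P a b" using ab
  proof (induct rule: Bolzano)
    case (trans u v w)
    show ?case unfolding P_def
    proof (intro impI)
      assume uw: "a \<le> u" "u \<le> w" "w \<le> b"
      have "integral {u..v} \<phi> + integral {v..w} \<phi> = integral {u..w} \<phi>"
        using trans uw by (intro Henstock_Kurzweil_Integration.integral_combine int) auto
      then show "\<bar>z w - z u\<bar> \<le> integral {u..w} \<phi> + e * (w - u)"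
        using trans uw unfolding P_def right_diff_distrib by force
    qed
  next
    case (local x)
    then have x: "x \<in> {a..b}" by simp
    have "eventually (\<lambda>s. \<bar>z s - z x\<bar> \<le> (\<phi> x + e / 2) * \<bar>s - x\<bar>) (at x within {a..b})"
      using z[OF x] e by (simp add: lipschitz_at_def)
    then obtain d1 where d1: "0 < d1"
      "\<And>s. s \<in> {a..b} \<Longrightarrow> dist s x < d1 \<Longrightarrow> \<bar>z s - z x\<bar> \<le> (\<phi> x + e / 2) * \<bar>s - x\<bar>"
      unfolding eventually_at by (metis abs_zero diff_self mult_zero_right order_refl)
    obtain d2 where d2: "0 < d2" "\<And>s. s \<in> {a..b} \<Longrightarrow> dist s x < d2 \<Longrightarrow> dist (\<phi> s) (\<phi> x) < e / 2"
      using \<phi> x e unfolding continuous_on_iff by (meson half_gt_zero)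
    show ?case
    proof (intro exI[of _ "min d1 d2"] conjI allI impI)
      fix u v assume uv: "u \<le> x \<and> x \<le> v \<and> v - u < min d1 d2"
      show "P u v" unfolding P_def
      proof (intro impI)
        assume *: "a \<le> u" "u \<le> v" "v \<le> b"
        have "\<bar>z v - z x\<bar> \<le> (\<phi> x + e / 2) * (v - x)" "\<bar>z u - z x\<bar> \<le> (\<phi> x + e / 2) * (x - u)"
          using d1(2)[of v] d1(2)[of u] * uv by (auto simp: dist_real_def)
        then have "\<bar>z v - z u\<bar> \<le> (\<phi> x + e / 2) * (v - x) + (\<phi> x + e / 2) * (x - u)" by linarith
        \<comment> \<open>Near x the number \<phi> x - e/2 lies below \<phi>; the difference to
          \<phi> x + e/2 is charged to the error term.\<close>
        also have "\<dots> = (\<phi> x - e / 2) * (v - u) + e * (v - u)" by (simp add: field_simps)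
        also have "(\<phi> x - e / 2) * (v - u) = integral {u..v} (\<lambda>s. \<phi> x - e / 2)"
          using * by simp
        also have "\<dots> \<le> integral {u..v} \<phi>"
        proof (rule integral_le)
          show "\<phi> x - e / 2 \<le> \<phi> s" if "s \<in> {u..v}" for s
          proof -
            have "s \<in> {a..b}" "dist s x < d2" using that * uv by (auto simp: dist_real_def)
            then have "\<bar>\<phi> s - \<phi> x\<bar> < e / 2" using d2(2)[of s] by (simp add: dist_real_def)
            then show ?thesis by linarith
          qed
        qed (use int * in auto)
        finally show "\<bar>z v - z u\<bar> \<le> integral {u..v} \<phi> + e * (v - u)" by simp
      qed
    qed (use d1 d2 in auto)
  qed
  then have "\<bar>z b - z a\<bar> \<le> integral {a..b} \<phi> + e * (b - a)" using ab by (simp add: P_def)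
  also have "e * (b - a) \<le> e0" using ab \<open>0 < e0\<close> by (simp add: e_def field_simps)
  finally show "\<bar>z b - z a\<bar> \<le> integral {a..b} \<phi> + e0" by simp
qed

subsection \<open>Lengths of paths\<close>

text \<open>Applied to a smooth piece and to its derivative, this is what makes the integrand of the
  length continuous on the piece.\<close>

lemma continuous_map_path:
  fixes \<gamma> :: "real \<Rightarrow> real \<Rightarrow> 'a::real_normed_vector"
  assumes "\<And>t. t \<in> I \<Longrightarrow> \<exists>v. has_path_derivative \<gamma> v t I" and C: "\<And>t. t \<in> I \<Longrightarrow> \<gamma> t \<in> Cinf"
  shows "continuous_map (top_of_set I) Cinf_topology \<gamma>"
  unfolding Cinf_topology_def
proof (rule continuous_on_generated_topo)
  show "\<gamma> ` topspace (top_of_set I) \<subseteq>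
     \<Union> {{g \<in> Cinf. \<forall>\<theta>. norm ((ddt ^^ k) g \<theta> - (ddt ^^ k) f \<theta>) < \<epsilon>} |f k \<epsilon>. f \<in> Cinf \<and> 0 < \<epsilon>}"
    using C
    unfolding topology_generated_by_topspace[symmetric] Cinf_topology_def[symmetric] topspace_Cinf_topology
    by auto
next
  fix U :: "(real \<Rightarrow> 'a) set"
  assume "U \<in> {{g \<in> Cinf. \<forall>\<theta>. norm ((ddt ^^ k) g \<theta> - (ddt ^^ k) f \<theta>) < \<epsilon>} |f k \<epsilon>. f \<in> Cinf \<and> 0 < \<epsilon>}"
  then obtain f k \<epsilon> where f: "f \<in> Cinf" and \<epsilon>: "0 < \<epsilon>"
    and U: "U = {g \<in> Cinf. \<forall>\<theta>. norm ((ddt ^^ k) g \<theta> - (ddt ^^ k) f \<theta>) < \<epsilon>}" by auto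
  show "openin (top_of_set I) (\<gamma> -` U \<inter> topspace (top_of_set I))"
    unfolding openin_euclidean_subtopology_iff topspace_euclidean_subtopology
  proof (intro conjI ballI)
    fix t assume t: "t \<in> \<gamma> -` U \<inter> I"
    then have tI: "t \<in> I" by simp
    obtain v where v: "has_path_derivative \<gamma> v t I" using assms(1)[OF tI] by auto
    have vC: "v \<in> Cinf" by (rule has_path_derivativeD[OF v])
    let ?h = "\<lambda>\<theta>. norm ((ddt ^^ k) (\<gamma> t) \<theta> - (ddt ^^ k) f \<theta>)"
    have per: "periodic ?h"
      using Cinf_periodic[OF diff_Cinf[OF ddt_pow_Cinf[OF C[OF tI], of k] ddt_pow_Cinf[OF f, of k]]]
      by (rule periodic_compose)
    have "continuous_on {0..2*pi} ?h"
      using f C[OF tI] by (intro continuous_intros Cinf_continuous_on ddt_pow_Cinf)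
    then obtain x where "x \<in> {0..2*pi}" and x: "\<And>y. y \<in> {0..2*pi} \<Longrightarrow> ?h y \<le> ?h x"
      using continuous_attains_sup[of "{0..2*pi}" ?h] by auto
    \<comment> \<open>Compactness of one period turns the pointwise strict inequality into a gap
      that is uniform in \<theta>.\<close>
    define \<delta> where "\<delta> = \<epsilon> - ?h x"
    have \<delta>: "0 < \<delta>" using t U by (auto simp: \<delta>_def)
    have h: "?h \<theta> \<le> \<epsilon> - \<delta>" for \<theta>
    proof -
      obtain y where "y \<in> {0..2*pi}" "?h y = ?h \<theta>"
        using periodic_representative[OF per] by blast
      then show ?thesis using x[of y] by (simp add: \<delta>_def)
    qed
    obtain K where K: "0 < K" "\<And>\<theta>. norm ((ddt ^^ k) v \<theta>) \<le> K"
      using Cinf_bounded[OF ddt_pow_Cinf[OF vC]] by blast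
    obtain d where d: "0 < d" "\<And>s. s \<in> I \<Longrightarrow> s \<noteq> t \<Longrightarrow> dist s t < d \<Longrightarrow>
        (\<lambda>\<theta>. (\<gamma> s \<theta> - \<gamma> t \<theta>) /\<^sub>R (s - t)) \<in> Cinf \<and>
        (\<forall>\<theta>. norm ((ddt ^^ k) (\<lambda>\<theta>. (\<gamma> s \<theta> - \<gamma> t \<theta>) /\<^sub>R (s - t)) \<theta> - (ddt ^^ k) v \<theta>) < 1)"
      using has_path_derivativeD(2)[OF v zero_less_one, of k] unfolding eventually_at by blast
    show "\<exists>e>0. \<forall>s\<in>I. dist s t < e \<longrightarrow> s \<in> \<gamma> -` U \<inter> I"
    \<comment> \<open>For s within d of t the k-th derivative of the difference quotient is bounded
      by K + 1: K for v and 1 for its distance to v.\<close>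
    proof (intro exI[of _ "min d (\<delta> / (K + 1))"] conjI ballI impI)
      show "0 < min d (\<delta> / (K + 1))" using d \<delta> K by simp
      fix s assume s: "s \<in> I" "dist s t < min d (\<delta> / (K + 1))"
      have "norm ((ddt ^^ k) (\<gamma> s) \<theta> - (ddt ^^ k) f \<theta>) < \<epsilon>" for \<theta>
      proof (cases "s = t")
        case True
        then show ?thesis using t U by auto
      next
        case False
        define q where "q = (\<lambda>\<theta>. (\<gamma> s \<theta> - \<gamma> t \<theta>) /\<^sub>R (s - t))"
        have q: "q \<in> Cinf" "norm ((ddt ^^ k) q \<theta> - (ddt ^^ k) v \<theta>) < 1"
          using d(2)[OF s(1) False] s by (auto simp: q_def)
        have "norm ((ddt ^^ k) q \<theta>) \<le> K + 1"
          using norm_triangle_ineq2[of "(ddt ^^ k) q \<theta>" "(ddt ^^ k) v \<theta>"] q(2) K(2)[of \<theta>] by linarith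
        moreover have "(\<lambda>\<theta>. (s - t) *\<^sub>R q \<theta>) = (\<lambda>\<theta>. \<gamma> s \<theta> - \<gamma> t \<theta>)"
          using False by (simp add: q_def)
        then have "(s - t) *\<^sub>R (ddt ^^ k) q \<theta> = (ddt ^^ k) (\<gamma> s) \<theta> - (ddt ^^ k) (\<gamma> t) \<theta>"
          using ddt_pow_scaleR_const[OF q(1), of k "s - t"] ddt_pow_diff[OF C[OF s(1)] C[OF tI], of k]
          by (simp add: fun_eq_iff)
        moreover have "norm ((s - t) *\<^sub>R (ddt ^^ k) q \<theta>) < \<delta>"
        proof -
          have "norm ((s - t) *\<^sub>R (ddt ^^ k) q \<theta>) \<le> \<bar>s - t\<bar> * (K + 1)"
            using calculation(1) by (simp add: mult_left_mono)
          also have "\<dots> < \<delta>" using s K by (simp add: dist_real_def field_simps)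
          finally show ?thesis .
        qed
        ultimately have "norm (((ddt ^^ k) (\<gamma> s) \<theta> - (ddt ^^ k) (\<gamma> t) \<theta>) + ((ddt ^^ k) (\<gamma> t) \<theta> - (ddt ^^ k) f \<theta>)) < \<epsilon>"
          using h[of \<theta>] by (intro norm_triangle_lt) simp
        then show ?thesis by simp
      qed
      then show "s \<in> \<gamma> -` U \<inter> I" using s(1) C by (simp add: U)
    qed
  qed auto
qed

lemma weakly_continuous_metric_nonneg:
  assumes "weakly_continuous_metric G" "c \<in> Imm" "v \<in> Cinf"
  shows "0 \<le> G c v v" and "G c (\<lambda>\<theta>. 0) (\<lambda>\<theta>. 0) = 0"
proof -
  have "\<forall>c\<in>Imm. \<forall>h\<in>Cinf. \<forall>l\<in>Cinf. \<forall>a. G c (\<lambda>\<theta>. a *\<^sub>R h \<theta>) l = a * G c h l"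
    using assms(1) unfolding weakly_continuous_metric_def by blast
  from this[rule_format, OF assms(2) const_Cinf const_Cinf, of 0 0 0]
  show 0: "G c (\<lambda>\<theta>. 0) (\<lambda>\<theta>. 0) = 0" by simp
  have "v \<noteq> (\<lambda>\<theta>. 0) \<longrightarrow> 0 < G c v v"
    using assms unfolding weakly_continuous_metric_def by blast
  then show "0 \<le> G c v v" using 0 by (cases "v = (\<lambda>\<theta>. 0)") auto
qed

text \<open>\<open>velocity\<close> is a derivative relative to \<open>{0..1}\<close>, while
  smoothness is relative to the piece. The two filters agree at interior points, where uniqueness
  identifies the chosen value; at the end points it remains unknown.\<close>

lemma smooth_piece_velocity:
  assumes G: "weakly_continuous_metric G" and ab: "a < b" and \<gamma>: "smooth_path_on {a..b} \<gamma>"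
    and I: "\<And>t. t \<in> {a..b} \<Longrightarrow> \<gamma> t \<in> Imm" and sub: "{a..b} \<subseteq> {0..1}"
  shows "\<exists>v. (\<forall>t\<in>{a..b}. has_path_derivative \<gamma> (v t) t {a..b}) \<and>
    continuous_on {a..b} (\<lambda>t. sqrt (G (\<gamma> t) (v t) (v t))) \<and>
    (\<forall>t\<in>{a<..<b}. velocity \<gamma> t = v t)"
proof -
  obtain \<Gamma> where \<Gamma>: "\<Gamma> 0 = \<gamma>" "\<And>k t. t \<in> {a..b} \<Longrightarrow> has_path_derivative (\<Gamma> k) (\<Gamma> (Suc k) t) t {a..b}"
    using \<gamma> by (auto simp: smooth_path_on_def)
  have C: "\<Gamma> k t \<in> Cinf" if "t \<in> {a..b}" for k t
  proof (cases k)
    case 0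
    then show ?thesis using I[OF that] \<Gamma>(1) by (simp add: Imm_def)
  next
    case (Suc l)
    then show ?thesis using has_path_derivativeD(1)[OF \<Gamma>(2)[OF that, of l]] by simp
  qed
  have cont: "continuous_map (top_of_set {a..b}) Cinf_topology (\<Gamma> k)" for k
    using \<Gamma>(2) C by (intro continuous_map_path) blast+
  have "continuous_map (top_of_set {a..b})
      (prod_topology (subtopology Cinf_topology Imm) (prod_topology Cinf_topology Cinf_topology))
      (\<lambda>t. (\<gamma> t, \<Gamma> 1 t, \<Gamma> 1 t))"
    using cont[of 0] cont[of 1] I \<Gamma>(1)
    by (intro continuous_map_pairedI continuous_map_into_subtopology) auto
  moreover have "continuous_map
       (prod_topology (subtopology Cinf_topology Imm) (prod_topology Cinf_topology Cinf_topology))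
       euclideanreal (\<lambda>(c, h, k). G c h k)"
    using G unfolding weakly_continuous_metric_def by blast
  ultimately have "continuous_map (top_of_set {a..b}) euclideanreal
      ((\<lambda>(c, h, k). G c h k) \<circ> (\<lambda>t. (\<gamma> t, \<Gamma> 1 t, \<Gamma> 1 t)))"
    by (rule continuous_map_compose)
  then have "continuous_on {a..b} (\<lambda>t. G (\<gamma> t) (\<Gamma> 1 t) (\<Gamma> 1 t))"
    by (simp add: o_def)
  then have 1: "continuous_on {a..b} (\<lambda>t. sqrt (G (\<gamma> t) (\<Gamma> 1 t) (\<Gamma> 1 t)))"
    by (intro continuous_intros)
  have 2: "velocity \<gamma> t = \<Gamma> 1 t" if "t \<in> {a<..<b}" for t
  proof -
    have t: "t \<in> {a..b}" using that by auto
    have "0 < t" "t < 1" using that sub ab by auto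
    then have at: "at t within {0..1} = at t" by (simp add: at_within_Icc_at)
    have "at t within {a..b} = at t" using that by (simp add: at_within_Icc_at)
    then have v: "has_path_derivative \<gamma> (\<Gamma> 1 t) t {0..1}"
      using \<Gamma>(2)[OF t, of 0] \<Gamma>(1) at by (auto intro: has_path_derivative_filter_mono)
    then have "has_path_derivative \<gamma> (velocity \<gamma> t) t {0..1}"
      unfolding velocity_def by (rule someI[of "\<lambda>v. has_path_derivative \<gamma> v t {0..1}"])
    then show ?thesis using has_path_derivative_unique v at by (metis trivial_limit_at)
  qed
  show ?thesis
    using \<Gamma>(2)[of _ 0] \<Gamma>(1) 1 2 by (intro exI[of _ "\<Gamma> 1"]) simp
qed

text \<open>The Lipschitz condition ranges over all subintervals, so that it applies to each smooth
  piece with one-sided derivatives at its ends. Integrability is part of the conclusion because the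
  integral in \<open>path_len\<close> would otherwise have the default value 0.\<close>

lemma path_len_bound:
  assumes G: "weakly_continuous_metric G" and \<gamma>: "piecewise_smooth_path \<gamma>"
    and K: "0 \<le> K"
    and z: "\<And>t v a b. t \<in> {a..b} \<Longrightarrow> {a..b} \<subseteq> {0..1} \<Longrightarrow> has_path_derivative \<gamma> v t {a..b} \<Longrightarrow>
      lipschitz_at z (K * sqrt (G (\<gamma> t) v v)) t {a..b}"
  shows "set_integrable lebesgue {0..1} (\<lambda>t. sqrt (G (\<gamma> t) (velocity \<gamma> t) (velocity \<gamma> t)))"
    and "\<bar>z 1 - z 0\<bar> \<le> K * path_len G \<gamma>"
proof -
  let ?F = "\<lambda>t. sqrt (G (\<gamma> t) (velocity \<gamma> t) (velocity \<gamma> t))"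
  obtain m \<tau> where \<tau>: "\<tau> 0 = 0" "\<tau> m = 1" "\<And>i. i < m \<Longrightarrow> \<tau> i < \<tau> (Suc i)"
    "\<And>i. i < m \<Longrightarrow> smooth_path_on {\<tau> i..\<tau> (Suc i)} \<gamma>"
    and I: "\<And>t. t \<in> {0..1} \<Longrightarrow> \<gamma> t \<in> Imm"
    using \<gamma> unfolding piecewise_smooth_path_def by blast
  have mono: "\<tau> i \<le> \<tau> j" if "i \<le> j" "j \<le> m" for i j
    using that
  proof (induction j)
    case (Suc j)
    then show ?case using \<tau>(3)[of j] by (cases "i = Suc j") auto
  qed simp
  have piece: "?F absolutely_integrable_on {\<tau> i..\<tau> (Suc i)} \<and>
      \<bar>z (\<tau> (Suc i)) - z (\<tau> i)\<bar> \<le> K * integral {\<tau> i..\<tau> (Suc i)} ?F" if i: "i < m" for i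
  proof -
    have sub: "{\<tau> i..\<tau> (Suc i)} \<subseteq> {0..1}"
      using mono[of 0 i] mono[of "Suc i" m] \<tau>(1,2) i by auto
    obtain v where v: "(\<forall>t\<in>{\<tau> i..\<tau> (Suc i)}. has_path_derivative \<gamma> (v t) t {\<tau> i..\<tau> (Suc i)}) \<and>
      continuous_on {\<tau> i..\<tau> (Suc i)} (\<lambda>t. sqrt (G (\<gamma> t) (v t) (v t))) \<and>
      (\<forall>t\<in>{\<tau> i<..<\<tau> (Suc i)}. velocity \<gamma> t = v t)"
      using smooth_piece_velocity[OF G \<tau>(3)[OF i] \<tau>(4)[OF i] I[OF subsetD[OF sub]] sub] ..
    note cont = v[THEN conjunct2, THEN conjunct1] and vel = v[THEN conjunct2, THEN conjunct2, rule_format]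
      and v = v[THEN conjunct1, rule_format]
    \<comment> \<open>The unknown velocities at the two ends change the integrand on a null set
      only.\<close>
    have neg: "negligible {\<tau> i, \<tau> (Suc i)}" by simp
    have eq: "?F t = sqrt (G (\<gamma> t) (v t) (v t))" if "t \<in> {\<tau> i..\<tau> (Suc i)} - {\<tau> i, \<tau> (Suc i)}" for t
      using vel[of t] that by auto
    have ai: "?F absolutely_integrable_on {\<tau> i..\<tau> (Suc i)}"
      using absolutely_integrable_spike[OF absolutely_integrable_continuous_real[OF cont] neg eq] .
    have "\<bar>z (\<tau> (Suc i)) - z (\<tau> i)\<bar> \<le> integral {\<tau> i..\<tau> (Suc i)} (\<lambda>t. K * sqrt (G (\<gamma> t) (v t) (v t)))"
      using \<tau>(3)[OF i] cont z[OF _ sub v]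
      by (intro lipschitz_at_integral_bound continuous_on_mult[OF continuous_on_const]) auto
    also have "integral {\<tau> i..\<tau> (Suc i)} (\<lambda>t. K * sqrt (G (\<gamma> t) (v t) (v t))) = K * integral {\<tau> i..\<tau> (Suc i)} ?F"
    proof -
      have "integral {\<tau> i..\<tau> (Suc i)} (\<lambda>t. sqrt (G (\<gamma> t) (v t) (v t))) = integral {\<tau> i..\<tau> (Suc i)} ?F"
        by (rule integral_spike[OF neg eq])
      then show ?thesis by simp
    qed
    finally show ?thesis using ai by (intro conjI)
  qed
  have "?F absolutely_integrable_on {0..\<tau> i} \<and> \<bar>z (\<tau> i) - z 0\<bar> \<le> K * integral {0..\<tau> i} ?F" if "i \<le> m" for i
    using that
  proof (induction i)
    case 0
    have "?F absolutely_integrable_on {0..0}"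
      by (intro absolutely_integrable_continuous_real) simp
    then show ?case using \<tau>(1) by simp
  next
    case (Suc i)
    have le: "0 \<le> \<tau> i" "\<tau> i \<le> \<tau> (Suc i)" using mono[of 0 i] \<tau>(1) \<tau>(3)[of i] Suc.prems by auto
    have IH: "?F absolutely_integrable_on {0..\<tau> i}" "\<bar>z (\<tau> i) - z 0\<bar> \<le> K * integral {0..\<tau> i} ?F"
      using Suc.IH Suc.prems by simp_all
    have pc: "?F absolutely_integrable_on {\<tau> i..\<tau> (Suc i)}"
      "\<bar>z (\<tau> (Suc i)) - z (\<tau> i)\<bar> \<le> K * integral {\<tau> i..\<tau> (Suc i)} ?F"
      using piece[of i] Suc.prems by simp_all
    have "{0..\<tau> i} \<union> {\<tau> i..\<tau> (Suc i)} = {0..\<tau> (Suc i)}" using le by auto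
    then have ai: "?F absolutely_integrable_on {0..\<tau> (Suc i)}"
      using set_integrable_Un[OF IH(1) pc(1)] by simp
    then have "?F integrable_on {0..\<tau> (Suc i)}" by (rule set_lebesgue_integral_eq_integral(1))
    then have "integral {0..\<tau> i} ?F + integral {\<tau> i..\<tau> (Suc i)} ?F = integral {0..\<tau> (Suc i)} ?F"
      using le by (intro Henstock_Kurzweil_Integration.integral_combine)
    then have "K * integral {0..\<tau> i} ?F + K * integral {\<tau> i..\<tau> (Suc i)} ?F = K * integral {0..\<tau> (Suc i)} ?F"
      by (simp only: distrib_left[symmetric])
    then have "\<bar>z (\<tau> (Suc i)) - z 0\<bar> \<le> K * integral {0..\<tau> (Suc i)} ?F" using IH(2) pc(2) by linarith
    then show ?case using ai by (intro conjI)
  qed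
  from this[of m] have *: "?F absolutely_integrable_on {0..1}" "\<bar>z 1 - z 0\<bar> \<le> K * integral {0..1} ?F"
    using \<tau>(2) by auto
  show "set_integrable lebesgue {0..1} ?F" by (rule *(1))
  show "\<bar>z 1 - z 0\<bar> \<le> K * path_len G \<gamma>"
    using *(2) set_lebesgue_integral_eq_integral(2)[OF *(1)] by (simp add: path_len_def)
qed

text \<open>The values of G outside \<open>Cinf\<close> are arbitrary, so the sign of G on the
  velocity is secured only off the break points.\<close>

lemma velocity_Cinf:
  fixes \<gamma> :: "real \<Rightarrow> real \<Rightarrow> 'a::real_normed_vector"
    and G :: "(real \<Rightarrow> 'a) \<Rightarrow> (real \<Rightarrow> 'a) \<Rightarrow> (real \<Rightarrow> 'a) \<Rightarrow> real"
  assumes G: "weakly_continuous_metric G" and \<gamma>: "piecewise_smooth_path \<gamma>"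
  obtains S where "finite S" "\<And>s. s \<in> {0..1} - S \<Longrightarrow> velocity \<gamma> s \<in> Cinf"
proof -
  obtain m \<tau> where \<tau>: "\<tau> 0 = 0" "\<tau> m = 1" "\<And>i. i < m \<Longrightarrow> \<tau> i < \<tau> (Suc i)"
    "\<And>i. i < m \<Longrightarrow> smooth_path_on {\<tau> i..\<tau> (Suc i)} \<gamma>"
    and I: "\<And>t. t \<in> {0..1} \<Longrightarrow> \<gamma> t \<in> Imm"
    using \<gamma> unfolding piecewise_smooth_path_def by blast
  have mono: "\<tau> i \<le> \<tau> j" if "i \<le> j" "j \<le> m" for i j
    using that
  proof (induction j)
    case (Suc j)
    then show ?case using \<tau>(3)[of j] by (cases "i = Suc j") auto
  qed simp
  have "velocity \<gamma> s \<in> Cinf" if s: "s \<in> {0..1} - \<tau> ` {..m}" for s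
  proof -
    define l where "l = (LEAST i. i \<le> m \<and> s \<le> \<tau> i)"
    have ex: "m \<le> m \<and> s \<le> \<tau> m" using \<tau>(2) s by simp
    have l: "l \<le> m" "s \<le> \<tau> l" using LeastI[of "\<lambda>i. i \<le> m \<and> s \<le> \<tau> i", OF ex] by (auto simp: l_def)
    have "s \<noteq> \<tau> i" if "i \<le> m" for i using s that by auto
    then have ne: "s < \<tau> l" "s \<noteq> \<tau> 0" using l by (auto simp: less_le)
    then have "l \<noteq> 0" using \<tau>(1) s by auto
    then obtain i where i: "l = Suc i" by (cases l) auto
    have "\<tau> i < s"
      using not_less_Least[of i "\<lambda>i. i \<le> m \<and> s \<le> \<tau> i"] i l by (auto simp: l_def[symmetric])
    have im: "i < m" using i l by simp
    have sub: "{\<tau> i..\<tau> (Suc i)} \<subseteq> {0..1}"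
      using mono[of 0 i] mono[of "Suc i" m] \<tau>(1,2) im by auto
    obtain v where v: "(\<forall>t\<in>{\<tau> i..\<tau> (Suc i)}. has_path_derivative \<gamma> (v t) t {\<tau> i..\<tau> (Suc i)}) \<and>
      continuous_on {\<tau> i..\<tau> (Suc i)} (\<lambda>t. sqrt (G (\<gamma> t) (v t) (v t))) \<and>
      (\<forall>t\<in>{\<tau> i<..<\<tau> (Suc i)}. velocity \<gamma> t = v t)"
      using smooth_piece_velocity[OF G \<tau>(3)[OF im] \<tau>(4)[OF im] I[OF subsetD[OF sub]] sub] ..
    note vel = v[THEN conjunct2, THEN conjunct2, rule_format] and v = v[THEN conjunct1, rule_format]
    show ?thesis
      using has_path_derivativeD(1)[OF v[of s]] vel[of s] \<open>\<tau> i < s\<close> ne(1) i by simp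
  qed
  then show ?thesis by (intro that[of "\<tau> ` {..m}"]) auto
qed

text \<open>With K = 0 and a constant function the Lipschitz condition becomes trivial.\<close>

lemma path_speed_integrable:
  assumes G: "weakly_continuous_metric G" and \<gamma>: "piecewise_smooth_path \<gamma>"
  shows "set_integrable lebesgue {0..1} (\<lambda>t. sqrt (G (\<gamma> t) (velocity \<gamma> t) (velocity \<gamma> t)))"
  by (rule path_len_bound(1)[OF G \<gamma> order_refl, of "\<lambda>t. 0"]) (simp add: lipschitz_at_const)

text \<open>Freezing the path at time t, rather than rescaling time, leaves its velocity before t as
  it was.\<close>

lemma piecewise_smooth_path_stop:
  assumes \<gamma>: "piecewise_smooth_path \<gamma>" and t: "0 < t" "t < 1"
  shows "piecewise_smooth_path (\<lambda>s. \<gamma> (min s t))"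
proof -
  obtain m \<tau> where \<tau>: "\<tau> 0 = 0" "\<tau> m = 1" "\<And>i. i < m \<Longrightarrow> \<tau> i < \<tau> (Suc i)"
    "\<And>i. i < m \<Longrightarrow> smooth_path_on {\<tau> i..\<tau> (Suc i)} \<gamma>"
    and I: "\<And>t. t \<in> {0..1} \<Longrightarrow> \<gamma> t \<in> Imm"
    using \<gamma> unfolding piecewise_smooth_path_def by blast
  define l where "l = (LEAST i. i \<le> m \<and> t \<le> \<tau> i)"
  have ex: "m \<le> m \<and> t \<le> \<tau> m" using \<tau>(2) t by simp
  have l: "l \<le> m" "t \<le> \<tau> l" using LeastI[of "\<lambda>i. i \<le> m \<and> t \<le> \<tau> i", OF ex] by (auto simp: l_def)
  have "l \<noteq> 0" using l \<tau>(1) t by (metis less_le_not_le)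
  then obtain j where j: "l = Suc j" by (cases l) auto
  have lt: "\<tau> i < t" if "i \<le> j" for i
    using not_less_Least[of i "\<lambda>i. i \<le> m \<and> t \<le> \<tau> i"] that j l by (auto simp: l_def[symmetric])
  \<comment> \<open>The piece that contains t ends at t, and the constant piece from t to 1 is
    appended.\<close>
  define \<tau>' where "\<tau>' = (\<lambda>i. if i \<le> j then \<tau> i else if i = Suc j then t else 1)"
  have "\<tau>' i < \<tau>' (Suc i) \<and> smooth_path_on {\<tau>' i..\<tau>' (Suc i)} (\<lambda>s. \<gamma> (min s t))" if "i < Suc (Suc j)" for i
  proof -
    have "i < j \<or> i = j \<or> i = Suc j" using that by linarith
    then consider "i < j" | "i = j" | "i = Suc j" by blast
    then show ?thesis
    proof cases
      case 1
      then have *: "\<tau>' i = \<tau> i" "\<tau>' (Suc i) = \<tau> (Suc i)" "i < m" using j l by (auto simp: \<tau>'_def)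
      have "smooth_path_on {\<tau> i..\<tau> (Suc i)} (\<lambda>s. \<gamma> (min s t))"
        using lt[of "Suc i"] 1 by (intro smooth_path_on_cong[OF \<tau>(4)[OF *(3)]]) auto
      then show ?thesis using * \<tau>(3) by simp
    next
      case 2
      then have *: "\<tau>' i = \<tau> i" "\<tau>' (Suc i) = t" "i < m" using j l by (auto simp: \<tau>'_def)
      have "smooth_path_on {\<tau> i..t} \<gamma>"
        using l j 2 by (intro smooth_path_on_subset[OF \<tau>(4)[OF *(3)]]) auto
      then have "smooth_path_on {\<tau> i..t} (\<lambda>s. \<gamma> (min s t))"
        by (rule smooth_path_on_cong) auto
      then show ?thesis using * lt[of i] 2 by simp
    next
      case 3
      then have *: "\<tau>' i = t" "\<tau>' (Suc i) = 1" by (auto simp: \<tau>'_def)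
      have "smooth_path_on {t..1} (\<lambda>s. \<gamma> (min s t))"
        by (rule smooth_path_on_cong[OF smooth_path_on_const]) auto
      then show ?thesis using * t by simp
    qed
  qed
  moreover have "\<tau>' 0 = 0" "\<tau>' (Suc (Suc j)) = 1" using \<tau>(1) by (auto simp: \<tau>'_def)
  moreover have "\<gamma> (min s t) \<in> Imm" if "s \<in> {0..1}" for s
    using that t by (intro I) auto
  ultimately show ?thesis unfolding piecewise_smooth_path_def by blast
qed

text \<open>The integrand agrees with the old one before t and vanishes after t. The comparison is
  almost everywhere, since neither t nor a break point need have a velocity.\<close>

lemma path_len_stop:
  assumes G: "weakly_continuous_metric G" and \<gamma>: "piecewise_smooth_path \<gamma>" and t: "0 < t" "t < 1"
  shows "path_len G (\<lambda>s. \<gamma> (min s t)) \<le> path_len G \<gamma>"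
proof -
  let ?\<gamma>' = "\<lambda>s. \<gamma> (min s t)"
  let ?F = "\<lambda>\<gamma> t. sqrt (G (\<gamma> t) (velocity \<gamma> t) (velocity \<gamma> t))"
  have I: "\<And>t. t \<in> {0..1} \<Longrightarrow> \<gamma> t \<in> Imm" using \<gamma> by (simp add: piecewise_smooth_path_def)
  have before: "velocity ?\<gamma>' s = velocity \<gamma> s" if "s < t" for s
  proof -
    have "eventually (\<lambda>u. u < t) (at s within {0..1})"
      using order_tendstoD(2)[OF tendsto_ident_at that] .
    then have ev: "eventually (\<lambda>u. \<gamma> u = ?\<gamma>' u) (at s within {0..1})" by eventually_elim simp
    then have "has_path_derivative ?\<gamma>' v s {0..1} \<longleftrightarrow> has_path_derivative \<gamma> v s {0..1}" for v
      using that has_path_derivative_cong[of \<gamma> ?\<gamma>' s "{0..1}" v] has_path_derivative_cong[of ?\<gamma>' \<gamma> s "{0..1}" v]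
      by (auto simp: eq_commute)
    then show ?thesis by (simp add: velocity_def)
  qed
  have after: "velocity ?\<gamma>' s = (\<lambda>\<theta>. 0)" if "t < s" "s \<le> 1" for s
  proof -
    have "eventually (\<lambda>u. t < u) (at s within {0..1})"
      using order_tendstoD(1)[OF tendsto_ident_at that(1)] .
    then have ev: "eventually (\<lambda>u. \<gamma> t = ?\<gamma>' u) (at s within {0..1})" by eventually_elim simp
    have v: "has_path_derivative ?\<gamma>' (\<lambda>\<theta>. 0) s {0..1}"
      by (rule has_path_derivative_cong[OF ev _ has_path_derivative_const]) (use that in simp)
    then have "has_path_derivative ?\<gamma>' (velocity ?\<gamma>' s) s {0..1}"
      unfolding velocity_def by (rule someI[of "\<lambda>v. has_path_derivative ?\<gamma>' v s {0..1}"])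
    then show ?thesis
      using v that t by (intro has_path_derivative_unique) (auto simp: trivial_limit_within)
  qed
  obtain S where S: "finite S" "\<And>s. s \<in> {0..1} - S \<Longrightarrow> velocity \<gamma> s \<in> Cinf"
    using velocity_Cinf[OF G \<gamma>] by blast
  have "insert t S \<in> null_sets lebesgue"
    using S(1) by (simp add: negligible_iff_null_sets[symmetric] negligible_finite)
  then have ae: "AE s in lebesgue. s \<notin> insert t S" by (rule AE_not_in)
  have key: "?F ?\<gamma>' s \<le> ?F \<gamma> s" if s: "s \<in> {0..1}" "s \<notin> insert t S" for s
  proof (cases "s < t")
    case True
    then show ?thesis using before[OF True] by simp
  next
    case False
    then have "?F ?\<gamma>' s = 0"
      using after[of s] s weakly_continuous_metric_nonneg(2)[OF G I const_Cinf] t by simp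
    moreover have "0 \<le> G (\<gamma> s) (velocity \<gamma> s) (velocity \<gamma> s)"
      using weakly_continuous_metric_nonneg(1)[OF G I S(2)] s by simp
    ultimately show ?thesis by simp
  qed
  have "AE s\<in>{0..1} in lebesgue. ?F ?\<gamma>' s \<le> ?F \<gamma> s"
    using ae by (rule eventually_mono) (intro impI key)
  show ?thesis
    unfolding path_len_def
  proof (rule set_integral_mono_AE)
    show "set_integrable lebesgue {0..1} (?F ?\<gamma>')"
      by (rule path_speed_integrable[OF G piecewise_smooth_path_stop[OF \<gamma> t]])
    show "set_integrable lebesgue {0..1} (?F \<gamma>)"
      by (rule path_speed_integrable[OF G \<gamma>])
    show "AE s\<in>{0..1} in lebesgue. ?F ?\<gamma>' s \<le> ?F \<gamma> s" by fact
  qed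
qed

text \<open>Each intermediate curve is the end point of a stopped path of length still below r. The
  estimate assumed on the ball is thus available along the whole path.\<close>

lemma metric_ball_path:
  assumes G: "weakly_continuous_metric G" and c: "c \<in> metric_ball G c0 r"
  obtains \<gamma> where "piecewise_smooth_path \<gamma>" "\<gamma> 0 = c0" "\<gamma> 1 = c" "path_len G \<gamma> < r"
    "\<And>t. t \<in> {0..1} \<Longrightarrow> \<gamma> t \<in> metric_ball G c0 r"
proof -
  have "c \<in> Imm" "geodesic_dist G c0 c < ereal r" using c by (auto simp: metric_ball_def)
  then obtain \<gamma> where \<gamma>: "piecewise_smooth_path \<gamma>" "\<gamma> 0 = c0" "\<gamma> 1 = c" "path_len G \<gamma> < r"
    by (auto simp: geodesic_dist_def INF_less_iff)
  have I: "\<And>t. t \<in> {0..1} \<Longrightarrow> \<gamma> t \<in> Imm" using \<gamma>(1) by (simp add: piecewise_smooth_path_def)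
  have dist: "geodesic_dist G c0 (\<gamma>' 1) < ereal r"
    if "piecewise_smooth_path \<gamma>'" "\<gamma>' 0 = c0" "path_len G \<gamma>' < r" for \<gamma>'
  proof -
    have "geodesic_dist G c0 (\<gamma>' 1) \<le> ereal (path_len G \<gamma>')"
      unfolding geodesic_dist_def by (rule INF_lower) (use that in simp)
    then show ?thesis using that(3) by (meson ereal_less_eq(3) le_less_trans less_ereal.simps(1))
  qed
  have "\<gamma> t \<in> metric_ball G c0 r" if t: "t \<in> {0..1}" for t
  proof -
    have mid: "geodesic_dist G c0 (\<gamma> t) < ereal r" if "0 < t" "t < 1" for t
      using dist[OF piecewise_smooth_path_stop[OF \<gamma>(1) that]] path_len_stop[OF G \<gamma>(1) that] \<gamma> that
      by (simp add: min_def)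
    \<comment> \<open>Stopping requires t > 0, so the centre is reached by the constant path of
      length 0; that r is positive follows from the length of \<gamma> being nonnegative.\<close>
    have const: "velocity (\<lambda>s. c0) s = (\<lambda>\<theta>. 0)" if "s \<in> {0..1}" for s
    proof -
      have "has_path_derivative (\<lambda>s. c0) (velocity (\<lambda>s. c0) s) s {0..1}"
        unfolding velocity_def by (rule someI[of "\<lambda>v. has_path_derivative (\<lambda>s. c0) v s {0..1}", OF has_path_derivative_const])
      then show ?thesis
        using that by (intro has_path_derivative_unique[OF _ has_path_derivative_const])
          (auto simp: trivial_limit_within)
    qed
    have c0: "c0 \<in> Imm" using I[of 0] \<gamma>(2) by simp
    have "(\<lambda>t. indicat_real {0..1} t *\<^sub>R sqrt (G c0 (velocity (\<lambda>s. c0) t) (velocity (\<lambda>s. c0) t))) = (\<lambda>t. 0)"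
      by (auto simp: fun_eq_iff const weakly_continuous_metric_nonneg(2)[OF G c0 const_Cinf] indicator_def)
    then have len0: "path_len G (\<lambda>s. c0) = 0"
      unfolding path_len_def set_lebesgue_integral_def by (simp only: integral_zero)
    have "piecewise_smooth_path (\<lambda>s. c0)"
      unfolding piecewise_smooth_path_def using c0
      by (intro conjI ballI exI[of _ 1] exI[of _ real]) (auto simp: smooth_path_on_const)
    moreover have "0 \<le> path_len G \<gamma>"
    proof -
      \<comment> \<open>The length estimate for the zero function, with K = 1, says that the length
        is nonnegative.\<close>
      have "\<bar>0 - 0 :: real\<bar> \<le> 1 * path_len G \<gamma>"
      proof (rule path_len_bound(2)[OF G \<gamma>(1) zero_le_one])
        fix t v and a b :: real
        assume *: "t \<in> {a..b}" "{a..b} \<subseteq> {0..1}" "has_path_derivative \<gamma> v t {a..b}"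
        then have "\<gamma> t \<in> Imm" using I by blast
        then have "0 \<le> G (\<gamma> t) v v"
          using weakly_continuous_metric_nonneg(1)[OF G] has_path_derivativeD(1)[OF *(3)] by blast
        then show "lipschitz_at (\<lambda>t. 0) (1 * sqrt (G (\<gamma> t) v v)) t {a..b}"
          by (intro lipschitz_at_const) simp
      qed
      then show ?thesis by simp
    qed
    ultimately have "geodesic_dist G c0 c0 < ereal r" using dist[of "\<lambda>s. c0"] len0 \<gamma>(4) by simp
    moreover consider "t = 0" | "0 < t" "t < 1" | "t = 1" using t by fastforce
    ultimately show ?thesis using mid[of t] dist[OF \<gamma>(1,2,4)] I[OF t] \<gamma>(2)
      by cases (auto simp: metric_ball_def)
  qed
  then show ?thesis using that \<gamma> by blast
qed

text \<open>For \<open>\<kappa> = 0\<close> this also bounds \<open>N\<close> away from zero.\<close>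

lemma seminorm_growth:
  assumes G: "weakly_continuous_metric G" and N: "Ck_seminorm N" and K: "0 \<le> K"
    and bound: "\<And>c v. c \<in> metric_ball G c0 r \<Longrightarrow> v \<in> Cinf \<Longrightarrow> N v \<le> K * sqrt (G c v v) * (\<kappa> + N c)"
    and pos: "\<And>c. c \<in> metric_ball G c0 r \<Longrightarrow> 0 < \<kappa> + N c"
    and c: "c \<in> metric_ball G c0 r"
  shows "\<bar>ln (\<kappa> + N c) - ln (\<kappa> + N c0)\<bar> \<le> K * r"
proof -
  obtain \<gamma> where \<gamma>: "piecewise_smooth_path \<gamma>" "\<gamma> 0 = c0" "\<gamma> 1 = c" "path_len G \<gamma> < r"
    and ball: "\<And>t. t \<in> {0..1} \<Longrightarrow> \<gamma> t \<in> metric_ball G c0 r"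
    using metric_ball_path[OF G c] by blast
  have I: "\<gamma> t \<in> Imm" if "t \<in> {0..1}" for t using ball[OF that] by (simp add: metric_ball_def)
  let ?z = "\<lambda>t. ln (\<kappa> + N (\<gamma> t))"
  have "\<bar>?z 1 - ?z 0\<bar> \<le> K * path_len G \<gamma>"
  proof (rule path_len_bound(2)[OF G \<gamma>(1) K])
    fix t v and a b :: real
    assume t: "t \<in> {a..b}" and sub: "{a..b} \<subseteq> {0..1}" and v: "has_path_derivative \<gamma> v t {a..b}"
    have t01: "t \<in> {0..1}" using t sub by blast
    have vC: "v \<in> Cinf" by (rule has_path_derivativeD[OF v])
    let ?L = "K * sqrt (G (\<gamma> t) v v) * (\<kappa> + N (\<gamma> t))"
    have "lipschitz_at (\<lambda>s. N (\<gamma> s)) (N v) t {a..b}"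
      using sub I by (intro Ck_seminorm_lipschitz_at[OF N v _ t]) (auto simp: Imm_def)
    then have "lipschitz_at (\<lambda>s. N (\<gamma> s)) ?L t {a..b}"
      using bound[OF ball[OF t01] vC] by (rule lipschitz_at_mono)
    then have "lipschitz_at (\<lambda>s. \<kappa> + N (\<gamma> s)) ?L t {a..b}" by (simp add: lipschitz_at_def)
    \<comment> \<open>Passing to the logarithm divides by \<kappa> + N and cancels that factor in
      \<open>?L\<close>.\<close>
    then have "lipschitz_at ?z (?L / (\<kappa> + N (\<gamma> t))) t {a..b}"
      using pos[OF ball[OF t01]] weakly_continuous_metric_nonneg(1)[OF G I[OF t01] vC] K
      by (intro lipschitz_at_ln) (auto intro!: mult_nonneg_nonneg simp: less_imp_le)
    then show "lipschitz_at ?z (K * sqrt (G (\<gamma> t) v v)) t {a..b}"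
      using pos[OF ball[OF t01]] by simp
  qed
  also have "\<dots> \<le> K * r" using K \<gamma>(4) by (intro mult_left_mono) auto
  finally show ?thesis using \<gamma> by simp
qed

subsection \<open>Bounds on metric balls\<close>

text \<open>The types of c and h are independent: tangent vectors take values in the space of the
  curve, the functions of the final estimate are real-valued.\<close>

abbreviation (input) Hn_sq :: "nat \<Rightarrow> (real \<Rightarrow> 'a::real_normed_vector) \<Rightarrow> (real \<Rightarrow> 'b::real_normed_vector) \<Rightarrow> real"
  where "Hn_sq n c h \<equiv>
    arc_integral c (\<lambda>\<theta>. (norm (h \<theta>))\<^sup>2 + (norm ((arc_deriv ddt c ^^ n) h \<theta>))\<^sup>2)"

lemma arc_integral_circ: "arc_integral c f = (\<integral>\<theta>. f \<theta> * speed c \<theta> \<partial>circ)"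
  unfolding arc_integral_def set_lebesgue_integral_circ speed_def ..

lemma arc_deriv_Cinf:
  fixes c :: "real \<Rightarrow> 'a::real_inner"
  shows "c \<in> Imm \<Longrightarrow> f \<in> Cinf \<Longrightarrow> (arc_deriv ddt c ^^ k) f \<in> Cinf"
  unfolding arc_deriv_ddt_eq_wder by (intro wder_inverse_Cinf speed_Cinf speed_pos)

lemma arc_interpolation:
  fixes c :: "real \<Rightarrow> 'a::real_inner" and f :: "real \<Rightarrow> 'b::real_inner"
  assumes c: "c \<in> Imm" and f: "f \<in> Cinf" and k: "k \<le> n"
  shows "(\<integral>\<theta>. (norm ((arc_deriv ddt c ^^ k) f \<theta>))\<^sup>2 * speed c \<theta> \<partial>circ) \<le> Hn_sq n c f"
  unfolding arc_integral_circ unfolding arc_deriv_ddt_eq_wder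
  by (intro weighted_interpolation speed_Cinf speed_pos c f k)

lemma arc_sup_bound:
  fixes c :: "real \<Rightarrow> 'a::real_inner" and f :: "real \<Rightarrow> 'b::real_inner"
  assumes c: "c \<in> Imm" and f: "f \<in> Cinf" and k: "1 \<le> k" "k < n"
  shows "(norm ((arc_deriv ddt c ^^ k) f \<theta>))\<^sup>2 \<le> (\<integral>\<theta>. speed c \<theta> \<partial>circ) * Hn_sq n c f"
  unfolding arc_integral_circ unfolding arc_deriv_ddt_eq_wder
  by (intro weighted_sup_interpolation speed_Cinf speed_pos c f k)

lemma Hn_sq_nonneg:
  fixes c :: "real \<Rightarrow> 'a::real_inner" and f :: "real \<Rightarrow> 'b::real_inner"
  shows "0 \<le> Hn_sq n c f"
  unfolding arc_integral_circ by (intro integral_nonneg_AE) (simp add: speed_def)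

text \<open>With \<theta> fixed, growth is estimated at each point separately, by constants that do
  not depend on the point.\<close>

lemma Ck_seminorm_point: "Ck_seminorm (\<lambda>f. norm ((ddt ^^ k) f \<theta>))"
  unfolding Ck_seminorm_def
  by (auto simp: norm_triangle_ineq ddt_pow_add ddt_pow_scaleR_const
      intro!: exI[of _ k] exI[of _ "1::real"])

lemma measure_circ [simp]: "measure circ {0..2*pi} = 2 * pi"
  by (simp add: measure_restrict_space)

lemma integral_circ_const [simp]: "(\<integral>\<theta>. (K::real) \<partial>circ) = 2 * pi * K"
  using integral_circ[of "\<lambda>\<theta>. K"] by simp

lemma Ck_seminorm_length: "Ck_seminorm (\<lambda>f. \<integral>\<theta>. norm (ddt f \<theta>) \<partial>circ)"
  unfolding Ck_seminorm_def
proof (intro conjI ballI allI exI impI)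
  fix f g :: "real \<Rightarrow> 'a" assume fg: "f \<in> Cinf" "g \<in> Cinf"
  have "(\<integral>\<theta>. norm (ddt (\<lambda>\<theta>. f \<theta> + g \<theta>) \<theta>) \<partial>circ) \<le> (\<integral>\<theta>. norm (ddt f \<theta>) + norm (ddt g \<theta>) \<partial>circ)"
    using fg
    by (intro integral_mono integrable_circ continuous_intros Cinf_continuous_on ddt_Cinf add_Cinf)
      (auto simp: ddt_add norm_triangle_ineq)
  also have "\<dots> = (\<integral>\<theta>. norm (ddt f \<theta>) \<partial>circ) + (\<integral>\<theta>. norm (ddt g \<theta>) \<partial>circ)"
    using fg by (intro Bochner_Integration.integral_add integrable_circ continuous_intros ddt_Cinf)
  finally show "(\<integral>\<theta>. norm (ddt (\<lambda>\<theta>. f \<theta> + g \<theta>) \<theta>) \<partial>circ) \<le>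
    (\<integral>\<theta>. norm (ddt f \<theta>) \<partial>circ) + (\<integral>\<theta>. norm (ddt g \<theta>) \<partial>circ)" .
next
  fix f :: "real \<Rightarrow> 'a" and a assume "f \<in> Cinf"
  then show "(\<integral>\<theta>. norm (ddt (\<lambda>\<theta>. a *\<^sub>R f \<theta>) \<theta>) \<partial>circ) = \<bar>a\<bar> * (\<integral>\<theta>. norm (ddt f \<theta>) \<partial>circ)"
    by (simp add: ddt_scaleR_const)
next
  fix f :: "real \<Rightarrow> 'a" and e assume f: "f \<in> Cinf" and e: "\<forall>\<theta>. norm ((ddt ^^ 1) f \<theta>) \<le> e"
  have "(\<integral>\<theta>. norm (ddt f \<theta>) \<partial>circ) \<le> (\<integral>\<theta>. e \<partial>circ)"
    using f e by (intro integral_mono integrable_circ continuous_intros ddt_Cinf) auto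
  then show "(\<integral>\<theta>. norm (ddt f \<theta>) \<partial>circ) \<le> (2 * pi) * e" by simp
qed

lemma Ck_seminorm_L2: "Ck_seminorm (\<lambda>f. sqrt (\<integral>\<theta>. (norm ((ddt ^^ k) f \<theta>))\<^sup>2 \<partial>circ))"
  unfolding Ck_seminorm_def
proof (intro conjI ballI allI exI impI)
  fix f g :: "real \<Rightarrow> 'a" assume fg: "f \<in> Cinf" "g \<in> Cinf"
  have "(\<integral>\<theta>. (norm ((ddt ^^ k) (\<lambda>\<theta>. f \<theta> + g \<theta>) \<theta>))\<^sup>2 \<partial>circ) \<le>
      (\<integral>\<theta>. (norm ((ddt ^^ k) f \<theta>) + norm ((ddt ^^ k) g \<theta>))\<^sup>2 \<partial>circ)"
    using fg
    by (intro integral_mono integrable_circ continuous_intros Cinf_continuous_on ddt_pow_Cinf add_Cinf)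
      (auto simp: ddt_pow_add norm_triangle_ineq power_mono)
  then have "sqrt (\<integral>\<theta>. (norm ((ddt ^^ k) (\<lambda>\<theta>. f \<theta> + g \<theta>) \<theta>))\<^sup>2 \<partial>circ) \<le>
      sqrt (\<integral>\<theta>. (norm ((ddt ^^ k) f \<theta>) + norm ((ddt ^^ k) g \<theta>))\<^sup>2 \<partial>circ)"
    by (rule real_sqrt_le_mono)
  also have "\<dots> \<le> sqrt (\<integral>\<theta>. (norm ((ddt ^^ k) f \<theta>))\<^sup>2 \<partial>circ) + sqrt (\<integral>\<theta>. (norm ((ddt ^^ k) g \<theta>))\<^sup>2 \<partial>circ)"
    using fg by (intro Minkowski_integral measurable_circ integrable_circ continuous_intros ddt_pow_Cinf)
  finally show "sqrt (\<integral>\<theta>. (norm ((ddt ^^ k) (\<lambda>\<theta>. f \<theta> + g \<theta>) \<theta>))\<^sup>2 \<partial>circ) \<le>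
    sqrt (\<integral>\<theta>. (norm ((ddt ^^ k) f \<theta>))\<^sup>2 \<partial>circ) + sqrt (\<integral>\<theta>. (norm ((ddt ^^ k) g \<theta>))\<^sup>2 \<partial>circ)" .
next
  fix f :: "real \<Rightarrow> 'a" and a assume "f \<in> Cinf"
  then show "sqrt (\<integral>\<theta>. (norm ((ddt ^^ k) (\<lambda>\<theta>. a *\<^sub>R f \<theta>) \<theta>))\<^sup>2 \<partial>circ) =
      \<bar>a\<bar> * sqrt (\<integral>\<theta>. (norm ((ddt ^^ k) f \<theta>))\<^sup>2 \<partial>circ)"
    by (simp add: ddt_pow_scaleR_const power_mult_distrib real_sqrt_mult)
next
  fix f :: "real \<Rightarrow> 'a" and e assume f: "f \<in> Cinf" and e: "\<forall>\<theta>. norm ((ddt ^^ k) f \<theta>) \<le> e"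
  have "0 \<le> e" using e norm_ge_zero order_trans by blast
  have "(\<integral>\<theta>. (norm ((ddt ^^ k) f \<theta>))\<^sup>2 \<partial>circ) \<le> (\<integral>\<theta>. e\<^sup>2 \<partial>circ)"
    using f e by (intro integral_mono integrable_circ continuous_intros ddt_pow_Cinf) (auto intro: power_mono)
  then have "sqrt (\<integral>\<theta>. (norm ((ddt ^^ k) f \<theta>))\<^sup>2 \<partial>circ) \<le> sqrt (2 * pi * e\<^sup>2)"
    by (simp add: real_sqrt_le_mono)
  then show "sqrt (\<integral>\<theta>. (norm ((ddt ^^ k) f \<theta>))\<^sup>2 \<partial>circ) \<le> sqrt (2 * pi) * e"
    using \<open>0 \<le> e\<close> by (simp add: real_sqrt_mult)
qed

lemma ln_diff_bound:
  assumes "\<bar>ln x - ln y\<bar> \<le> L" "0 < x" "0 < (y::real)"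
  shows "x \<le> y * exp L" "y * exp (- L) \<le> x"
proof -
  have "ln x \<le> ln (y * exp L)" "ln (y * exp (- L)) \<le> ln x"
    using assms by (auto simp: ln_mult)
  then show "x \<le> y * exp L" "y * exp (- L) \<le> x" using assms by auto
qed

text \<open>The weight w, which contains the top derivative of the curve, is only square integrable,
  so its factor d has to be bounded pointwise; square integrals suffice for the \<open>e j\<close>.
  The 2 comes from squaring a sum of two terms; one n bounds the squared sum over j by the sum of
  squares, the other counts the integrals.\<close>

lemma L2_top_bound:
  fixes f d :: "real \<Rightarrow> 'b::real_normed_vector" and e :: "nat \<Rightarrow> real \<Rightarrow> 'b"
  assumes C: "f \<in> Cinf" "\<And>j. e j \<in> Cinf" and w: "continuous_on {0..2*pi} w" "\<And>\<theta>. 0 \<le> w \<theta>"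
    and f: "\<And>\<theta>. norm (f \<theta>) \<le> K * (w \<theta> * norm (d \<theta>) + (\<Sum>j\<in>{2..n}. norm (e j \<theta>)))"
    and d: "\<And>\<theta>. (norm (d \<theta>))\<^sup>2 \<le> M" and e: "\<And>j. j \<in> {2..n} \<Longrightarrow> (\<integral>\<theta>. (norm (e j \<theta>))\<^sup>2 \<partial>circ) \<le> M"
  shows "(\<integral>\<theta>. (norm (f \<theta>))\<^sup>2 \<partial>circ) \<le> 2 * K\<^sup>2 * ((\<integral>\<theta>. (w \<theta>)\<^sup>2 \<partial>circ) + (real n)\<^sup>2) * M"
proof -
  have M: "0 \<le> M" using d[of 0] by (meson order_trans zero_le_power2)
  have "(norm (f \<theta>))\<^sup>2 \<le> 2 * K\<^sup>2 * (M * (w \<theta>)\<^sup>2 + n * (\<Sum>j\<in>{2..n}. (norm (e j \<theta>))\<^sup>2))" for \<theta>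
  proof -
    have "(norm (f \<theta>))\<^sup>2 \<le> (K * (w \<theta> * norm (d \<theta>) + (\<Sum>j\<in>{2..n}. norm (e j \<theta>))))\<^sup>2"
      using f by (intro power_mono) auto
    also have "\<dots> \<le> K\<^sup>2 * (2 * ((w \<theta> * norm (d \<theta>))\<^sup>2 + (\<Sum>j\<in>{2..n}. norm (e j \<theta>))\<^sup>2))"
      unfolding power_mult_distrib[of K]
      using sum_squares_bound[of "w \<theta> * norm (d \<theta>)" "\<Sum>j\<in>{2..n}. norm (e j \<theta>)"]
      by (intro mult_left_mono) (auto simp: power2_sum)
    also have "\<dots> \<le> K\<^sup>2 * (2 * (M * (w \<theta>)\<^sup>2 + n * (\<Sum>j\<in>{2..n}. (norm (e j \<theta>))\<^sup>2)))"
    proof (intro mult_left_mono add_mono)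
      show "(w \<theta> * norm (d \<theta>))\<^sup>2 \<le> M * (w \<theta>)\<^sup>2"
        using mult_right_mono[OF d[of \<theta>], of "(w \<theta>)\<^sup>2"] by (simp add: power_mult_distrib mult.commute)
      have "(\<Sum>j\<in>{2..n}. norm (e j \<theta>))\<^sup>2 \<le> card {2..n} * (\<Sum>j\<in>{2..n}. (norm (e j \<theta>))\<^sup>2)"
        using sum_squared_le_sum_of_squares[of "\<lambda>j. norm (e j \<theta>)" "{2..n}"] by (simp add: mult.commute)
      also have "\<dots> \<le> n * (\<Sum>j\<in>{2..n}. (norm (e j \<theta>))\<^sup>2)"
        by (intro mult_right_mono sum_nonneg) auto
      finally show "(\<Sum>j\<in>{2..n}. norm (e j \<theta>))\<^sup>2 \<le> n * (\<Sum>j\<in>{2..n}. (norm (e j \<theta>))\<^sup>2)" .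
    qed auto
    finally show ?thesis by (simp only: mult_ac)
  qed
  then have "(\<integral>\<theta>. (norm (f \<theta>))\<^sup>2 \<partial>circ) \<le>
      (\<integral>\<theta>. 2 * K\<^sup>2 * (M * (w \<theta>)\<^sup>2 + n * (\<Sum>j\<in>{2..n}. (norm (e j \<theta>))\<^sup>2)) \<partial>circ)"
    using C w by (intro integral_mono integrable_circ continuous_intros) auto
  also have "\<dots> = 2 * K\<^sup>2 * (M * (\<integral>\<theta>. (w \<theta>)\<^sup>2 \<partial>circ) + n * (\<Sum>j\<in>{2..n}. \<integral>\<theta>. (norm (e j \<theta>))\<^sup>2 \<partial>circ))"
  proof -
    have 1: "integrable circ (\<lambda>\<theta>. (w \<theta>)\<^sup>2)" "\<And>j. integrable circ (\<lambda>\<theta>. (norm (e j \<theta>))\<^sup>2)"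
      using C w by (intro integrable_circ continuous_intros, auto)+
    then show ?thesis by simp
  qed
  also have "\<dots> \<le> 2 * K\<^sup>2 * (M * (\<integral>\<theta>. (w \<theta>)\<^sup>2 \<partial>circ) + n * (n * M))"
  proof (intro mult_left_mono add_left_mono)
    have "(\<Sum>j\<in>{2..n}. \<integral>\<theta>. (norm (e j \<theta>))\<^sup>2 \<partial>circ) \<le> card {2..n} * M"
      using sum_bounded_above[of "{2..n}" "\<lambda>j. \<integral>\<theta>. (norm (e j \<theta>))\<^sup>2 \<partial>circ" M] e by simp
    also have "\<dots> \<le> n * M" using M by (intro mult_right_mono) auto
    finally show "(\<Sum>j\<in>{2..n}. \<integral>\<theta>. (norm (e j \<theta>))\<^sup>2 \<partial>circ) \<le> n * M" .
  qed auto
  finally show ?thesis by (simp add: algebra_simps power2_eq_square)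
qed

section \<open>A priori estimates on one fixed ball\<close>

context
  fixes n :: nat and c0 :: "real \<Rightarrow> 'a::real_inner" and r C' :: real
    and G :: "(real \<Rightarrow> 'a) \<Rightarrow> (real \<Rightarrow> 'a) \<Rightarrow> (real \<Rightarrow> 'a) \<Rightarrow> real"
  assumes n: "2 \<le> n" and G: "weakly_continuous_metric G" and c0: "c0 \<in> Imm" and C': "0 \<le> C'"
    and bound: "\<And>c h. c \<in> metric_ball G c0 r \<Longrightarrow> h \<in> Cinf \<Longrightarrow> Hn_sq n c h \<le> C' * G c h h"
begin

private abbreviation (input) "B \<equiv> metric_ball G c0 r"

private lemma ball_Imm: "c \<in> B \<Longrightarrow> c \<in> Imm"
  by (simp add: metric_ball_def)

private lemma ball_Cinf: "c \<in> B \<Longrightarrow> c \<in> Cinf"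
  by (simp add: metric_ball_def Imm_def)

private lemma G_nonneg: "c \<in> B \<Longrightarrow> v \<in> Cinf \<Longrightarrow> 0 \<le> G c v v"
  using weakly_continuous_metric_nonneg(1)[OF G ball_Imm] .

text \<open>The length comes first because the bound for the square integral of \<open>D_s v\<close>
  is free of the curve, and Cauchy-Schwarz costs just one factor of length.\<close>

private lemma length_bounded: "\<exists>\<Lambda>>0. \<forall>c\<in>B. (\<integral>\<theta>. speed c \<theta> \<partial>circ) \<le> \<Lambda>"
proof -
  let ?N = "\<lambda>c. \<integral>\<theta>. norm (ddt c \<theta>) \<partial>circ"
  have pos: "0 \<le> ?N c" for c :: "real \<Rightarrow> 'a" by (intro integral_nonneg_AE) simp
  have "?N v \<le> sqrt C' * sqrt (G c v v) * (1 + ?N c)" if c: "c \<in> B" and v: "v \<in> Cinf" for c v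
  proof -
    note cI = ball_Imm[OF c]
    note cont = Cinf_continuous_on[OF speed_Cinf(1)[OF cI]] Cinf_norm_continuous[OF arc_deriv_Cinf[OF cI v, of 1]]
    have sp: "0 < speed c \<theta>" for \<theta> using speed_pos[OF cI] .
    have "norm (ddt v \<theta>) = (norm ((arc_deriv ddt c ^^ 1) v \<theta>) * sqrt (speed c \<theta>)) * sqrt (speed c \<theta>)" for \<theta>
      using sp[of \<theta>] by (simp add: arc_deriv_ddt_eq_wder wder_def mult.assoc less_imp_le)
    then have "?N v = (\<integral>\<theta>. (norm ((arc_deriv ddt c ^^ 1) v \<theta>) * sqrt (speed c \<theta>)) * sqrt (speed c \<theta>) \<partial>circ)"
      by simp
    then have "(?N v)\<^sup>2 \<le> (\<integral>\<theta>. (norm ((arc_deriv ddt c ^^ 1) v \<theta>) * sqrt (speed c \<theta>))\<^sup>2 \<partial>circ)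
        * (\<integral>\<theta>. (sqrt (speed c \<theta>))\<^sup>2 \<partial>circ)"
      by (simp only:) (intro Cauchy_Schwarz_integral measurable_circ integrable_circ continuous_intros cont)
    also have "\<dots> = (\<integral>\<theta>. (norm ((arc_deriv ddt c ^^ 1) v \<theta>))\<^sup>2 * speed c \<theta> \<partial>circ) * ?N c"
      using sp by (simp add: power_mult_distrib less_imp_le speed_def)
    \<comment> \<open>The length is enlarged to (1 + length)^2, which after the square root is the
      form of growth with \<kappa> = 1.\<close>
    also have "\<dots> \<le> (C' * G c v v) * (1 + ?N c)\<^sup>2"
    proof (intro mult_mono)
      show "(\<integral>\<theta>. (norm ((arc_deriv ddt c ^^ 1) v \<theta>))\<^sup>2 * speed c \<theta> \<partial>circ) \<le> C' * G c v v"
        using arc_interpolation[OF cI v, of 1 n] bound[OF c v] n by simp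
      have "?N c \<le> 1 + ?N c" "1 + ?N c \<le> (1 + ?N c) * (1 + ?N c)"
        using pos[of c] mult_left_mono[of 1 "1 + ?N c" "1 + ?N c"] by auto
      then show "?N c \<le> (1 + ?N c)\<^sup>2" unfolding power2_eq_square by linarith
    qed (use pos C' G_nonneg[OF c v] in auto)
    also have "\<dots> = (sqrt C' * sqrt (G c v v) * (1 + ?N c))\<^sup>2"
      using C' G_nonneg[OF c v] by (simp add: power_mult_distrib)
    finally show ?thesis
      using C' G_nonneg[OF c v] pos[of c] by (elim power2_le_imp_le) (auto intro!: mult_nonneg_nonneg)
  qed
  then have "\<bar>ln (1 + ?N c) - ln (1 + ?N c0)\<bar> \<le> sqrt C' * r" if "c \<in> B" for c
    using C' pos that by (intro seminorm_growth[OF G Ck_seminorm_length]) (auto intro: add_pos_nonneg)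
  then have "1 + ?N c \<le> (1 + ?N c0) * exp (sqrt C' * r)" if "c \<in> B" for c
    using that pos by (intro ln_diff_bound(1)) (auto intro: add_pos_nonneg)
  moreover have "0 < (1 + ?N c0) * exp (sqrt C' * r)" using pos[of c0] by (intro mult_pos_pos add_pos_nonneg) auto
  ultimately show ?thesis
    by (intro exI[of _ "(1 + ?N c0) * exp (sqrt C' * r)"]) (force simp: speed_def)
qed

text \<open>The curve enters only through its length; j < n because the supremum costs one
  derivative.\<close>

private lemma arc_deriv_sup_bound:
  "\<exists>K>0. \<forall>c\<in>B. \<forall>v\<in>Cinf. \<forall>j. 1 \<le> j \<longrightarrow> j < n \<longrightarrow> (\<forall>\<theta>. norm ((arc_deriv ddt c ^^ j) v \<theta>) \<le> K * sqrt (G c v v))"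
proof -
  obtain \<Lambda> where \<Lambda>: "0 < \<Lambda>" "\<And>c. c \<in> B \<Longrightarrow> (\<integral>\<theta>. speed c \<theta> \<partial>circ) \<le> \<Lambda>"
    using length_bounded by blast
  \<comment> \<open>The summand 1 makes the constant positive also when C' = 0.\<close>
  have "norm ((arc_deriv ddt c ^^ j) v \<theta>) \<le> sqrt (\<Lambda> * (C' + 1)) * sqrt (G c v v)"
    if c: "c \<in> B" and v: "v \<in> Cinf" and j: "1 \<le> j" "j < n" for c v j \<theta>
  proof -
    have "(norm ((arc_deriv ddt c ^^ j) v \<theta>))\<^sup>2 \<le> (\<integral>\<theta>. speed c \<theta> \<partial>circ) * Hn_sq n c v"
      by (rule arc_sup_bound[OF ball_Imm[OF c] v j])
    also have "\<dots> \<le> \<Lambda> * ((C' + 1) * G c v v)"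
      using \<Lambda> c bound[OF c v] G_nonneg[OF c v] Hn_sq_nonneg[where n = n and c = c and f = v] by (intro mult_mono) (auto simp: distrib_right)
    finally have "norm ((arc_deriv ddt c ^^ j) v \<theta>) \<le> sqrt (\<Lambda> * ((C' + 1) * G c v v))"
      by (rule real_le_rsqrt)
    then show ?thesis by (simp add: real_sqrt_mult mult.assoc)
  qed
  moreover have "0 < sqrt (\<Lambda> * (C' + 1))" using \<Lambda>(1) C' by simp
  ultimately show ?thesis by blast
qed

private lemma speed_bounded: "\<exists>a>0. \<exists>A. \<forall>c\<in>B. \<forall>\<theta>. a \<le> speed c \<theta> \<and> speed c \<theta> \<le> A"
proof -
  obtain K where K: "0 < K"
    "\<And>c v j \<theta>. c \<in> B \<Longrightarrow> v \<in> Cinf \<Longrightarrow> 1 \<le> j \<Longrightarrow> j < n \<Longrightarrow> norm ((arc_deriv ddt c ^^ j) v \<theta>) \<le> K * sqrt (G c v v)"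
    using arc_deriv_sup_bound by blast
  have c0C: "c0 \<in> Cinf" using c0 by (simp add: Imm_def)
  obtain A0 where A0: "0 < A0" "\<And>\<theta>. norm (ddt c0 \<theta>) \<le> A0" using Cinf_bounded[OF ddt_Cinf[OF c0C]] by blast
  obtain A1 where A1: "0 < A1" "\<And>\<theta>. norm (inverse (speed c0 \<theta>)) \<le> A1"
    using Cinf_bounded[OF inverse_speed_Cinf(1)[OF c0]] by blast
  have low: "inverse A1 \<le> speed c0 \<theta>" for \<theta>
    using A1(2)[of \<theta>] A1(1) speed_pos[OF c0, of \<theta>] by (simp add: inverse_le_imp_le)
  have ln: "\<bar>ln (speed c \<theta>) - ln (speed c0 \<theta>)\<bar> \<le> K * r" if c: "c \<in> B" for c \<theta>
  proof -
    \<comment> \<open>This is the case \<kappa> = 0: the norm of \<open>ddt v\<close> is |c'| times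
      that of \<open>D_s v\<close>, with no additive term, so the logarithm of |c'| itself is
      controlled on both sides.\<close>
    have "\<bar>ln (0 + norm ((ddt ^^ 1) c \<theta>)) - ln (0 + norm ((ddt ^^ 1) c0 \<theta>))\<bar> \<le> K * r"
    proof (rule seminorm_growth[OF G Ck_seminorm_point])
      fix c v assume c: "c \<in> B" and v: "v \<in> (Cinf :: (real \<Rightarrow> 'a) set)"
      have "norm (ddt v \<theta>) = speed c \<theta> * norm (arc_deriv ddt c v \<theta>)"
        using speed_pos[OF ball_Imm[OF c], of \<theta>] by (simp add: arc_deriv_ddt_eq_wder wder_def)
      also have "\<dots> \<le> speed c \<theta> * (K * sqrt (G c v v))"
        using K(2)[OF c v, of 1 \<theta>] n speed_pos[OF ball_Imm[OF c], of \<theta>] by (intro mult_left_mono) auto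
      finally show "norm ((ddt ^^ 1) v \<theta>) \<le> K * sqrt (G c v v) * (0 + norm ((ddt ^^ 1) c \<theta>))"
        by (simp add: speed_def mult_ac)
    next
      fix c assume "c \<in> B"
      then show "0 < 0 + norm ((ddt ^^ 1) c \<theta>)" using speed_pos[OF ball_Imm, of c \<theta>] by (simp add: speed_def)
    qed (use K c in auto)
    then show ?thesis by (simp add: speed_def)
  qed
  have "inverse A1 * exp (- (K * r)) \<le> speed c \<theta> \<and> speed c \<theta> \<le> A0 * exp (K * r)" if c: "c \<in> B" for c \<theta>
  proof
    have "inverse A1 * exp (- (K * r)) \<le> speed c0 \<theta> * exp (- (K * r))"
      using low by (intro mult_right_mono) auto
    also have "\<dots> \<le> speed c \<theta>"
      by (intro ln_diff_bound(2)[OF ln] speed_pos ball_Imm c c0)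
    finally show "inverse A1 * exp (- (K * r)) \<le> speed c \<theta>" .
    have "speed c \<theta> \<le> speed c0 \<theta> * exp (K * r)"
      by (intro ln_diff_bound(1)[OF ln] speed_pos ball_Imm c c0)
    also have "\<dots> \<le> A0 * exp (K * r)"
      using A0 by (intro mult_right_mono) (auto simp: speed_def)
    finally show "speed c \<theta> \<le> A0 * exp (K * r)" .
  qed
  moreover have "0 < inverse A1 * exp (- (K * r))" using A1 by simp
  ultimately show ?thesis by blast
qed

text \<open>The comparison at order k requires bounds on the curve below order k and produces the
  weight 1 + |k-th derivative of c|, exactly the factor that the growth estimate tolerates with
  \<kappa> = 1. The pointwise bounds on \<open>D_s^j v\<close> end at j = n - 1, hence k <
  n.\<close>

private lemma derivatives_bounded:
  "1 \<le> k \<Longrightarrow> k < n \<Longrightarrow> \<exists>K. \<forall>c\<in>B. \<forall>\<theta>. norm ((ddt ^^ k) c \<theta>) \<le> K"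
proof (induction k rule: less_induct)
  case (less k)
  obtain a A where a: "0 < a" "\<And>c \<theta>. c \<in> B \<Longrightarrow> a \<le> speed c \<theta>" and A: "\<And>c \<theta>. c \<in> B \<Longrightarrow> speed c \<theta> \<le> A"
    using speed_bounded by blast
  show ?case
  proof (cases "k = 1")
    case True
    then show ?thesis using A by (auto simp: speed_def)
  next
    case False
    then obtain l where l: "k = Suc l" "1 \<le> l" using less.prems by (cases k) auto
    obtain K where K: "0 < K"
      "\<And>c v j \<theta>. c \<in> B \<Longrightarrow> v \<in> Cinf \<Longrightarrow> 1 \<le> j \<Longrightarrow> j < n \<Longrightarrow> norm ((arc_deriv ddt c ^^ j) v \<theta>) \<le> K * sqrt (G c v v)"
      using arc_deriv_sup_bound by blast
    have "\<exists>L>0. \<forall>c\<in>B. \<forall>f\<in>Cinf. \<forall>\<theta>. norm ((ddt ^^ Suc l) f \<theta> :: 'a) \<le>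
      L * ((1 + norm ((ddt ^^ Suc l) c \<theta>)) * norm (arc_deriv ddt c f \<theta>) +
        (\<Sum>j\<in>{2..Suc l}. norm ((arc_deriv ddt c ^^ j) f \<theta>)))"
    proof (rule arc_deriv_comparison(1)[OF _ a])
      show "B \<subseteq> Imm" using ball_Imm by blast
      show "\<exists>K. \<forall>c\<in>B. \<forall>\<theta>. norm ((ddt ^^ j) c \<theta>) \<le> K" if "1 \<le> j" "j \<le> l" for j
        using less.IH[of j] that l less.prems by simp
    qed
    then obtain L where L: "0 < L" "\<And>c f \<theta>. c \<in> B \<Longrightarrow> f \<in> Cinf \<Longrightarrow> norm ((ddt ^^ Suc l) f \<theta> :: 'a) \<le>
      L * ((1 + norm ((ddt ^^ Suc l) c \<theta>)) * norm (arc_deriv ddt c f \<theta>) +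
        (\<Sum>j\<in>{2..Suc l}. norm ((arc_deriv ddt c ^^ j) f \<theta>)))"
      by metis
    \<comment> \<open>The first derivative contributes once, the sum over higher orders at most n
      times.\<close>
    let ?K = "L * (1 + real n) * K"
    have "norm ((ddt ^^ k) v \<theta>) \<le> ?K * sqrt (G c v v) * (1 + norm ((ddt ^^ k) c \<theta>))"
      if c: "c \<in> B" and v: "v \<in> Cinf" for c v \<theta>
    proof -
      let ?w = "1 + norm ((ddt ^^ k) c \<theta>)" and ?g = "K * sqrt (G c v v)"
      have g: "0 \<le> ?g" using K(1) G_nonneg[OF c v] by simp
      have "norm ((ddt ^^ k) v \<theta>) \<le> L * (?w * norm (arc_deriv ddt c v \<theta>) +
          (\<Sum>j\<in>{2..k}. norm ((arc_deriv ddt c ^^ j) v \<theta>)))"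
        using L(2)[OF c v, of \<theta>] l by simp
      also have "\<dots> \<le> L * (?w * ?g + n * (?w * ?g))"
      proof (intro mult_left_mono add_mono)
        show "norm (arc_deriv ddt c v \<theta>) \<le> ?g" using K(2)[OF c v, of 1 \<theta>] n by simp
        have "?g \<le> ?w * ?g" using g mult_right_mono[of 1 ?w ?g] by simp
        have "(\<Sum>j\<in>{2..k}. norm ((arc_deriv ddt c ^^ j) v \<theta>)) \<le> real (card {2..k}) * ?g"
          using sum_bounded_above[of "{2..k}" "\<lambda>j. norm ((arc_deriv ddt c ^^ j) v \<theta>)" ?g]
            K(2)[OF c v] less.prems by simp
        also have "\<dots> \<le> n * (?w * ?g)"
          using less.prems g \<open>?g \<le> ?w * ?g\<close> by (intro mult_mono[of "real (card {2..k})" _ ?g]) auto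
        finally show "(\<Sum>j\<in>{2..k}. norm ((arc_deriv ddt c ^^ j) v \<theta>)) \<le> n * (?w * ?g)" .
      qed (use L(1) in auto)
      also have "\<dots> = ?K * sqrt (G c v v) * ?w" by (simp add: algebra_simps)
      finally show ?thesis .
    qed
    then have "\<bar>ln (1 + norm ((ddt ^^ k) c \<theta>)) - ln (1 + norm ((ddt ^^ k) c0 \<theta>))\<bar> \<le> ?K * r"
      if "c \<in> B" for c \<theta>
      using K L that by (intro seminorm_growth[OF G Ck_seminorm_point]) (auto intro: add_pos_nonneg)
    then have 1: "1 + norm ((ddt ^^ k) c \<theta>) \<le> (1 + norm ((ddt ^^ k) c0 \<theta>)) * exp (?K * r)" if "c \<in> B" for c \<theta>
      using that by (intro ln_diff_bound(1)) (auto intro: add_pos_nonneg)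
    have "c0 \<in> Cinf" using c0 by (simp add: Imm_def)
    then obtain A0 where A0: "\<And>\<theta>. norm ((ddt ^^ k) c0 \<theta>) \<le> A0" using Cinf_bounded[OF ddt_pow_Cinf] by metis
    have "norm ((ddt ^^ k) c \<theta>) \<le> (1 + A0) * exp (?K * r)" if "c \<in> B" for c \<theta>
    proof -
      have "(1 + norm ((ddt ^^ k) c0 \<theta>)) * exp (?K * r) \<le> (1 + A0) * exp (?K * r)"
        using A0 by (intro mult_right_mono) auto
      then show ?thesis using 1[OF that, of \<theta>] by linarith
    qed
    then show ?thesis by blast
  qed
qed

private lemma comparison:
  "\<exists>K>0. \<forall>c\<in>B. \<forall>f\<in>Cinf. \<forall>\<theta>. norm ((ddt ^^ n) f \<theta> :: 'b::real_normed_vector) \<le>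
      K * ((1 + norm ((ddt ^^ n) c \<theta>)) * norm (arc_deriv ddt c f \<theta>) +
        (\<Sum>j\<in>{2..n}. norm ((arc_deriv ddt c ^^ j) f \<theta>)))" (is ?A)
  "\<exists>K>0. \<forall>c\<in>B. \<forall>f\<in>Cinf. \<forall>\<theta>. norm ((arc_deriv ddt c ^^ n) f \<theta> :: 'b) \<le>
      K * ((1 + norm ((ddt ^^ n) c \<theta>)) * norm (ddt f \<theta>) +
        (\<Sum>j\<in>{2..n}. norm ((ddt ^^ j) f \<theta>)))" (is ?B)
proof -
  obtain l where l: "n = Suc l" using n by (cases n) auto
  obtain a A where a: "0 < a" "\<And>c \<theta>. c \<in> B \<Longrightarrow> a \<le> speed c \<theta>"
    using speed_bounded by blast
  have B: "B \<subseteq> Imm" using ball_Imm by blast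
  have bdd: "\<exists>K. \<forall>c\<in>B. \<forall>\<theta>. norm ((ddt ^^ j) c \<theta>) \<le> K" if "1 \<le> j" "j \<le> l" for j
    using derivatives_bounded[of j] that l by simp
  show ?A unfolding l by (rule arc_deriv_comparison(1)[OF B a bdd])
  show ?B unfolding l by (rule arc_deriv_comparison(2)[OF B a bdd])
qed

private lemma weight_L2:
  assumes c: "c \<in> Cinf"
  shows "(\<integral>\<theta>. (1 + norm ((ddt ^^ n) c \<theta>))\<^sup>2 \<partial>circ) \<le> 4 * pi + 2 * (\<integral>\<theta>. (norm ((ddt ^^ n) c \<theta>))\<^sup>2 \<partial>circ)"
proof -
  have i: "integrable circ (\<lambda>\<theta>. (norm ((ddt ^^ n) c \<theta>))\<^sup>2)"
    using c by (intro integrable_circ continuous_intros ddt_pow_Cinf)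
  have "(\<integral>\<theta>. (1 + norm ((ddt ^^ n) c \<theta>))\<^sup>2 \<partial>circ) \<le> (\<integral>\<theta>. 2 + 2 * (norm ((ddt ^^ n) c \<theta>))\<^sup>2 \<partial>circ)"
  proof (rule integral_mono)
    fix \<theta>
    show "(1 + norm ((ddt ^^ n) c \<theta>))\<^sup>2 \<le> 2 + 2 * (norm ((ddt ^^ n) c \<theta>))\<^sup>2"
      using sum_squares_bound[of 1 "norm ((ddt ^^ n) c \<theta>)"] by (simp add: power2_sum)
  qed (use c in \<open>intro integrable_circ continuous_intros ddt_pow_Cinf, assumption\<close>)+
  also have "\<dots> = 4 * pi + 2 * (\<integral>\<theta>. (norm ((ddt ^^ n) c \<theta>))\<^sup>2 \<partial>circ)"
    using i integrable_circ[of "\<lambda>\<theta>. 2"] by (subst Bochner_Integration.integral_add) auto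
  finally show ?thesis .
qed

text \<open>The bound from below on the speed converts integrals against \<open>ds\<close> into
  integrals against \<open>d\<theta>\<close>.\<close>

private lemma arc_deriv_L2:
  fixes c :: "real \<Rightarrow> 'a"
  assumes a: "0 < a" "\<And>\<theta>. a \<le> speed c \<theta>" and c: "c \<in> Imm" and f: "f \<in> Cinf" and j: "j \<le> n"
  shows "(\<integral>\<theta>. (norm ((arc_deriv ddt c ^^ j) f \<theta> :: 'b::real_inner))\<^sup>2 \<partial>circ) \<le> Hn_sq n c f / a"
proof -
  note cont = Cinf_norm_continuous[OF arc_deriv_Cinf[OF c f]] Cinf_continuous_on[OF speed_Cinf(1)[OF c]]
  have "a * (\<integral>\<theta>. (norm ((arc_deriv ddt c ^^ j) f \<theta>))\<^sup>2 \<partial>circ) = (\<integral>\<theta>. (norm ((arc_deriv ddt c ^^ j) f \<theta>))\<^sup>2 * a \<partial>circ)"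
    by (simp add: mult.commute)
  also have "\<dots> \<le> (\<integral>\<theta>. (norm ((arc_deriv ddt c ^^ j) f \<theta>))\<^sup>2 * speed c \<theta> \<partial>circ)"
    by (intro integral_mono integrable_circ continuous_intros cont mult_left_mono a) auto
  also have "\<dots> \<le> Hn_sq n c f" by (rule arc_interpolation[OF c f j])
  finally show ?thesis using a(1) by (simp add: pos_le_divide_eq mult.commute)
qed

text \<open>At order n no pointwise bound on \<open>D_s^n v\<close> is left, so the seminorm is a
  square integral. The weight multiplies \<open>D_s v\<close>, which is bounded since n \<ge> 2; its
  own square integral is controlled by the seminorm of c, and the growth is linear again.\<close>

private lemma top_derivative_bounded:
  "\<exists>K. \<forall>c\<in>B. (\<integral>\<theta>. (1 + norm ((ddt ^^ n) c \<theta>))\<^sup>2 \<partial>circ) \<le> K"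
proof -
  let ?N = "\<lambda>f. sqrt (\<integral>\<theta>. (norm ((ddt ^^ n) f \<theta> :: 'a))\<^sup>2 \<partial>circ)"
  have pos: "0 \<le> ?N c" for c by simp
  have sq: "(?N c)\<^sup>2 = (\<integral>\<theta>. (norm ((ddt ^^ n) c \<theta>))\<^sup>2 \<partial>circ)" for c by simp
  obtain K where K: "0 < K"
    "\<And>c v j \<theta>. c \<in> B \<Longrightarrow> v \<in> Cinf \<Longrightarrow> 1 \<le> j \<Longrightarrow> j < n \<Longrightarrow> norm ((arc_deriv ddt c ^^ j) v \<theta>) \<le> K * sqrt (G c v v)"
    using arc_deriv_sup_bound by blast
  obtain a A where a: "0 < a" "\<And>c \<theta>. c \<in> B \<Longrightarrow> a \<le> speed c \<theta>"
    using speed_bounded by blast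
  obtain L where L: "0 < L" "\<And>c f \<theta>. c \<in> B \<Longrightarrow> f \<in> Cinf \<Longrightarrow> norm ((ddt ^^ n) f \<theta> :: 'a) \<le>
      L * ((1 + norm ((ddt ^^ n) c \<theta>)) * norm (arc_deriv ddt c f \<theta>) +
        (\<Sum>j\<in>{2..n}. norm ((arc_deriv ddt c ^^ j) f \<theta>)))"
    using comparison(1) by metis
  \<comment> \<open>Per unit of G, the first summand bounds |D_s v|^2 pointwise and the second
    bounds the square integrals of the higher derivatives.\<close>
  define M where "M = K\<^sup>2 + C' / a"
  have M: "0 \<le> M" using C' a(1) by (simp add: M_def)
  \<comment> \<open>The numbers 4 pi and 2 come from \<open>weight_L2\<close>, where 1 and the
    squared seminorm of c are each at most (1 + seminorm)^2; the rest is from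
    \<open>L2_top_bound\<close>.\<close>
  define Q where "Q = 2 * L\<^sup>2 * (4 * pi + 2 + (real n)\<^sup>2) * M"
  have Q: "0 \<le> Q" using M by (simp add: Q_def)
  have "?N v \<le> sqrt Q * sqrt (G c v v) * (1 + ?N c)" if c: "c \<in> B" and v: "v \<in> Cinf" for c v
  proof -
    let ?g = "G c v v"
    have g: "0 \<le> ?g" using G_nonneg[OF c v] .
    have "(\<integral>\<theta>. (norm ((ddt ^^ n) v \<theta>))\<^sup>2 \<partial>circ) \<le>
        2 * L\<^sup>2 * ((\<integral>\<theta>. (1 + norm ((ddt ^^ n) c \<theta>))\<^sup>2 \<partial>circ) + (real n)\<^sup>2) * (M * ?g)"
    proof (rule L2_top_bound[OF _ _ _ _ L(2)[OF c v]])
      show "continuous_on {0..2*pi} (\<lambda>\<theta>. 1 + norm ((ddt ^^ n) c \<theta>))"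
        using ball_Cinf[OF c] by (intro continuous_intros ddt_pow_Cinf)
      show "(norm (arc_deriv ddt c v \<theta>))\<^sup>2 \<le> M * ?g" for \<theta>
      proof -
        have "(norm (arc_deriv ddt c v \<theta>))\<^sup>2 \<le> (K * sqrt ?g)\<^sup>2"
          using K(2)[OF c v, of 1 \<theta>] n by (intro power_mono) auto
        also have "\<dots> \<le> M * ?g" using g C' a(1) by (simp add: power_mult_distrib M_def mult_right_mono)
        finally show ?thesis .
      qed
      show "(\<integral>\<theta>. (norm ((arc_deriv ddt c ^^ j) v \<theta>))\<^sup>2 \<partial>circ) \<le> M * ?g" if "j \<in> {2..n}" for j
      proof -
        have "(\<integral>\<theta>. (norm ((arc_deriv ddt c ^^ j) v \<theta>))\<^sup>2 \<partial>circ) \<le> Hn_sq n c v / a"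
          using that by (intro arc_deriv_L2 a c v ball_Imm) auto
        also have "\<dots> \<le> C' * ?g / a" using a(1) bound[OF c v] by (intro divide_right_mono) auto
        also have "\<dots> \<le> M * ?g" using g by (simp add: M_def distrib_right)
        finally show ?thesis .
      qed
    qed (use v arc_deriv_Cinf[OF ball_Imm[OF c] v] in auto)
    also have "\<dots> \<le> 2 * L\<^sup>2 * ((4 * pi + 2 + (real n)\<^sup>2) * (1 + ?N c)\<^sup>2) * (M * ?g)"
    proof (intro mult_left_mono mult_right_mono)
      have "(\<integral>\<theta>. (1 + norm ((ddt ^^ n) c \<theta>))\<^sup>2 \<partial>circ) + (real n)\<^sup>2 \<le> 4 * pi + 2 * (?N c)\<^sup>2 + (real n)\<^sup>2"
        using weight_L2[OF ball_Cinf[OF c]] sq[of c] by linarith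
      also have "\<dots> \<le> (4 * pi + (real n)\<^sup>2) * (1 + ?N c)\<^sup>2 + 2 * (1 + ?N c)\<^sup>2"
      proof -
        have "1 \<le> (1 + ?N c)\<^sup>2" "(?N c)\<^sup>2 \<le> (1 + ?N c)\<^sup>2"
          using pos[of c] one_le_power[of "1 + ?N c" 2] power_mono[of "?N c" "1 + ?N c" 2] by auto
        moreover have "4 * pi + (real n)\<^sup>2 \<le> (4 * pi + (real n)\<^sup>2) * (1 + ?N c)\<^sup>2"
          using mult_left_mono[OF calculation(1), of "4 * pi + (real n)\<^sup>2"] by simp
        ultimately show ?thesis by linarith
      qed
      also have "\<dots> = (4 * pi + 2 + (real n)\<^sup>2) * (1 + ?N c)\<^sup>2" by (simp only: distrib_right)
      finally show "(\<integral>\<theta>. (1 + norm ((ddt ^^ n) c \<theta>))\<^sup>2 \<partial>circ) + (real n)\<^sup>2 \<le>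
        (4 * pi + 2 + (real n)\<^sup>2) * (1 + ?N c)\<^sup>2" .
    qed (use M g in auto)
    also have "\<dots> = Q * ?g * (1 + ?N c)\<^sup>2" by (simp add: Q_def mult_ac)
    also have "\<dots> = (sqrt Q * sqrt ?g * (1 + ?N c))\<^sup>2" using Q g by (simp add: power_mult_distrib)
    finally have "?N v \<le> sqrt ((sqrt Q * sqrt ?g * (1 + ?N c))\<^sup>2)" by (rule real_sqrt_le_mono)
    moreover have "0 \<le> sqrt Q * sqrt ?g * (1 + ?N c)"
      using Q g pos[of c] by (intro mult_nonneg_nonneg) auto
    ultimately show ?thesis by (simp only: real_sqrt_abs abs_of_nonneg)
  qed
  then have "\<bar>ln (1 + ?N c) - ln (1 + ?N c0)\<bar> \<le> sqrt Q * r" if "c \<in> B" for c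
    using Q pos that by (intro seminorm_growth[OF G Ck_seminorm_L2]) (auto intro: add_pos_nonneg)
  then have 1: "1 + ?N c \<le> (1 + ?N c0) * exp (sqrt Q * r)" if "c \<in> B" for c
    using that pos by (intro ln_diff_bound(1)) (auto intro: add_pos_nonneg)
  have "(\<integral>\<theta>. (1 + norm ((ddt ^^ n) c \<theta>))\<^sup>2 \<partial>circ) \<le> 4 * pi + 2 * ((1 + ?N c0) * exp (sqrt Q * r))\<^sup>2"
    if c: "c \<in> B" for c
  proof -
    have "(?N c)\<^sup>2 \<le> ((1 + ?N c0) * exp (sqrt Q * r))\<^sup>2"
      using 1[OF c] pos[of c] by (intro power_mono) linarith+
    then show ?thesis using weight_L2[OF ball_Cinf[OF c]] sq[of c] by linarith
  qed
  then show ?thesis by blast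
qed

text \<open>The value space of h is free: once the curves are controlled, the comparison makes no
  further reference to G.\<close>

lemma smooth_norms_equivalent:
  "\<exists>C>0. \<forall>c\<in>metric_ball G c0 r. \<forall>h\<in>Cinf.
    (\<integral>\<theta>. (norm (h \<theta> :: 'b::real_inner))\<^sup>2 + (norm ((ddt ^^ n) h \<theta>))\<^sup>2 \<partial>circ) \<le> C * Hn_sq n c h \<and>
    Hn_sq n c h \<le> C * (\<integral>\<theta>. (norm (h \<theta>))\<^sup>2 + (norm ((ddt ^^ n) h \<theta>))\<^sup>2 \<partial>circ)"
proof -
  obtain a A where a: "0 < a" "\<And>c \<theta>. c \<in> B \<Longrightarrow> a \<le> speed c \<theta>" and A': "\<And>c \<theta>. c \<in> B \<Longrightarrow> speed c \<theta> \<le> A"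
    using speed_bounded by blast
  \<comment> \<open>If the ball is empty, A is an arbitrary number; the maximum is positive in any
    case. The same precaution is taken with W.\<close>
  define A1 where "A1 = max A 1"
  have A: "0 < A1" "\<And>c \<theta>. c \<in> B \<Longrightarrow> speed c \<theta> \<le> A1" using A' by (auto simp: A1_def intro: max.coboundedI1)
  obtain \<Lambda> where \<Lambda>: "0 < \<Lambda>" "\<And>c. c \<in> B \<Longrightarrow> (\<integral>\<theta>. speed c \<theta> \<partial>circ) \<le> \<Lambda>"
    using length_bounded by blast
  obtain W where W: "\<And>c. c \<in> B \<Longrightarrow> (\<integral>\<theta>. (1 + norm ((ddt ^^ n) c \<theta>))\<^sup>2 \<partial>circ) \<le> W"
    using top_derivative_bounded by blast
  obtain L1 where L1: "0 < L1" "\<And>c f \<theta>. c \<in> B \<Longrightarrow> f \<in> Cinf \<Longrightarrow> norm ((ddt ^^ n) f \<theta> :: 'b) \<le>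
      L1 * ((1 + norm ((ddt ^^ n) c \<theta>)) * norm (arc_deriv ddt c f \<theta>) +
        (\<Sum>j\<in>{2..n}. norm ((arc_deriv ddt c ^^ j) f \<theta>)))"
    using comparison(1) by metis
  obtain L2 where L2: "0 < L2" "\<And>c f \<theta>. c \<in> B \<Longrightarrow> f \<in> Cinf \<Longrightarrow> norm ((arc_deriv ddt c ^^ n) f \<theta> :: 'b) \<le>
      L2 * ((1 + norm ((ddt ^^ n) c \<theta>)) * norm (ddt f \<theta>) + (\<Sum>j\<in>{2..n}. norm ((ddt ^^ j) f \<theta>)))"
    using comparison(2) by metis
  define W1 where "W1 = max W 0 + (real n)\<^sup>2"
  have W1: "0 \<le> W1" "\<And>c. c \<in> B \<Longrightarrow> (\<integral>\<theta>. (1 + norm ((ddt ^^ n) c \<theta>))\<^sup>2 \<partial>circ) + (real n)\<^sup>2 \<le> W1"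
    using W by (auto simp: W1_def intro: max.coboundedI1)
  \<comment> \<open>The summand 1/a is for |h|^2 and the other for the n-th derivative: \<Lambda>
    from the pointwise bound on the first derivative, 1/a from the square integrals.\<close>
  define E1 where "E1 = 1 / a + 2 * L1\<^sup>2 * W1 * (\<Lambda> + 1 / a)"
  \<comment> \<open>\<open>A1\<close> bounds the speed, and 2 pi is the length belonging to the
    constant weight 1.\<close>
  define E2 where "E2 = A1 * (1 + 2 * L2\<^sup>2 * W1 * (2 * pi + 1))"
  have lower: "(\<integral>\<theta>. (norm (h \<theta>))\<^sup>2 + (norm ((ddt ^^ n) h \<theta>))\<^sup>2 \<partial>circ) \<le> E1 * Hn_sq n c h"
    if c: "c \<in> B" and h: "h \<in> Cinf" for c and h :: "real \<Rightarrow> 'b"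
  proof -
    let ?S = "Hn_sq n c h"
    note cI = ball_Imm[OF c]
    have S: "0 \<le> ?S" by (rule Hn_sq_nonneg)
    have "(\<integral>\<theta>. (norm ((ddt ^^ n) h \<theta>))\<^sup>2 \<partial>circ) \<le>
        2 * L1\<^sup>2 * ((\<integral>\<theta>. (1 + norm ((ddt ^^ n) c \<theta>))\<^sup>2 \<partial>circ) + (real n)\<^sup>2) * ((\<Lambda> + 1 / a) * ?S)"
    proof (rule L2_top_bound[OF _ _ _ _ L1(2)[OF c h]])
      show "continuous_on {0..2*pi} (\<lambda>\<theta>. 1 + norm ((ddt ^^ n) c \<theta>))"
        using ball_Cinf[OF c] by (intro continuous_intros ddt_pow_Cinf)
      show "(norm (arc_deriv ddt c h \<theta>))\<^sup>2 \<le> (\<Lambda> + 1 / a) * ?S" for \<theta>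
      proof -
        have "(norm ((arc_deriv ddt c ^^ 1) h \<theta>))\<^sup>2 \<le> (\<integral>\<theta>. speed c \<theta> \<partial>circ) * ?S"
          using n by (intro arc_sup_bound cI h) auto
        also have "\<dots> \<le> (\<Lambda> + 1 / a) * ?S" using \<Lambda>(2)[OF c] a(1) S by (intro mult_right_mono add_increasing2) auto
        finally show ?thesis by simp
      qed
      show "(\<integral>\<theta>. (norm ((arc_deriv ddt c ^^ j) h \<theta>))\<^sup>2 \<partial>circ) \<le> (\<Lambda> + 1 / a) * ?S" if "j \<in> {2..n}" for j
      proof -
        have "(\<integral>\<theta>. (norm ((arc_deriv ddt c ^^ j) h \<theta>))\<^sup>2 \<partial>circ) \<le> ?S / a"
          using that by (intro arc_deriv_L2 a c h cI) auto
        also have "\<dots> \<le> (\<Lambda> + 1 / a) * ?S" using S \<Lambda>(1) by (simp add: distrib_right)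
        finally show ?thesis .
      qed
    qed (use h arc_deriv_Cinf[OF cI h] in auto)
    also have "\<dots> \<le> 2 * L1\<^sup>2 * W1 * ((\<Lambda> + 1 / a) * ?S)"
      using W1(2)[OF c] S \<Lambda>(1) a(1) by (intro mult_right_mono mult_left_mono) auto
    finally have 1: "(\<integral>\<theta>. (norm ((ddt ^^ n) h \<theta>))\<^sup>2 \<partial>circ) \<le> 2 * L1\<^sup>2 * W1 * ((\<Lambda> + 1 / a) * ?S)" .
    have 2: "(\<integral>\<theta>. (norm (h \<theta>))\<^sup>2 \<partial>circ) \<le> ?S / a"
      using arc_deriv_L2[OF a(1) a(2)[OF c] cI h, of 0] by simp
    have "(\<integral>\<theta>. (norm (h \<theta>))\<^sup>2 + (norm ((ddt ^^ n) h \<theta>))\<^sup>2 \<partial>circ) =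
        (\<integral>\<theta>. (norm (h \<theta>))\<^sup>2 \<partial>circ) + (\<integral>\<theta>. (norm ((ddt ^^ n) h \<theta>))\<^sup>2 \<partial>circ)"
      using h by (intro Bochner_Integration.integral_add integrable_circ continuous_intros ddt_pow_Cinf)
    also have "\<dots> \<le> ?S / a + 2 * L1\<^sup>2 * W1 * ((\<Lambda> + 1 / a) * ?S)" using 1 2 by linarith
    also have "\<dots> = E1 * ?S" by (simp add: E1_def distrib_right)
    finally show ?thesis .
  qed
  have upper: "Hn_sq n c h \<le> E2 * (\<integral>\<theta>. (norm (h \<theta>))\<^sup>2 + (norm ((ddt ^^ n) h \<theta>))\<^sup>2 \<partial>circ)"
    if c: "c \<in> B" and h: "h \<in> Cinf" for c and h :: "real \<Rightarrow> 'b"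
  proof -
    let ?S = "\<integral>\<theta>. (norm (h \<theta>))\<^sup>2 + (norm ((ddt ^^ n) h \<theta>))\<^sup>2 \<partial>circ"
    note cI = ball_Imm[OF c]
    have S: "0 \<le> ?S" by (intro integral_nonneg_AE) auto
    \<comment> \<open>For the weight a = 1 the weighted inequalities are phrased with this
      operator.\<close>
    have D: "wder (\<lambda>\<theta>. inverse 1) = (ddt :: (real \<Rightarrow> 'b) \<Rightarrow> _)" by (simp add: wder_one)
    have "(\<integral>\<theta>. (norm ((arc_deriv ddt c ^^ n) h \<theta>))\<^sup>2 \<partial>circ) \<le>
        2 * L2\<^sup>2 * ((\<integral>\<theta>. (1 + norm ((ddt ^^ n) c \<theta>))\<^sup>2 \<partial>circ) + (real n)\<^sup>2) * ((2 * pi + 1) * ?S)"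
    proof (rule L2_top_bound[OF _ _ _ _ L2(2)[OF c h]])
      show "continuous_on {0..2*pi} (\<lambda>\<theta>. 1 + norm ((ddt ^^ n) c \<theta>))"
        using ball_Cinf[OF c] by (intro continuous_intros ddt_pow_Cinf)
      show "(norm (ddt h \<theta>))\<^sup>2 \<le> (2 * pi + 1) * ?S" for \<theta>
      proof -
        have "(norm (ddt h \<theta>))\<^sup>2 \<le> 2 * pi * ?S"
          using weighted_sup_interpolation[of "\<lambda>\<theta>. 1" h 1 n \<theta>] n h by (simp add: D wder_one)
        also have "\<dots> \<le> (2 * pi + 1) * ?S" using S by (intro mult_right_mono) auto
        finally show ?thesis .
      qed
      show "(\<integral>\<theta>. (norm ((ddt ^^ j) h \<theta>))\<^sup>2 \<partial>circ) \<le> (2 * pi + 1) * ?S" if "j \<in> {2..n}" for j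
      proof -
        have "(\<integral>\<theta>. (norm ((ddt ^^ j) h \<theta>))\<^sup>2 \<partial>circ) \<le> 1 * ?S"
          using weighted_interpolation[of "\<lambda>\<theta>. 1" h j n] that h by (simp add: D wder_one)
        also have "\<dots> \<le> (2 * pi + 1) * ?S" using S by (intro mult_right_mono) auto
        finally show ?thesis .
      qed
    qed (use h arc_deriv_Cinf[OF cI h] in auto)
    also have "\<dots> \<le> 2 * L2\<^sup>2 * W1 * ((2 * pi + 1) * ?S)"
      using W1(2)[OF c] S by (intro mult_right_mono mult_left_mono) auto
    finally have 1: "(\<integral>\<theta>. (norm ((arc_deriv ddt c ^^ n) h \<theta>))\<^sup>2 \<partial>circ) \<le> 2 * L2\<^sup>2 * W1 * ((2 * pi + 1) * ?S)" .
    have 2: "(\<integral>\<theta>. (norm (h \<theta>))\<^sup>2 \<partial>circ) \<le> ?S"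
      using h by (intro integral_mono integrable_circ continuous_intros ddt_pow_Cinf) auto
    have "Hn_sq n c h \<le> (\<integral>\<theta>. ((norm (h \<theta>))\<^sup>2 + (norm ((arc_deriv ddt c ^^ n) h \<theta>))\<^sup>2) * A1 \<partial>circ)"
      unfolding arc_integral_circ using h A(2)[OF c]
      by (intro integral_mono integrable_circ continuous_intros mult_left_mono arc_deriv_Cinf cI
          Cinf_continuous_on[OF speed_Cinf(1)]) auto
    also have "\<dots> = A1 * (\<integral>\<theta>. (norm (h \<theta>))\<^sup>2 + (norm ((arc_deriv ddt c ^^ n) h \<theta>))\<^sup>2 \<partial>circ)"
      by (simp add: mult.commute)
    also have "(\<integral>\<theta>. (norm (h \<theta>))\<^sup>2 + (norm ((arc_deriv ddt c ^^ n) h \<theta>))\<^sup>2 \<partial>circ) =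
        (\<integral>\<theta>. (norm (h \<theta>))\<^sup>2 \<partial>circ) + (\<integral>\<theta>. (norm ((arc_deriv ddt c ^^ n) h \<theta>))\<^sup>2 \<partial>circ)"
      using h by (intro Bochner_Integration.integral_add integrable_circ continuous_intros arc_deriv_Cinf cI)
    also have "A1 * \<dots> \<le> A1 * (?S + 2 * L2\<^sup>2 * W1 * ((2 * pi + 1) * ?S))"
      using 1 2 A(1) by (intro mult_left_mono) auto
    also have "\<dots> = E2 * ?S" by (simp add: E2_def distrib_right distrib_left mult_ac)
    finally show ?thesis .
  qed
  have *: "(\<integral>\<theta>. (norm (h \<theta>))\<^sup>2 + (norm ((ddt ^^ n) h \<theta>))\<^sup>2 \<partial>circ) \<le> (max E1 E2) * Hn_sq n c h \<and>
    Hn_sq n c h \<le> (max E1 E2) * (\<integral>\<theta>. (norm (h \<theta>))\<^sup>2 + (norm ((ddt ^^ n) h \<theta>))\<^sup>2 \<partial>circ)"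
    if "c \<in> B" "h \<in> Cinf" for c and h :: "real \<Rightarrow> 'b"
  proof -
    have *: "0 \<le> Hn_sq n c h" "0 \<le> (\<integral>\<theta>. (norm (h \<theta>))\<^sup>2 + (norm ((ddt ^^ n) h \<theta>))\<^sup>2 \<partial>circ)"
      by (auto intro!: Hn_sq_nonneg integral_nonneg_AE)
    from mult_right_mono[OF max.cobounded1[of E1 E2] *(1)] mult_right_mono[OF max.cobounded2[of E2 E1] *(2)]
    show ?thesis using lower[OF that] upper[OF that] by linarith
  qed
  have "0 < E1" using a(1) W1(1) \<Lambda>(1) by (auto simp: E1_def intro!: add_pos_nonneg mult_nonneg_nonneg)
  then have "0 < max E1 E2" by simp
  then show ?thesis using * by blast
qed

end

subsection \<open>Density of smooth functions\<close>

lemma cos_sin_Cinf: "cos \<in> (Cinf :: (real \<Rightarrow> real) set)" "sin \<in> (Cinf :: (real \<Rightarrow> real) set)"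
proof -
  have d: "(cos has_vector_derivative (- 1) * sin \<theta>) (at \<theta>)" "(sin has_vector_derivative cos \<theta>) (at \<theta>)"
    for \<theta> :: real
    using DERIV_cos[of \<theta>] DERIV_sin[of \<theta>] by (simp_all add: has_real_derivative_iff_has_vector_derivative)
  have "times_differentiable k (cos :: real \<Rightarrow> real) \<and> times_differentiable k (sin :: real \<Rightarrow> real)" for k
  proof (induction k)
    case 0
    then show ?case using d by (auto simp: differentiable_on_def intro!: differentiableI_vector)
  next
    case (Suc k)
    then have "times_differentiable k (\<lambda>\<theta>. (- 1) * sin \<theta> :: real)"
      by (intro times_differentiable_bilinear[OF bounded_bilinear_mult] times_differentiable_const) auto
    then show ?case using Suc times_differentiable_SucI[OF d(1)] times_differentiable_SucI[OF d(2)] by blast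
  qed
  then show "cos \<in> (Cinf :: (real \<Rightarrow> real) set)" "sin \<in> (Cinf :: (real \<Rightarrow> real) set)"
    by (auto simp: Cinf_iff periodic_def)
qed

text \<open>Restricted to the unit circle, real and imaginary part become cosine and sine, so these
  are trigonometric polynomials.\<close>

lemma polynomial_cis_Cinf:
  assumes "real_polynomial_function f"
  shows "(\<lambda>\<theta>. f (cis \<theta>)) \<in> Cinf"
  using assms
proof induction
  case (linear f)
  then have "f (cis \<theta>) = f 1 * cos \<theta> + f \<i> * sin \<theta>" for \<theta>
  proof -
    have "cis \<theta> = cos \<theta> *\<^sub>R 1 + sin \<theta> *\<^sub>R \<i>" by (simp add: complex_eq_iff)
    then show ?thesis
      using linear by (simp add: linear_add linear_scale bounded_linear.linear mult.commute)
  qed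
  then show ?case using cos_sin_Cinf by (simp add: add_Cinf mult_Cinf)
qed (auto intro: add_Cinf mult_Cinf)

text \<open>
  The approximants are first cut off near the point 1 of the unit circle, where \<open>Arg2pi\<close> jumps,
  and then replaced by trigonometric polynomials via the Stone-Weierstrass theorem.
\<close>

lemma bounded_approximation:
  fixes f :: "real \<Rightarrow> real"
  assumes f: "f \<in> borel_measurable circ" and K: "\<And>\<theta>. \<bar>f \<theta>\<bar> \<le> K"
  obtains q where "\<And>m. q m \<in> Cinf" "\<And>m \<theta>. \<bar>q m \<theta>\<bar> \<le> K + 1" "AE \<theta> in circ. (\<lambda>m. q m \<theta>) \<longlonglongrightarrow> f \<theta>"
proof -
  \<comment> \<open>Measurability in the sense of \<open>measurable_on\<close> supplies continuous
    functions that converge to f off a null set; they are not periodic yet.\<close>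
  have "(\<lambda>x. if x \<in> {0..2*pi} then f x else 0) \<in> borel_measurable lebesgue"
    using f by (intro borel_measurable_if_I) auto
  then have "(\<lambda>x. if x \<in> {0..2*pi} then f x else 0) measurable_on UNIV"
    by (rule lebesgue_measurable_imp_measurable_on) auto
  then obtain N g where N: "negligible N" and g: "\<And>m. continuous_on UNIV (g m)"
    and lim: "\<And>x. x \<notin> N \<Longrightarrow> (\<lambda>m. g m x) \<longlonglongrightarrow> (if x \<in> {0..2*pi} then f x else 0)"
    unfolding measurable_on_def by auto
  have K0: "0 \<le> K" using K[of 0] by simp
  \<comment> \<open>Clamping to [-K, K] makes the sequence bounded, as dominated convergence will
    require; the polynomial approximation later adds an error of at most 1.\<close>
  define P where "P = (\<lambda>(m::nat) z. max (- K) (min K (g m (Arg2pi z))) * min 1 (real m * cmod (z - 1)))"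
  have bound: "\<bar>P m z\<bar> \<le> K * min 1 (real m * cmod (z - 1))" for m z
    unfolding P_def abs_mult using K0 by (intro mult_mono) auto
  have cont: "continuous_on (sphere 0 1) (P m)" for m
  proof (intro continuous_at_imp_continuous_on ballI)
    fix z :: complex assume z: "z \<in> sphere 0 1"
    show "isCont (P m) z"
    proof (cases "z = 1")
      case True
      have "(\<lambda>x. K * min 1 (real m * cmod (x - 1))) \<midarrow>1\<rightarrow> K * min 1 (real m * cmod (1 - 1))"
        by (intro tendsto_intros)
      then have "(\<lambda>x. K * min 1 (real m * cmod (x - 1))) \<midarrow>1\<rightarrow> 0" by simp
      then have "P m \<midarrow>1\<rightarrow> 0"
        by (rule tendsto_0_le[where K = 1]) (use bound K0 in \<open>auto simp: abs_mult intro!: always_eventually\<close>)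
      then show ?thesis using True by (simp add: isCont_def P_def)
    next
      case False
      have "z \<notin> \<real>\<^sub>\<ge>\<^sub>0"
      proof
        assume "z \<in> \<real>\<^sub>\<ge>\<^sub>0"
        then obtain x where "z = of_real x" "0 \<le> x" by (rule nonneg_Reals_cases)
        then show False using z False by simp
      qed
      then have 1: "isCont Arg2pi z" by (rule continuous_at_Arg2pi)
      have 2: "isCont (g m) (Arg2pi z)" using g[of m] by (simp add: continuous_on_eq_continuous_at)
      show ?thesis
        unfolding P_def
        by (intro continuous_mult continuous_max continuous_min continuous_const continuous_norm
            continuous_diff continuous_ident isCont_o2[OF 1 2])
    qed
  qed
  have "\<exists>R. real_polynomial_function R \<and> (\<forall>z\<in>sphere 0 1. \<bar>P m z - R z\<bar> < 1 / (real m + 1))" for m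
  proof -
    have e: "0 < 1 / (real m + 1)" by simp
    show ?thesis
      using Stone_Weierstrass_real_polynomial_function[OF compact_sphere cont[of m] e] by metis
  qed
  then have "\<exists>R. \<forall>m. real_polynomial_function (R m) \<and> (\<forall>z\<in>sphere 0 1. \<bar>P m z - R m z\<bar> < 1 / (real m + 1))"
    by (intro choice allI)
  then obtain R where R: "\<forall>m. real_polynomial_function (R m) \<and> (\<forall>z\<in>sphere 0 1. \<bar>P m z - R m z\<bar> < 1 / (real m + 1))" ..
  note R = R[rule_format, THEN conjunct1] R[rule_format, THEN conjunct2, rule_format]
  define q where "q = (\<lambda>m \<theta>. R m (cis \<theta>))"
  have close: "\<bar>P m (cis \<theta>) - q m \<theta>\<bar> < 1 / (real m + 1)" for m \<theta>
    using R(2)[of "cis \<theta>" m] by (simp add: q_def)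
  have qC: "q m \<in> Cinf" for m unfolding q_def by (intro polynomial_cis_Cinf R)
  have qb: "\<bar>q m \<theta>\<bar> \<le> K + 1" for m \<theta>
  proof -
    have "K * min 1 (real m * cmod (cis \<theta> - 1)) \<le> K * 1" using K0 by (intro mult_left_mono) auto
    moreover have "1 / (real m + 1) \<le> 1" by simp
    ultimately show ?thesis using bound[of m "cis \<theta>"] close[of m \<theta>] by linarith
  qed
  have conv: "(\<lambda>m. q m \<theta>) \<longlonglongrightarrow> f \<theta>" if \<theta>: "0 < \<theta>" "\<theta> < 2 * pi" "\<theta> \<notin> N" for \<theta>
  proof -
    have arg: "Arg2pi (cis \<theta>) = \<theta>"
      by (rule Arg2pi_unique[of 1]) (use \<theta> in \<open>auto simp: cis_conv_exp\<close>)
    have "cis \<theta> \<noteq> 1"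
    proof
      assume "cis \<theta> = 1"
      then have "Arg2pi (cis \<theta>) = Arg2pi 1" by simp
      moreover have "Arg2pi 1 = 0" using Arg2pi_of_real[of 1] by simp
      ultimately show False using arg \<theta>(1) by simp
    qed
    then have pos: "0 < cmod (cis \<theta> - 1)" by simp
    have "eventually (\<lambda>m. min 1 (real m * cmod (cis \<theta> - 1)) = 1) sequentially"
      using eventually_ge_at_top[of "nat \<lceil>1 / cmod (cis \<theta> - 1)\<rceil>"]
    proof eventually_elim
      case (elim m)
      then have "1 / cmod (cis \<theta> - 1) \<le> real m" by linarith
      then show ?case using pos by (simp add: field_simps)
    qed
    then have "(\<lambda>m. min 1 (real m * cmod (cis \<theta> - 1))) \<longlonglongrightarrow> 1" by (rule tendsto_eventually)
    moreover have "(\<lambda>m. g m \<theta>) \<longlonglongrightarrow> f \<theta>" using lim[OF \<theta>(3)] \<theta> by simp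
    ultimately have "(\<lambda>m. P m (cis \<theta>)) \<longlonglongrightarrow> max (- K) (min K (f \<theta>)) * 1"
      unfolding P_def arg by (intro tendsto_mult tendsto_max tendsto_min tendsto_const)
    moreover have "max (- K) (min K (f \<theta>)) = f \<theta>" using K[of \<theta>] by auto
    ultimately have 1: "(\<lambda>m. P m (cis \<theta>)) \<longlonglongrightarrow> f \<theta>" by simp
    have "(\<lambda>m. 1 / (real m + 1)) \<longlonglongrightarrow> 0" using LIMSEQ_inverse_real_of_nat by (simp add: inverse_eq_divide add.commute)
    then have "(\<lambda>m. P m (cis \<theta>) - q m \<theta>) \<longlonglongrightarrow> 0"
      by (rule tendsto_0_le[where K = 1]) (use close in \<open>auto intro!: always_eventually simp: less_imp_le\<close>)
    from tendsto_diff[OF 1 this] show ?thesis by simp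
  qed
  have "insert 0 (insert (2*pi) N) \<in> null_sets lebesgue"
    using N by (simp add: negligible_iff_null_sets[symmetric])
  then have "AE \<theta> in lebesgue. \<theta> \<notin> insert 0 (insert (2*pi) N)" by (rule AE_not_in)
  then have "AE \<theta> in lebesgue. \<theta> \<in> {0..2*pi} \<longrightarrow> (\<lambda>m. q m \<theta>) \<longlonglongrightarrow> f \<theta>"
    by (rule eventually_mono) (use conv in auto)
  then have "AE \<theta> in circ. (\<lambda>m. q m \<theta>) \<longlonglongrightarrow> f \<theta>"
    by (subst AE_restrict_space_iff) auto
  then show ?thesis using that[of q] qC qb by simp
qed

section \<open>Pairings with smooth functions and approximation in L2\<close>

lemma Cinf_circ:
  assumes "(q :: real \<Rightarrow> real) \<in> Cinf"
  shows "q \<in> borel_measurable circ" "integrable circ q"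
  using assms by (auto intro!: measurable_circ integrable_circ Cinf_continuous_on)

lemma integrable_mult_Cinf:
  fixes f q :: "real \<Rightarrow> real"
  assumes f: "integrable circ f" and q: "q \<in> Cinf"
  shows "integrable circ (\<lambda>\<theta>. f \<theta> * q \<theta>)"
proof -
  obtain K where K: "0 < K" "\<And>\<theta>. norm (q \<theta>) \<le> K" using Cinf_bounded[OF q] by blast
  have [measurable]: "f \<in> borel_measurable circ" "q \<in> borel_measurable circ" using f Cinf_circ[OF q] by auto
  show ?thesis
  proof (rule Bochner_Integration.integrable_bound)
    show "integrable circ (\<lambda>\<theta>. K * f \<theta>)" using f by simp
    have "norm (f \<theta> * q \<theta>) \<le> norm (K * f \<theta>)" for \<theta>
      using mult_left_mono[OF K(2)[of \<theta>], of "\<bar>f \<theta>\<bar>"] K(1) by (simp add: abs_mult mult.commute)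
    then show "AE \<theta> in circ. norm (f \<theta> * q \<theta>) \<le> norm (K * f \<theta>)" by auto
  qed simp
qed

text \<open>Smooth approximants of \<open>sgn g\<close> are used as test functions. They are bounded
  by 1 + 1, so 2|g| dominates although g is merely integrable.\<close>

lemma fundamental_lemma_variations:
  fixes g :: "real \<Rightarrow> real"
  assumes g: "integrable circ g" and 0: "\<And>\<phi>. \<phi> \<in> Cinf \<Longrightarrow> (\<integral>\<theta>. g \<theta> * \<phi> \<theta> \<partial>circ) = 0"
  shows "AE \<theta> in circ. g \<theta> = 0"
proof -
  have [measurable]: "g \<in> borel_measurable circ" using g by simp
  have "(\<lambda>\<theta>. sgn (g \<theta>)) \<in> borel_measurable circ" by measurable
  then obtain q where q: "\<And>m. q m \<in> Cinf" "\<And>m \<theta>. \<bar>q m \<theta>\<bar> \<le> 1 + 1"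
    "AE \<theta> in circ. (\<lambda>m. q m \<theta>) \<longlonglongrightarrow> sgn (g \<theta>)"
    by (rule bounded_approximation[where K = 1]) (auto simp: abs_sgn_eq)
  have [measurable]: "q m \<in> borel_measurable circ" for m using Cinf_circ q(1) by blast
  have "(\<lambda>m. \<integral>\<theta>. g \<theta> * q m \<theta> \<partial>circ) \<longlonglongrightarrow> (\<integral>\<theta>. g \<theta> * sgn (g \<theta>) \<partial>circ)"
  proof (rule integral_dominated_convergence)
    show "integrable circ (\<lambda>\<theta>. 2 * \<bar>g \<theta>\<bar>)" using g by simp
    show "AE \<theta> in circ. (\<lambda>m. g \<theta> * q m \<theta>) \<longlonglongrightarrow> g \<theta> * sgn (g \<theta>)"
      using q(3) by eventually_elim (intro tendsto_intros)
    show "AE \<theta> in circ. norm (g \<theta> * q m \<theta>) \<le> 2 * \<bar>g \<theta>\<bar>" for m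
    proof (rule AE_I2)
      fix \<theta>
      show "norm (g \<theta> * q m \<theta>) \<le> 2 * \<bar>g \<theta>\<bar>"
        using mult_left_mono[OF q(2)[of m \<theta>], of "\<bar>g \<theta>\<bar>"] by (simp add: abs_mult mult.commute)
    qed
  qed auto
  then have "(\<integral>\<theta>. g \<theta> * sgn (g \<theta>) \<partial>circ) = 0" using 0[OF q(1)] LIMSEQ_unique[OF _ tendsto_const] by simp
  then have "(\<integral>\<theta>. \<bar>g \<theta>\<bar> \<partial>circ) = 0" by (simp add: abs_sgn)
  then show ?thesis using integral_nonneg_eq_0_iff_AE[of circ "\<lambda>\<theta>. \<bar>g \<theta>\<bar>"] g by simp
qed

text \<open>Concerns the values on one period only; unlike \<open>L2_circle\<close> it does not ask
  for periodicity, which convergence of integrals ignores.\<close>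

definition square_integrable :: "(real \<Rightarrow> real) \<Rightarrow> bool" where
  "square_integrable f \<longleftrightarrow> f \<in> borel_measurable circ \<and> integrable circ (\<lambda>\<theta>. (f \<theta>)\<^sup>2)"

lemma square_integrable_Cinf: "q \<in> Cinf \<Longrightarrow> square_integrable q"
  unfolding square_integrable_def
  by (intro conjI Cinf_circ integrable_circ continuous_on_power Cinf_continuous_on)

lemma square_integrable_mult:
  "square_integrable f \<Longrightarrow> square_integrable g \<Longrightarrow> integrable circ (\<lambda>\<theta>. f \<theta> * g \<theta>)"
  unfolding square_integrable_def by (intro integrable_mult_L2) auto

lemma square_integrable_add:
  "square_integrable f \<Longrightarrow> square_integrable g \<Longrightarrow> square_integrable (\<lambda>\<theta>. f \<theta> + g \<theta>)"
  unfolding square_integrable_def by (intro conjI integrable_add_L2) auto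

lemma square_integrable_Cinf_mult:
  assumes f: "square_integrable f" and q: "q \<in> Cinf"
  shows "square_integrable (\<lambda>\<theta>. q \<theta> * f \<theta>)"
proof -
  have "integrable circ (\<lambda>\<theta>. (f \<theta>)\<^sup>2 * (q \<theta> * q \<theta>))"
    using f q by (intro integrable_mult_Cinf mult_Cinf) (auto simp: square_integrable_def)
  then have "integrable circ (\<lambda>\<theta>. (q \<theta> * f \<theta>)\<^sup>2)" by (simp add: power2_eq_square mult_ac)
  then show ?thesis using f Cinf_circ(1)[OF q] by (auto simp: square_integrable_def)
qed

lemma square_integrable_diff:
  assumes "square_integrable f" "square_integrable g"
  shows "square_integrable (\<lambda>\<theta>. f \<theta> - g \<theta>)"
  using square_integrable_add[OF assms(1) square_integrable_Cinf_mult[OF assms(2) const_Cinf[of "-1"]]] by simp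

lemma square_integrable_sum:
  "(\<And>i. i \<in> I \<Longrightarrow> square_integrable (f i)) \<Longrightarrow> square_integrable (\<lambda>\<theta>. \<Sum>i\<in>I. f i \<theta>)"
  by (induction I rule: infinite_finite_induct)
    (auto intro: square_integrable_add square_integrable_Cinf)

lemma square_integrable_integrable: "square_integrable f \<Longrightarrow> integrable circ f"
  using square_integrable_mult[OF _ square_integrable_Cinf[OF const_Cinf[of 1]], of f] by simp

lemma L2_add_le:
  assumes "square_integrable f" "square_integrable g"
  shows "(\<integral>\<theta>. (f \<theta> + g \<theta>)\<^sup>2 \<partial>circ) \<le> 2 * (\<integral>\<theta>. (f \<theta>)\<^sup>2 \<partial>circ) + 2 * (\<integral>\<theta>. (g \<theta>)\<^sup>2 \<partial>circ)"
proof -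
  have i: "integrable circ (\<lambda>\<theta>. (f \<theta>)\<^sup>2)" "integrable circ (\<lambda>\<theta>. (g \<theta>)\<^sup>2)" "integrable circ (\<lambda>\<theta>. (f \<theta> + g \<theta>)\<^sup>2)"
    using assms square_integrable_add[OF assms] by (auto simp: square_integrable_def)
  have "(\<integral>\<theta>. (f \<theta> + g \<theta>)\<^sup>2 \<partial>circ) \<le> (\<integral>\<theta>. 2 * (f \<theta>)\<^sup>2 + 2 * (g \<theta>)\<^sup>2 \<partial>circ)"
  proof (rule integral_mono)
    show "(f \<theta> + g \<theta>)\<^sup>2 \<le> 2 * (f \<theta>)\<^sup>2 + 2 * (g \<theta>)\<^sup>2" for \<theta>
      using sum_squares_bound[of "f \<theta>" "g \<theta>"] by (simp add: power2_sum)
  qed (use i in auto)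
  then show ?thesis using i by simp
qed

lemma L2_diff_le:
  assumes "square_integrable f" "square_integrable g" "square_integrable h"
  shows "(\<integral>\<theta>. (f \<theta> - h \<theta>)\<^sup>2 \<partial>circ) \<le>
    2 * (\<integral>\<theta>. (f \<theta> - g \<theta>)\<^sup>2 \<partial>circ) + 2 * (\<integral>\<theta>. (g \<theta> - h \<theta>)\<^sup>2 \<partial>circ)"
  using L2_add_le[OF square_integrable_diff[OF assms(1,2)] square_integrable_diff[OF assms(2,3)]] by simp

text \<open>Truncation at height K reduces to bounded functions, for which almost everywhere
  convergence with a uniform bound gives convergence in L2.\<close>

lemma L2_approximation:
  assumes f: "square_integrable f"
  obtains q where "\<And>m::nat. q m \<in> Cinf" "(\<lambda>m. \<integral>\<theta>. (f \<theta> - q m \<theta>)\<^sup>2 \<partial>circ) \<longlonglongrightarrow> 0"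
proof -
  have [measurable]: "f \<in> borel_measurable circ" and f2: "integrable circ (\<lambda>\<theta>. (f \<theta>)\<^sup>2)"
    using f by (auto simp: square_integrable_def)
  interpret finite_measure circ by (rule finite_measure_circ)
  define T where "T = (\<lambda>(K::nat) \<theta>. max (- real K) (min (real K) (f \<theta>)))"
  have [measurable]: "T K \<in> borel_measurable circ" for K unfolding T_def by measurable
  have Tb: "\<bar>T K \<theta>\<bar> \<le> real K" for K \<theta> unfolding T_def by auto
  have Tf: "\<bar>f \<theta> - T K \<theta>\<bar> \<le> \<bar>f \<theta>\<bar>" "\<bar>T K \<theta>\<bar> \<le> \<bar>f \<theta>\<bar>" for K \<theta> unfolding T_def by (auto simp: max_def min_def)
  have T2: "square_integrable (T K)" for K
    unfolding square_integrable_def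
  proof
    show "integrable circ (\<lambda>\<theta>. (T K \<theta>)\<^sup>2)"
      by (rule Bochner_Integration.integrable_bound[OF f2]) (auto simp: abs_le_square_iff[symmetric] Tf)
  qed measurable
  have "(\<lambda>K. \<integral>\<theta>. (f \<theta> - T K \<theta>)\<^sup>2 \<partial>circ) \<longlonglongrightarrow> (\<integral>\<theta>. 0 \<partial>circ)"
  proof (rule integral_dominated_convergence[OF _ _ f2])
    show "AE \<theta> in circ. (\<lambda>K. (f \<theta> - T K \<theta>)\<^sup>2) \<longlonglongrightarrow> 0"
    proof (rule AE_I2)
      fix \<theta>
      have "eventually (\<lambda>K. (f \<theta> - T K \<theta>)\<^sup>2 = 0) sequentially"
        using eventually_ge_at_top[of "nat \<lceil>\<bar>f \<theta>\<bar>\<rceil>"]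
      proof eventually_elim
        case (elim K)
        then have "\<bar>f \<theta>\<bar> \<le> real K" by linarith
        then show ?case unfolding T_def by (auto simp: max_def min_def)
      qed
      then show "(\<lambda>K. (f \<theta> - T K \<theta>)\<^sup>2) \<longlonglongrightarrow> 0" by (rule tendsto_eventually)
    qed
    show "AE \<theta> in circ. norm ((f \<theta> - T K \<theta>)\<^sup>2) \<le> (f \<theta>)\<^sup>2" for K
      by (auto simp: abs_le_square_iff[symmetric] Tf)
  qed auto
  then have lim1: "(\<lambda>K. \<integral>\<theta>. (f \<theta> - T K \<theta>)\<^sup>2 \<partial>circ) \<longlonglongrightarrow> 0" by simp
  have step: "\<exists>q\<in>Cinf. (\<integral>\<theta>. (T K \<theta> - q \<theta>)\<^sup>2 \<partial>circ) < e" if "0 < e" for e K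
  proof -
    obtain q where q: "\<And>m. q m \<in> Cinf" "\<And>m \<theta>. \<bar>q m \<theta>\<bar> \<le> real K + 1" "AE \<theta> in circ. (\<lambda>m. q m \<theta>) \<longlonglongrightarrow> T K \<theta>"
      by (rule bounded_approximation[of "T K" "real K"]) (use Tb in auto)
    have [measurable]: "q m \<in> borel_measurable circ" for m using Cinf_circ q(1) by blast
    have "(\<lambda>m. \<integral>\<theta>. (T K \<theta> - q m \<theta>)\<^sup>2 \<partial>circ) \<longlonglongrightarrow> (\<integral>\<theta>. 0 \<partial>circ)"
    proof (rule integral_dominated_convergence)
      show "integrable circ (\<lambda>\<theta>. (2 * real K + 1)\<^sup>2)" by simp
      show "AE \<theta> in circ. (\<lambda>m. (T K \<theta> - q m \<theta>)\<^sup>2) \<longlonglongrightarrow> 0"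
        using q(3)
      proof eventually_elim
        case (elim \<theta>)
        have "(\<lambda>m. (T K \<theta> - q m \<theta>)\<^sup>2) \<longlonglongrightarrow> (T K \<theta> - T K \<theta>)\<^sup>2" by (intro tendsto_intros elim)
        then show ?case by simp
      qed
      show "AE \<theta> in circ. norm ((T K \<theta> - q m \<theta>)\<^sup>2) \<le> (2 * real K + 1)\<^sup>2" for m
      proof (rule AE_I2)
        fix \<theta>
        have "\<bar>T K \<theta> - q m \<theta>\<bar> \<le> 2 * real K + 1" using Tb[of K \<theta>] q(2)[of m \<theta>] by linarith
        then show "norm ((T K \<theta> - q m \<theta>)\<^sup>2) \<le> (2 * real K + 1)\<^sup>2"
          by (simp add: abs_le_square_iff[symmetric])
      qed
    qed auto
    then have "eventually (\<lambda>m. (\<integral>\<theta>. (T K \<theta> - q m \<theta>)\<^sup>2 \<partial>circ) < e) sequentially"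
      using that by (intro order_tendstoD(2)) auto
    then obtain m where "(\<integral>\<theta>. (T K \<theta> - q m \<theta>)\<^sup>2 \<partial>circ) < e" using eventually_happens'[OF sequentially_bot] by blast
    then show ?thesis using q(1) by blast
  qed
  \<comment> \<open>A diagonal choice: the m-th truncation is approximated up to 1/(m + 1).\<close>
  have "\<forall>m. \<exists>q\<in>Cinf. (\<integral>\<theta>. (T m \<theta> - q \<theta>)\<^sup>2 \<partial>circ) < inverse (real (Suc m))"
    using step by simp
  then obtain q where q: "\<And>m. q m \<in> Cinf" "\<And>m. (\<integral>\<theta>. (T m \<theta> - q m \<theta>)\<^sup>2 \<partial>circ) < inverse (real (Suc m))"
    by metis
  have "(\<lambda>m. \<integral>\<theta>. (f \<theta> - q m \<theta>)\<^sup>2 \<partial>circ) \<longlonglongrightarrow> 0"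
  proof (rule tendsto_sandwich[OF _ _ tendsto_const])
    show "eventually (\<lambda>m. 0 \<le> (\<integral>\<theta>. (f \<theta> - q m \<theta>)\<^sup>2 \<partial>circ)) sequentially" by simp
    show "eventually (\<lambda>m. (\<integral>\<theta>. (f \<theta> - q m \<theta>)\<^sup>2 \<partial>circ) \<le>
      2 * (\<integral>\<theta>. (f \<theta> - T m \<theta>)\<^sup>2 \<partial>circ) + 2 * inverse (real (Suc m))) sequentially"
    proof (rule always_eventually, rule allI)
      fix m
      show "(\<integral>\<theta>. (f \<theta> - q m \<theta>)\<^sup>2 \<partial>circ) \<le>
          2 * (\<integral>\<theta>. (f \<theta> - T m \<theta>)\<^sup>2 \<partial>circ) + 2 * inverse (real (Suc m))"
        using L2_diff_le[OF f T2 square_integrable_Cinf[OF q(1)], of m m] q(2)[of m] by linarith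
    qed
    have "(\<lambda>m. 2 * (\<integral>\<theta>. (f \<theta> - T m \<theta>)\<^sup>2 \<partial>circ) + 2 * inverse (real (Suc m))) \<longlonglongrightarrow> 2 * 0 + 2 * 0"
      by (intro tendsto_intros lim1 LIMSEQ_inverse_real_of_nat)
    then show "(\<lambda>m. 2 * (\<integral>\<theta>. (f \<theta> - T m \<theta>)\<^sup>2 \<partial>circ) + 2 * inverse (real (Suc m))) \<longlonglongrightarrow> 0" by simp
  qed
  then show ?thesis using that q(1) by blast
qed

subsection \<open>Weak derivatives\<close>

lemma antiderivative_Cinf:
  fixes \<psi> :: "real \<Rightarrow> real"
  assumes \<psi>: "\<psi> \<in> Cinf" and 0: "(\<integral>\<theta>. \<psi> \<theta> \<partial>circ) = 0"
  obtains \<phi> where "\<phi> \<in> Cinf" "ddt \<phi> = \<psi>" "\<And>\<theta>. \<bar>\<phi> \<theta>\<bar> \<le> (\<integral>\<theta>. \<bar>\<psi> \<theta>\<bar> \<partial>circ)"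
proof -
  \<comment> \<open>An oriented integral for either sign of \<theta>: one of the two intervals is
    empty or a point.\<close>
  define \<phi> where "\<phi> = (\<lambda>\<theta>. integral {0..\<theta>} \<psi> - integral {\<theta>..0} \<psi>)"
  have d: "(\<phi> has_vector_derivative \<psi> \<theta>) (at \<theta>)" for \<theta>
  proof -
    define N where "N = \<bar>\<theta>\<bar> + 1"
    have int: "\<psi> integrable_on {a..b}" for a b
      by (intro integrable_continuous_real Cinf_continuous_on \<psi>)
    have "((\<lambda>u. integral {- N..u} \<psi>) has_vector_derivative \<psi> \<theta>) (at \<theta> within {- N..N})"
      by (intro integral_has_vector_derivative Cinf_continuous_on \<psi>) (auto simp: N_def)
    moreover have "at \<theta> within {- N..N} = at \<theta>"
      by (intro at_within_Icc_at) (auto simp: N_def)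
    ultimately have "((\<lambda>u. integral {- N..u} \<psi> - integral {- N..0} \<psi>) has_vector_derivative \<psi> \<theta>) (at \<theta>)"
      by (auto intro!: derivative_eq_intros)
    then show ?thesis
    proof (rule has_vector_derivative_transform_within_open[of _ _ _ "{- N<..<N}"])
      show "integral {- N..u} \<psi> - integral {- N..0} \<psi> = \<phi> u" if "u \<in> {- N<..<N}" for u
      proof (cases "0 \<le> u")
        case True
        then have "integral {- N..0} \<psi> + integral {0..u} \<psi> = integral {- N..u} \<psi>"
          using that by (intro Henstock_Kurzweil_Integration.integral_combine int) (auto simp: N_def)
        moreover have "integral {u..0} \<psi> = 0" using True by (cases "u = 0") auto
        ultimately show ?thesis by (simp add: \<phi>_def)
      next
        case False
        then have "integral {- N..u} \<psi> + integral {u..0} \<psi> = integral {- N..0} \<psi>"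
          using that by (intro Henstock_Kurzweil_Integration.integral_combine int) (auto simp: N_def)
        then show ?thesis using False by (simp add: \<phi>_def)
      qed
    qed (auto simp: N_def)
  qed
  \<comment> \<open>The increment over a period has derivative zero, so it equals its value at 0,
    the integral of \<psi>.\<close>
  have "\<phi> (\<theta> + 2 * pi) = \<phi> \<theta>" for \<theta>
  proof -
    have "((\<lambda>\<theta>. \<phi> (\<theta> + 2 * pi) - \<phi> \<theta>) has_real_derivative 0) (at x)" for x
    proof -
      have "((\<lambda>x. \<phi> (x + 2 * pi)) has_vector_derivative \<psi> (x + 2 * pi)) (at x)"
        using vector_diff_chain_at[of "\<lambda>x. x + 2 * pi" 1 x \<phi> "\<psi> (x + 2 * pi)"] d[of "x + 2 * pi"]
          has_vector_derivative_add_const[of "\<lambda>x. x" "2 * pi" 1]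
        by (simp add: o_def)
      then have "((\<lambda>\<theta>. \<phi> (\<theta> + 2 * pi) - \<phi> \<theta>) has_vector_derivative \<psi> (x + 2 * pi) - \<psi> x) (at x)"
        by (intro has_vector_derivative_diff d)
      then show ?thesis
        using Cinf_periodic[OF \<psi>] by (simp add: periodic_def has_real_derivative_iff_has_vector_derivative)
    qed
    then have "\<phi> (\<theta> + 2 * pi) - \<phi> \<theta> = \<phi> (0 + 2 * pi) - \<phi> 0"
      using DERIV_isconst_all[of "\<lambda>\<theta>. \<phi> (\<theta> + 2 * pi) - \<phi> \<theta>" \<theta> 0] by simp
    also have "\<dots> = 0"
      using 0 integral_circ[OF Cinf_continuous_on[OF \<psi>]] by (simp add: \<phi>_def)
    finally show ?thesis by simp
  qed
  then have per: "periodic \<phi>" by (simp add: periodic_def)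
  have "times_differentiable k \<phi>" for k
  proof (cases k)
    case 0
    then show ?thesis using d by (auto simp: differentiable_on_def intro: differentiableI_vector)
  next
    case (Suc l)
    then show ?thesis using times_differentiable_SucI[OF d] \<psi> by (auto simp: Cinf_iff)
  qed
  then have C: "\<phi> \<in> Cinf" using per by (simp add: Cinf_iff)
  have dd: "ddt \<phi> = \<psi>" by (rule ddt_eqI[OF d])
  have "\<bar>\<phi> \<theta>\<bar> \<le> (\<integral>\<theta>. \<bar>\<psi> \<theta>\<bar> \<partial>circ)" for \<theta>
  proof -
    obtain x where x: "x \<in> {0..2*pi}" "\<phi> x = \<phi> \<theta>" using periodic_representative[OF per] .
    have "\<phi> 0 = 0" by (simp add: \<phi>_def)
    then show ?thesis using norm_diff_le_integral_circ[OF C x(1), of 0] x(2) dd by simp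
  qed
  then show ?thesis using that C dd by blast
qed

lemma has_weak_derivative_iff:
  "has_weak_derivative f g \<longleftrightarrow> periodic f \<and> integrable circ f \<and> periodic g \<and> integrable circ g \<and>
    (\<forall>\<phi>\<in>Cinf. (\<integral>\<theta>. f \<theta> * ddt \<phi> \<theta> \<partial>circ) = - (\<integral>\<theta>. g \<theta> * \<phi> \<theta> \<partial>circ))"
  unfolding has_weak_derivative_def set_integrable_circ set_lebesgue_integral_circ ..

lemma has_weak_derivative_Cinf:
  assumes "f \<in> Cinf"
  shows "has_weak_derivative f (ddt f)"
  unfolding has_weak_derivative_iff
proof (intro conjI ballI)
  fix \<phi> :: "real \<Rightarrow> real" assume \<phi>: "\<phi> \<in> Cinf"
  have "0 = (\<integral>\<theta>. f \<theta> * ddt \<phi> \<theta> + ddt f \<theta> * \<phi> \<theta> \<partial>circ)"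
    using integral_circ_ddt[OF mult_Cinf[OF assms \<phi>]] by (simp add: ddt_mult assms \<phi>)
  also have "\<dots> = (\<integral>\<theta>. f \<theta> * ddt \<phi> \<theta> \<partial>circ) + (\<integral>\<theta>. ddt f \<theta> * \<phi> \<theta> \<partial>circ)"
    using assms \<phi> by (intro Bochner_Integration.integral_add Cinf_circ mult_Cinf ddt_Cinf)
  finally show "(\<integral>\<theta>. f \<theta> * ddt \<phi> \<theta> \<partial>circ) = - (\<integral>\<theta>. ddt f \<theta> * \<phi> \<theta> \<partial>circ)" by simp
qed (use assms in \<open>auto intro: Cinf_periodic Cinf_circ\<close>)

lemma has_weak_derivative_add:
  assumes "has_weak_derivative f f'" "has_weak_derivative g g'"
  shows "has_weak_derivative (\<lambda>\<theta>. f \<theta> + g \<theta>) (\<lambda>\<theta>. f' \<theta> + g' \<theta>)"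
proof -
  have "(\<integral>\<theta>. (f \<theta> + g \<theta>) * ddt \<phi> \<theta> \<partial>circ) = - (\<integral>\<theta>. (f' \<theta> + g' \<theta>) * \<phi> \<theta> \<partial>circ)" if \<phi>: "\<phi> \<in> Cinf" for \<phi>
    using assms \<phi> unfolding has_weak_derivative_iff distrib_right
    by (subst (1 2) Bochner_Integration.integral_add) (auto intro!: integrable_mult_Cinf)
  then show ?thesis
    using assms by (auto simp: has_weak_derivative_iff periodic_def)
qed

text \<open>The weak derivative of f is tested with b \<phi> in place of \<phi>.\<close>

lemma has_weak_derivative_mult:
  assumes f: "has_weak_derivative f g" and b: "b \<in> Cinf"
  shows "has_weak_derivative (\<lambda>\<theta>. b \<theta> * f \<theta>) (\<lambda>\<theta>. ddt b \<theta> * f \<theta> + b \<theta> * g \<theta>)"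
proof -
  have i: "integrable circ f" "integrable circ g" using f by (auto simp: has_weak_derivative_iff)
  have ib: "integrable circ (\<lambda>\<theta>. b \<theta> * f \<theta>)" "integrable circ (\<lambda>\<theta>. ddt b \<theta> * f \<theta>)" "integrable circ (\<lambda>\<theta>. b \<theta> * g \<theta>)"
    using integrable_mult_Cinf[OF i(1) b] integrable_mult_Cinf[OF i(1) ddt_Cinf[OF b]] integrable_mult_Cinf[OF i(2) b]
    by (simp_all add: mult.commute)
  have "(\<integral>\<theta>. (b \<theta> * f \<theta>) * ddt \<phi> \<theta> \<partial>circ) = - (\<integral>\<theta>. (ddt b \<theta> * f \<theta> + b \<theta> * g \<theta>) * \<phi> \<theta> \<partial>circ)"
    if \<phi>: "\<phi> \<in> Cinf" for \<phi>
  proof -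
    have "(\<integral>\<theta>. f \<theta> * (b \<theta> * ddt \<phi> \<theta> + ddt b \<theta> * \<phi> \<theta>) \<partial>circ) = - (\<integral>\<theta>. g \<theta> * (b \<theta> * \<phi> \<theta>) \<partial>circ)"
      using f mult_Cinf[OF b \<phi>] unfolding has_weak_derivative_iff by (auto simp: ddt_mult[OF b \<phi>])
    moreover have "(\<integral>\<theta>. f \<theta> * (b \<theta> * ddt \<phi> \<theta> + ddt b \<theta> * \<phi> \<theta>) \<partial>circ) =
        (\<integral>\<theta>. (b \<theta> * f \<theta>) * ddt \<phi> \<theta> \<partial>circ) + (\<integral>\<theta>. (ddt b \<theta> * f \<theta>) * \<phi> \<theta> \<partial>circ)"
      by (subst Bochner_Integration.integral_add[OF integrable_mult_Cinf[OF ib(1) ddt_Cinf[OF \<phi>]]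
            integrable_mult_Cinf[OF ib(2) \<phi>], symmetric]) (simp add: algebra_simps)
    moreover have "(\<integral>\<theta>. (ddt b \<theta> * f \<theta> + b \<theta> * g \<theta>) * \<phi> \<theta> \<partial>circ) =
        (\<integral>\<theta>. (ddt b \<theta> * f \<theta>) * \<phi> \<theta> \<partial>circ) + (\<integral>\<theta>. g \<theta> * (b \<theta> * \<phi> \<theta>) \<partial>circ)"
      unfolding distrib_right
      by (subst Bochner_Integration.integral_add[OF integrable_mult_Cinf[OF ib(2) \<phi>]
            integrable_mult_Cinf[OF ib(3) \<phi>]]) (simp add: mult_ac)
    ultimately show ?thesis by simp
  qed
  moreover have "periodic (\<lambda>\<theta>. b \<theta> * f \<theta>)" "periodic (\<lambda>\<theta>. ddt b \<theta> * f \<theta> + b \<theta> * g \<theta>)"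
    using f Cinf_periodic[OF b] Cinf_periodic[OF ddt_Cinf[OF b]] by (auto simp: has_weak_derivative_iff periodic_def)
  ultimately show ?thesis using ib by (simp add: has_weak_derivative_iff)
qed

lemma has_weak_derivative_diff:
  assumes "has_weak_derivative f f'" "has_weak_derivative g g'"
  shows "has_weak_derivative (\<lambda>\<theta>. f \<theta> - g \<theta>) (\<lambda>\<theta>. f' \<theta> - g' \<theta>)"
  using has_weak_derivative_add[OF assms(1) has_weak_derivative_mult[OF assms(2) const_Cinf[of "-1"]]] by simp

lemma has_weak_derivative_sum:
  "finite I \<Longrightarrow> (\<And>i. i \<in> I \<Longrightarrow> has_weak_derivative (f i) (f' i)) \<Longrightarrow>
    has_weak_derivative (\<lambda>\<theta>. \<Sum>i\<in>I. f i \<theta>) (\<lambda>\<theta>. \<Sum>i\<in>I. f' i \<theta>)"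
proof (induction I rule: finite_induct)
  case empty
  then show ?case using has_weak_derivative_Cinf[OF const_Cinf[of 0]] by simp
next
  case (insert i I)
  then show ?case by (simp add: has_weak_derivative_add)
qed

text \<open>\<open>weak_ddt\<close> is a choice, so it can be identified only up to null sets. The
  input too may differ from f on a null set, which is what iterating the operator requires.\<close>

lemma weak_ddt_AE_eq:
  assumes f: "has_weak_derivative f g" and eq: "AE \<theta> in circ. f' \<theta> = f \<theta>"
    and f': "periodic f'" "f' \<in> borel_measurable circ"
  shows "has_weak_derivative f' (weak_ddt f')" and "AE \<theta> in circ. weak_ddt f' \<theta> = g \<theta>"
proof -
  have [measurable]: "f \<in> borel_measurable circ" "f' \<in> borel_measurable circ" using f f' by (auto simp: has_weak_derivative_iff)
  have "integrable circ f'"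
    using f eq by (subst integrable_cong_AE[of _ _ f]) (auto simp: has_weak_derivative_iff)
  moreover have "(\<integral>\<theta>. f' \<theta> * ddt \<phi> \<theta> \<partial>circ) = (\<integral>\<theta>. f \<theta> * ddt \<phi> \<theta> \<partial>circ)" if "\<phi> \<in> Cinf" for \<phi>
  proof -
    have [measurable]: "ddt \<phi> \<in> borel_measurable circ" using that by (intro Cinf_circ ddt_Cinf)
    show ?thesis using eq by (intro integral_cong_AE) (auto elim: eventually_mono)
  qed
  ultimately have "has_weak_derivative f' g" using f f' by (simp add: has_weak_derivative_iff)
  then show w: "has_weak_derivative f' (weak_ddt f')" unfolding weak_ddt_def by (rule someI[of "has_weak_derivative f'"])
  have i: "integrable circ g" "integrable circ (weak_ddt f')"
    using f w by (auto simp: has_weak_derivative_iff)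
  have "AE \<theta> in circ. weak_ddt f' \<theta> - g \<theta> = 0"
  proof (rule fundamental_lemma_variations)
    fix \<phi> :: "real \<Rightarrow> real" assume \<phi>: "\<phi> \<in> Cinf"
    have "(\<integral>\<theta>. weak_ddt f' \<theta> * \<phi> \<theta> \<partial>circ) = (\<integral>\<theta>. g \<theta> * \<phi> \<theta> \<partial>circ)"
      using \<open>has_weak_derivative f' g\<close> w \<phi> by (auto simp: has_weak_derivative_iff)
    then show "(\<integral>\<theta>. (weak_ddt f' \<theta> - g \<theta>) * \<phi> \<theta> \<partial>circ) = 0"
      using i \<phi> unfolding left_diff_distrib
      by (subst Bochner_Integration.integral_diff) (auto intro!: integrable_mult_Cinf)
  qed (use i in auto)
  then show "AE \<theta> in circ. weak_ddt f' \<theta> = g \<theta>" by simp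
qed

subsection \<open>Density in Sobolev spaces\<close>

lemma L2_tendsto_inner:
  assumes f: "square_integrable f" and q: "\<And>m::nat. square_integrable (q m)" and g: "square_integrable g"
    and lim: "(\<lambda>m. \<integral>\<theta>. (f \<theta> - q m \<theta>)\<^sup>2 \<partial>circ) \<longlonglongrightarrow> 0"
  shows "(\<lambda>m. \<integral>\<theta>. q m \<theta> * g \<theta> \<partial>circ) \<longlonglongrightarrow> (\<integral>\<theta>. f \<theta> * g \<theta> \<partial>circ)"
proof -
  have bound: "\<bar>(\<integral>\<theta>. q m \<theta> * g \<theta> \<partial>circ) - (\<integral>\<theta>. f \<theta> * g \<theta> \<partial>circ)\<bar> \<le>
      sqrt ((\<integral>\<theta>. (f \<theta> - q m \<theta>)\<^sup>2 \<partial>circ) * (\<integral>\<theta>. (g \<theta>)\<^sup>2 \<partial>circ))" for m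
  proof -
    have "(\<integral>\<theta>. (f \<theta> - q m \<theta>) * g \<theta> \<partial>circ) = (\<integral>\<theta>. f \<theta> * g \<theta> \<partial>circ) - (\<integral>\<theta>. q m \<theta> * g \<theta> \<partial>circ)"
      unfolding left_diff_distrib
      by (intro Bochner_Integration.integral_diff square_integrable_mult f q g)
    moreover have "\<bar>\<integral>\<theta>. (f \<theta> - q m \<theta>) * g \<theta> \<partial>circ\<bar>\<^sup>2 \<le>
        (\<integral>\<theta>. (f \<theta> - q m \<theta>)\<^sup>2 \<partial>circ) * (\<integral>\<theta>. (g \<theta>)\<^sup>2 \<partial>circ)"
      unfolding power2_abs using square_integrable_diff[OF f q] g
      by (intro Cauchy_Schwarz_integral) (auto simp: square_integrable_def)
    note real_le_rsqrt[OF this]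
    ultimately show ?thesis by (simp only: abs_minus_commute)
  qed
  have "(\<lambda>m. sqrt ((\<integral>\<theta>. (f \<theta> - q m \<theta>)\<^sup>2 \<partial>circ) * (\<integral>\<theta>. (g \<theta>)\<^sup>2 \<partial>circ))) \<longlonglongrightarrow>
      sqrt (0 * (\<integral>\<theta>. (g \<theta>)\<^sup>2 \<partial>circ))"
    by (intro tendsto_intros lim)
  then have "(\<lambda>m. sqrt ((\<integral>\<theta>. (f \<theta> - q m \<theta>)\<^sup>2 \<partial>circ) * (\<integral>\<theta>. (g \<theta>)\<^sup>2 \<partial>circ))) \<longlonglongrightarrow> 0"
    by simp
  then have "(\<lambda>m. (\<integral>\<theta>. q m \<theta> * g \<theta> \<partial>circ) - (\<integral>\<theta>. f \<theta> * g \<theta> \<partial>circ)) \<longlonglongrightarrow> 0"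
  proof (rule tendsto_0_le[where K = 1])
    show "eventually (\<lambda>m. norm ((\<integral>\<theta>. q m \<theta> * g \<theta> \<partial>circ) - (\<integral>\<theta>. f \<theta> * g \<theta> \<partial>circ)) \<le>
        norm (sqrt ((\<integral>\<theta>. (f \<theta> - q m \<theta>)\<^sup>2 \<partial>circ) * (\<integral>\<theta>. (g \<theta>)\<^sup>2 \<partial>circ))) * 1) sequentially"
    proof (rule always_eventually, rule allI)
      fix m
      have "x \<le> norm x * 1" for x :: real by simp
      then show "norm ((\<integral>\<theta>. q m \<theta> * g \<theta> \<partial>circ) - (\<integral>\<theta>. f \<theta> * g \<theta> \<partial>circ)) \<le>
        norm (sqrt ((\<integral>\<theta>. (f \<theta> - q m \<theta>)\<^sup>2 \<partial>circ) * (\<integral>\<theta>. (g \<theta>)\<^sup>2 \<partial>circ))) * 1"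
        using bound[of m] unfolding real_norm_def by (rule order_trans[rotated])
    qed
  qed
  then show ?thesis by (simp add: LIM_zero_iff)
qed

text \<open>Writing q^2 = (f - q)^2 + 2 q f - f^2 reduces the claim to convergence of the error and
  of a pairing with a fixed function.\<close>

lemma L2_tendsto_weighted_square:
  assumes f: "square_integrable f" and q: "\<And>m::nat. square_integrable (q m)" and a: "a \<in> Cinf"
    and lim: "(\<lambda>m. \<integral>\<theta>. (f \<theta> - q m \<theta>)\<^sup>2 \<partial>circ) \<longlonglongrightarrow> 0"
  shows "(\<lambda>m. \<integral>\<theta>. (q m \<theta>)\<^sup>2 * a \<theta> \<partial>circ) \<longlonglongrightarrow> (\<integral>\<theta>. (f \<theta>)\<^sup>2 * a \<theta> \<partial>circ)"
proof -
  have af: "square_integrable (\<lambda>\<theta>. a \<theta> * f \<theta>)" by (rule square_integrable_Cinf_mult[OF f a])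
  have i: "integrable circ (\<lambda>\<theta>. (f \<theta>)\<^sup>2 * a \<theta>)" "integrable circ (\<lambda>\<theta>. q m \<theta> * (a \<theta> * f \<theta>))"
    "integrable circ (\<lambda>\<theta>. (f \<theta> - q m \<theta>)\<^sup>2 * a \<theta>)" "integrable circ (\<lambda>\<theta>. (f \<theta> - q m \<theta>)\<^sup>2)" for m
    using f square_integrable_diff[OF f q, of m] square_integrable_mult[OF q af, of m]
    by (auto simp: square_integrable_def intro!: integrable_mult_Cinf a)
  obtain K where K: "0 < K" "\<And>\<theta>. norm (a \<theta>) \<le> K" using Cinf_bounded[OF a] by blast
  have "(\<lambda>m. \<integral>\<theta>. (f \<theta> - q m \<theta>)\<^sup>2 * a \<theta> \<partial>circ) \<longlonglongrightarrow> 0"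
  proof (rule tendsto_0_le[OF lim, where K = K])
    show "eventually (\<lambda>m. norm (\<integral>\<theta>. (f \<theta> - q m \<theta>)\<^sup>2 * a \<theta> \<partial>circ) \<le> norm (\<integral>\<theta>. (f \<theta> - q m \<theta>)\<^sup>2 \<partial>circ) * K) sequentially"
    proof (rule always_eventually, rule allI)
      fix m
      have "norm (\<integral>\<theta>. (f \<theta> - q m \<theta>)\<^sup>2 * a \<theta> \<partial>circ) \<le> (\<integral>\<theta>. norm ((f \<theta> - q m \<theta>)\<^sup>2 * a \<theta>) \<partial>circ)"
        by (rule integral_norm_bound)
      also have "\<dots> \<le> (\<integral>\<theta>. (f \<theta> - q m \<theta>)\<^sup>2 * K \<partial>circ)"
        using i(3,4)[of m] K(2) by (intro integral_mono integrable_norm) (auto simp: abs_mult intro!: mult_left_mono)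
      finally show "norm (\<integral>\<theta>. (f \<theta> - q m \<theta>)\<^sup>2 * a \<theta> \<partial>circ) \<le> norm (\<integral>\<theta>. (f \<theta> - q m \<theta>)\<^sup>2 \<partial>circ) * K"
        by simp
    qed
  qed
  moreover have "(\<lambda>m. \<integral>\<theta>. q m \<theta> * (a \<theta> * f \<theta>) \<partial>circ) \<longlonglongrightarrow> (\<integral>\<theta>. f \<theta> * (a \<theta> * f \<theta>) \<partial>circ)"
    by (rule L2_tendsto_inner[OF f q af lim])
  ultimately have "(\<lambda>m. (\<integral>\<theta>. (f \<theta> - q m \<theta>)\<^sup>2 * a \<theta> \<partial>circ) + 2 * (\<integral>\<theta>. q m \<theta> * (a \<theta> * f \<theta>) \<partial>circ) - (\<integral>\<theta>. (f \<theta>)\<^sup>2 * a \<theta> \<partial>circ))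
      \<longlonglongrightarrow> 0 + 2 * (\<integral>\<theta>. f \<theta> * (a \<theta> * f \<theta>) \<partial>circ) - (\<integral>\<theta>. (f \<theta>)\<^sup>2 * a \<theta> \<partial>circ)"
    by (intro tendsto_intros)
  moreover have "(\<integral>\<theta>. (f \<theta> - q m \<theta>)\<^sup>2 * a \<theta> \<partial>circ) + 2 * (\<integral>\<theta>. q m \<theta> * (a \<theta> * f \<theta>) \<partial>circ) - (\<integral>\<theta>. (f \<theta>)\<^sup>2 * a \<theta> \<partial>circ)
      = (\<integral>\<theta>. (q m \<theta>)\<^sup>2 * a \<theta> \<partial>circ)" for m
  proof -
    have "(\<integral>\<theta>. (f \<theta> - q m \<theta>)\<^sup>2 * a \<theta> \<partial>circ) + 2 * (\<integral>\<theta>. q m \<theta> * (a \<theta> * f \<theta>) \<partial>circ) - (\<integral>\<theta>. (f \<theta>)\<^sup>2 * a \<theta> \<partial>circ)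
      = (\<integral>\<theta>. (f \<theta> - q m \<theta>)\<^sup>2 * a \<theta> + 2 * (q m \<theta> * (a \<theta> * f \<theta>)) - (f \<theta>)\<^sup>2 * a \<theta> \<partial>circ)"
      using i(1) i(2)[of m] i(3)[of m] by simp
    also have "\<dots> = (\<integral>\<theta>. (q m \<theta>)\<^sup>2 * a \<theta> \<partial>circ)"
      by (intro Bochner_Integration.integral_cong refl) (simp add: power2_eq_square algebra_simps)
    finally show ?thesis .
  qed
  moreover have "(\<integral>\<theta>. f \<theta> * (a \<theta> * f \<theta>) \<partial>circ) = (\<integral>\<theta>. (f \<theta>)\<^sup>2 * a \<theta> \<partial>circ)"
    by (intro Bochner_Integration.integral_cong refl) (simp add: power2_eq_square)
  ultimately show ?thesis by simp
qed

lemma L2_tendsto_square: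
  assumes "square_integrable f" "\<And>m::nat. square_integrable (q m)"
    "(\<lambda>m. \<integral>\<theta>. (f \<theta> - q m \<theta>)\<^sup>2 \<partial>circ) \<longlonglongrightarrow> 0"
  shows "(\<lambda>m. \<integral>\<theta>. (q m \<theta>)\<^sup>2 \<partial>circ) \<longlonglongrightarrow> (\<integral>\<theta>. (f \<theta>)\<^sup>2 \<partial>circ)"
  using L2_tendsto_weighted_square[OF assms(1,2) const_Cinf assms(3), of 1] by simp

text \<open>
  By duality: pairing \<open>r\<close> with a smooth \<open>\<psi>\<close> of mean zero moves the derivative onto the
  antiderivative of \<open>\<psi>\<close>, and \<open>\<psi>\<close> is then chosen close to \<open>r\<close>.
\<close>

lemma Poincare_weak:
  assumes r: "square_integrable r" and s: "square_integrable s"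
    and w: "has_weak_derivative r s" and 0: "(\<integral>\<theta>. r \<theta> \<partial>circ) = 0"
  shows "(\<integral>\<theta>. (r \<theta>)\<^sup>2 \<partial>circ) \<le> (2 * pi)\<^sup>2 * (\<integral>\<theta>. (s \<theta>)\<^sup>2 \<partial>circ)"
proof -
  let ?R = "\<integral>\<theta>. (r \<theta>)\<^sup>2 \<partial>circ" and ?S = "\<integral>\<theta>. (s \<theta>)\<^sup>2 \<partial>circ"
  have dual: "(\<integral>\<theta>. \<psi> \<theta> * r \<theta> \<partial>circ)\<^sup>2 \<le> ?S * ((2 * pi)\<^sup>2 * (\<integral>\<theta>. (\<psi> \<theta>)\<^sup>2 \<partial>circ))" if \<psi>: "\<psi> \<in> Cinf" for \<psi>
  proof -
    define \<mu> where "\<mu> = (\<integral>\<theta>. \<psi> \<theta> \<partial>circ) / (2 * pi)"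
    define \<psi>0 where "\<psi>0 = (\<lambda>\<theta>. \<psi> \<theta> - \<mu>)"
    have \<psi>0: "\<psi>0 \<in> Cinf" unfolding \<psi>0_def by (intro diff_Cinf \<psi> const_Cinf)
    have i: "integrable circ (\<lambda>\<theta>. \<mu>)" by (rule Cinf_circ(2)[OF const_Cinf])
    have "(\<integral>\<theta>. \<psi>0 \<theta> \<partial>circ) = (\<integral>\<theta>. \<psi> \<theta> \<partial>circ) - (\<integral>\<theta>. \<mu> \<partial>circ)"
      unfolding \<psi>0_def by (intro Bochner_Integration.integral_diff Cinf_circ \<psi> i)
    also have "\<dots> = 0" by (simp only: integral_circ_const) (simp add: \<mu>_def)
    finally have "(\<integral>\<theta>. \<psi>0 \<theta> \<partial>circ) = 0" .
    then obtain \<phi> where \<phi>: "\<phi> \<in> Cinf" "ddt \<phi> = \<psi>0" "\<And>\<theta>. \<bar>\<phi> \<theta>\<bar> \<le> (\<integral>\<theta>. \<bar>\<psi>0 \<theta>\<bar> \<partial>circ)"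
      using antiderivative_Cinf[OF \<psi>0] by blast
    let ?I = "\<integral>\<theta>. \<bar>\<psi>0 \<theta>\<bar> \<partial>circ"
    \<comment> \<open>Because r has mean zero, the mean of \<psi> does not affect the
      pairing.\<close>
    have "(\<integral>\<theta>. \<psi> \<theta> * r \<theta> \<partial>circ) = (\<integral>\<theta>. r \<theta> * \<psi>0 \<theta> + \<mu> * r \<theta> \<partial>circ)"
      by (intro Bochner_Integration.integral_cong refl) (simp add: \<psi>0_def algebra_simps)
    also have "\<dots> = (\<integral>\<theta>. r \<theta> * \<psi>0 \<theta> \<partial>circ) + (\<integral>\<theta>. \<mu> * r \<theta> \<partial>circ)"
      using square_integrable_integrable[OF r] integrable_mult_Cinf[OF square_integrable_integrable[OF r] \<psi>0]
      by simp
    also have "\<dots> = - (\<integral>\<theta>. s \<theta> * \<phi> \<theta> \<partial>circ)"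
      using w \<phi>(1,2) 0 by (auto simp: has_weak_derivative_iff)
    finally have "(\<integral>\<theta>. \<psi> \<theta> * r \<theta> \<partial>circ)\<^sup>2 = (\<integral>\<theta>. s \<theta> * \<phi> \<theta> \<partial>circ)\<^sup>2" by simp
    also have "\<dots> \<le> ?S * (\<integral>\<theta>. (\<phi> \<theta>)\<^sup>2 \<partial>circ)"
      using s square_integrable_Cinf[OF \<phi>(1)]
      by (intro Cauchy_Schwarz_integral) (auto simp: square_integrable_def)
    also have "\<dots> \<le> ?S * ((2 * pi)\<^sup>2 * (\<integral>\<theta>. (\<psi> \<theta>)\<^sup>2 \<partial>circ))"
    proof (intro mult_left_mono)
      \<comment> \<open>One factor 2 pi arises from integrating the pointwise bound on \<phi>, the
        other from Cauchy-Schwarz for the integral of |\<psi>0|.\<close>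
      have "(\<integral>\<theta>. (\<phi> \<theta>)\<^sup>2 \<partial>circ) \<le> (\<integral>\<theta>. ?I\<^sup>2 \<partial>circ)"
      proof (rule integral_mono)
        show "integrable circ (\<lambda>\<theta>. (\<phi> \<theta>)\<^sup>2)" using square_integrable_Cinf[OF \<phi>(1)] by (simp add: square_integrable_def)
        show "integrable circ (\<lambda>\<theta>. ?I\<^sup>2)" by (rule Cinf_circ(2)[OF const_Cinf])
        show "(\<phi> \<theta>)\<^sup>2 \<le> ?I\<^sup>2" for \<theta> using power_mono[OF \<phi>(3), of \<theta> 2] by simp
      qed
      also have "\<dots> = 2 * pi * ?I\<^sup>2" by (rule integral_circ_const)
      also have "?I\<^sup>2 \<le> 2 * pi * (\<integral>\<theta>. (\<psi>0 \<theta>)\<^sup>2 \<partial>circ)"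
      proof -
        have "(\<integral>\<theta>. 1 * \<bar>\<psi>0 \<theta>\<bar> \<partial>circ)\<^sup>2 \<le> (\<integral>\<theta>. 1\<^sup>2 \<partial>circ) * (\<integral>\<theta>. \<bar>\<psi>0 \<theta>\<bar>\<^sup>2 \<partial>circ)"
          using square_integrable_Cinf[OF const_Cinf[of 1]] square_integrable_Cinf[OF \<psi>0]
          by (intro Cauchy_Schwarz_integral) (auto simp: square_integrable_def)
        then show ?thesis by simp
      qed
      also have "(\<integral>\<theta>. (\<psi>0 \<theta>)\<^sup>2 \<partial>circ) \<le> (\<integral>\<theta>. (\<psi> \<theta>)\<^sup>2 \<partial>circ)"
      proof -
        have i2: "integrable circ (\<lambda>\<theta>. (\<psi> \<theta>)\<^sup>2)" using square_integrable_Cinf[OF \<psi>] by (simp add: square_integrable_def)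
        have "(\<integral>\<theta>. (\<psi>0 \<theta>)\<^sup>2 \<partial>circ) = (\<integral>\<theta>. (\<psi> \<theta>)\<^sup>2 - 2 * \<mu> * \<psi> \<theta> + \<mu>\<^sup>2 \<partial>circ)"
          by (intro Bochner_Integration.integral_cong refl) (simp add: \<psi>0_def power2_eq_square algebra_simps)
        also have "\<dots> = (\<integral>\<theta>. (\<psi> \<theta>)\<^sup>2 \<partial>circ) - 2 * \<mu> * (\<integral>\<theta>. \<psi> \<theta> \<partial>circ) + 2 * pi * \<mu>\<^sup>2"
          using i2 Cinf_circ(2)[OF \<psi>] Cinf_circ(2)[OF const_Cinf[of "\<mu>\<^sup>2"]] by simp
        also have "\<dots> = (\<integral>\<theta>. (\<psi> \<theta>)\<^sup>2 \<partial>circ) - 2 * pi * \<mu>\<^sup>2" by (simp add: \<mu>_def power2_eq_square field_simps)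
        also have "\<dots> \<le> (\<integral>\<theta>. (\<psi> \<theta>)\<^sup>2 \<partial>circ)" by simp
        finally show ?thesis .
      qed
      finally show "(\<integral>\<theta>. (\<phi> \<theta>)\<^sup>2 \<partial>circ) \<le> (2 * pi)\<^sup>2 * (\<integral>\<theta>. (\<psi> \<theta>)\<^sup>2 \<partial>circ)"
        by (simp add: power2_eq_square mult.assoc)
    qed simp
    finally show ?thesis .
  qed
  obtain q where q: "\<And>m::nat. q m \<in> Cinf" and lim: "(\<lambda>m. \<integral>\<theta>. (r \<theta> - q m \<theta>)\<^sup>2 \<partial>circ) \<longlonglongrightarrow> 0"
    using L2_approximation[OF r] by blast
  have qs: "square_integrable (q m)" for m by (rule square_integrable_Cinf[OF q])
  have 1: "(\<lambda>m. (\<integral>\<theta>. q m \<theta> * r \<theta> \<partial>circ)\<^sup>2) \<longlonglongrightarrow> (\<integral>\<theta>. r \<theta> * r \<theta> \<partial>circ)\<^sup>2"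
    by (intro tendsto_power L2_tendsto_inner[OF r qs r lim])
  have 2: "(\<lambda>m. ?S * ((2 * pi)\<^sup>2 * (\<integral>\<theta>. (q m \<theta>)\<^sup>2 \<partial>circ))) \<longlonglongrightarrow> ?S * ((2 * pi)\<^sup>2 * ?R)"
    by (intro tendsto_intros L2_tendsto_square[OF r qs lim])
  have "?R\<^sup>2 \<le> ?S * ((2 * pi)\<^sup>2 * ?R)"
    using LIMSEQ_le[OF 1 2] dual[OF q] by (simp add: power2_eq_square)
  moreover have "0 \<le> ?R" "0 \<le> ?S" by simp_all
  ultimately show ?thesis
  proof (cases "?R = 0")
    case False
    then have "0 < ?R" using \<open>0 \<le> ?R\<close> by linarith
    have "?R * ?R \<le> ((2 * pi)\<^sup>2 * ?S) * ?R"
      using \<open>?R\<^sup>2 \<le> ?S * ((2 * pi)\<^sup>2 * ?R)\<close> unfolding power2_eq_square[of ?R] by (simp only: mult_ac)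
    then show ?thesis using \<open>0 < ?R\<close> by (simp only: mult_le_cancel_right_pos)
  qed simp
qed

text \<open>The approximants are built from the top of the chain and integrated downwards. A
  periodic antiderivative requires mean zero, so the means are subtracted first; they tend to zero.
  In order zero convergence comes from the Poincare inequality.\<close>

lemma weak_derivative_chain_approximation:
  assumes "\<And>k. k \<le> n \<Longrightarrow> square_integrable (x k)"
    and "\<And>k. k < n \<Longrightarrow> has_weak_derivative (x k) (x (Suc k))"
  shows "\<exists>p. (\<forall>m::nat. p m \<in> Cinf) \<and>
    (\<forall>k\<le>n. (\<lambda>m. \<integral>\<theta>. (x k \<theta> - (ddt ^^ k) (p m) \<theta>)\<^sup>2 \<partial>circ) \<longlonglongrightarrow> 0)"
  using assms
proof (induction n arbitrary: x)
  case 0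
  obtain q where "\<And>m::nat. q m \<in> Cinf" "(\<lambda>m. \<integral>\<theta>. (x 0 \<theta> - q m \<theta>)\<^sup>2 \<partial>circ) \<longlonglongrightarrow> 0"
    using L2_approximation[OF 0(1)[of 0]] by blast
  then show ?case by (intro exI[of _ q]) simp
next
  case (Suc n)
  have x: "square_integrable (x k)" if "k \<le> Suc n" for k using Suc.prems(1) that .
  have x0: "square_integrable (x 0)" "square_integrable (x 1)" using x by auto
  have w: "has_weak_derivative (x 0) (x 1)" using Suc.prems(2)[of 0] by simp
  obtain q where q: "\<And>m::nat. q m \<in> Cinf"
    and lim: "\<And>k. k \<le> n \<Longrightarrow> (\<lambda>m. \<integral>\<theta>. (x (Suc k) \<theta> - (ddt ^^ k) (q m) \<theta>)\<^sup>2 \<partial>circ) \<longlonglongrightarrow> 0"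
    using Suc.IH[of "\<lambda>k. x (Suc k)"] Suc.prems by auto
  have qs: "square_integrable (q m)" for m by (rule square_integrable_Cinf[OF q])
  have lim0: "(\<lambda>m. \<integral>\<theta>. (x 1 \<theta> - q m \<theta>)\<^sup>2 \<partial>circ) \<longlonglongrightarrow> 0" using lim[of 0] by simp
  define \<mu> where "\<mu> = (\<lambda>m. (\<integral>\<theta>. q m \<theta> \<partial>circ) / (2 * pi))"
  \<comment> \<open>A weak derivative on the circle has mean zero, as the constant test function
    shows.\<close>
  have "(\<integral>\<theta>. x 1 \<theta> \<partial>circ) = 0"
    using w const_Cinf[of "1::real"] unfolding has_weak_derivative_iff by fastforce
  then have "\<mu> \<longlonglongrightarrow> 0 / (2 * pi)"
    unfolding \<mu>_def
    using L2_tendsto_inner[OF x0(2) qs square_integrable_Cinf[OF const_Cinf[of 1]] lim0]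
    by (intro tendsto_divide tendsto_const) auto
  then have \<mu>0: "\<mu> \<longlonglongrightarrow> 0" by simp
  define q0 where "q0 = (\<lambda>m \<theta>. q m \<theta> - \<mu> m)"
  have q0: "q0 m \<in> Cinf" for m unfolding q0_def by (intro diff_Cinf q const_Cinf)
  have "(\<integral>\<theta>. q0 m \<theta> \<partial>circ) = 0" for m
  proof -
    have "(\<integral>\<theta>. q0 m \<theta> \<partial>circ) = (\<integral>\<theta>. q m \<theta> \<partial>circ) - (\<integral>\<theta>. \<mu> m \<partial>circ)"
      unfolding q0_def by (intro Bochner_Integration.integral_diff Cinf_circ q const_Cinf)
    also have "\<dots> = 0" by (simp only: integral_circ_const) (simp add: \<mu>_def)
    finally show ?thesis .
  qed
  then have "\<exists>P. P \<in> Cinf \<and> ddt P = q0 m" for m using antiderivative_Cinf[OF q0] by metis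
  then obtain P where P: "\<And>m. P m \<in> Cinf" "\<And>m. ddt (P m) = q0 m" by metis
  \<comment> \<open>The constant of integration is chosen so that \<open>x 0 - p m\<close> has mean
    zero, as the Poincare inequality demands.\<close>
  define \<nu> where "\<nu> = (\<lambda>m. (\<integral>\<theta>. x 0 \<theta> - P m \<theta> \<partial>circ) / (2 * pi))"
  define p where "p = (\<lambda>m \<theta>. P m \<theta> + \<nu> m)"
  have p: "p m \<in> Cinf" for m unfolding p_def by (intro add_Cinf P const_Cinf)
  have dp: "ddt (p m) = q0 m" for m unfolding p_def by (simp add: ddt_add P)
  have mean: "(\<integral>\<theta>. x 0 \<theta> - p m \<theta> \<partial>circ) = 0" for m
  proof -
    have "(\<integral>\<theta>. x 0 \<theta> - p m \<theta> \<partial>circ) = (\<integral>\<theta>. (x 0 \<theta> - P m \<theta>) - \<nu> m \<partial>circ)" by (simp add: p_def algebra_simps)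
    also have "\<dots> = (\<integral>\<theta>. x 0 \<theta> - P m \<theta> \<partial>circ) - (\<integral>\<theta>. \<nu> m \<partial>circ)"
      by (intro Bochner_Integration.integral_diff Bochner_Integration.integrable_diff
          square_integrable_integrable[OF x0(1)] Cinf_circ P const_Cinf)
    also have "\<dots> = 0" by (simp only: integral_circ_const) (simp add: \<nu>_def)
    finally show ?thesis .
  qed
  have q0s: "square_integrable (q0 m)" for m by (rule square_integrable_Cinf[OF q0])
  have lim1: "(\<lambda>m. \<integral>\<theta>. (x 1 \<theta> - q0 m \<theta>)\<^sup>2 \<partial>circ) \<longlonglongrightarrow> 0"
  proof (rule tendsto_sandwich[OF _ _ tendsto_const])
    show "eventually (\<lambda>m. (\<integral>\<theta>. (x 1 \<theta> - q0 m \<theta>)\<^sup>2 \<partial>circ) \<le>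
      2 * (\<integral>\<theta>. (x 1 \<theta> - q m \<theta>)\<^sup>2 \<partial>circ) + 2 * (2 * pi * (\<mu> m)\<^sup>2)) sequentially"
    proof (rule always_eventually, rule allI)
      fix m
      have "(\<integral>\<theta>. (q m \<theta> - q0 m \<theta>)\<^sup>2 \<partial>circ) = 2 * pi * (\<mu> m)\<^sup>2" by (simp add: q0_def)
      then show "(\<integral>\<theta>. (x 1 \<theta> - q0 m \<theta>)\<^sup>2 \<partial>circ) \<le>
          2 * (\<integral>\<theta>. (x 1 \<theta> - q m \<theta>)\<^sup>2 \<partial>circ) + 2 * (2 * pi * (\<mu> m)\<^sup>2)"
        using L2_diff_le[OF x0(2) qs q0s, of m m] by simp
    qed
    have "(\<lambda>m. 2 * (\<integral>\<theta>. (x 1 \<theta> - q m \<theta>)\<^sup>2 \<partial>circ) + 2 * (2 * pi * (\<mu> m)\<^sup>2)) \<longlonglongrightarrow> 2 * 0 + 2 * (2 * pi * 0\<^sup>2)"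
      by (intro tendsto_intros lim0 \<mu>0)
    then show "(\<lambda>m. 2 * (\<integral>\<theta>. (x 1 \<theta> - q m \<theta>)\<^sup>2 \<partial>circ) + 2 * (2 * pi * (\<mu> m)\<^sup>2)) \<longlonglongrightarrow> 0" by simp
  qed simp
  have "(\<lambda>m. \<integral>\<theta>. (x k \<theta> - (ddt ^^ k) (p m) \<theta>)\<^sup>2 \<partial>circ) \<longlonglongrightarrow> 0" if k: "k \<le> Suc n" for k
  proof -
    consider "k = 0" | "k = 1" | j where "k = Suc (Suc j)" by (metis One_nat_def not0_implies_Suc)
    then show ?thesis
    proof cases
      case 1
      have "(\<lambda>m. \<integral>\<theta>. (x 0 \<theta> - p m \<theta>)\<^sup>2 \<partial>circ) \<longlonglongrightarrow> 0"
      proof (rule tendsto_sandwich[OF _ _ tendsto_const])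
        show "eventually (\<lambda>m. (\<integral>\<theta>. (x 0 \<theta> - p m \<theta>)\<^sup>2 \<partial>circ) \<le>
            (2 * pi)\<^sup>2 * (\<integral>\<theta>. (x 1 \<theta> - q0 m \<theta>)\<^sup>2 \<partial>circ)) sequentially"
          by (intro always_eventually allI Poincare_weak square_integrable_diff x0 q0s
              square_integrable_Cinf[OF p] mean has_weak_derivative_diff w)
            (use has_weak_derivative_Cinf[OF p] dp in simp)
        have "(\<lambda>m. (2 * pi)\<^sup>2 * (\<integral>\<theta>. (x 1 \<theta> - q0 m \<theta>)\<^sup>2 \<partial>circ)) \<longlonglongrightarrow> (2 * pi)\<^sup>2 * 0"
          by (intro tendsto_intros lim1)
        then show "(\<lambda>m. (2 * pi)\<^sup>2 * (\<integral>\<theta>. (x 1 \<theta> - q0 m \<theta>)\<^sup>2 \<partial>circ)) \<longlonglongrightarrow> 0" by simp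
      qed simp
      then show ?thesis using 1 by simp
    next
      case 2
      then show ?thesis using lim1 by (simp add: dp)
    next
      case 3
      have "ddt (q0 m) = ddt (q m)" for m unfolding q0_def by (simp add: ddt_diff q)
      then have "(ddt ^^ k) (p m) = (ddt ^^ Suc j) (q m)" for m
        unfolding 3 by (simp add: funpow_Suc_right dp del: funpow.simps)
      then show ?thesis using lim[of "Suc j"] k 3 by simp
    qed
  qed
  then show ?case using p by blast
qed

subsection \<open>Arc length derivatives of Sobolev functions\<close>

lemma L2_circle_square_integrable: "f \<in> L2_circle \<Longrightarrow> square_integrable f"
  unfolding L2_circle_def square_integrable_def set_integrable_circ
  by (auto intro: measurable_restrict_space1)

text \<open>The coefficients are those of the smooth case with \<delta> = 1. Each step picks a new
  representative, so the expansion holds almost everywhere, and periodicity and measurability are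
  carried along because the next weak derivative needs them.\<close>

lemma arc_deriv_weak_expand:
  fixes c :: "real \<Rightarrow> 'a::real_inner" and h :: "real \<Rightarrow> real"
  assumes c: "c \<in> Imm" and h: "h \<in> Sobolev n" and k: "k \<le> n"
  shows "periodic ((arc_deriv weak_ddt c ^^ k) h) \<and> (arc_deriv weak_ddt c ^^ k) h \<in> borel_measurable circ \<and>
    (AE \<theta> in circ. (arc_deriv weak_ddt c ^^ k) h \<theta> =
      (\<Sum>j\<le>k. coef (\<lambda>\<theta>. inverse (speed c \<theta>)) (\<lambda>\<theta>. inverse (speed c \<theta>)) k j \<theta> * (weak_ddt ^^ j) h \<theta>))"
  using k
proof (induction k)
  case 0
  have "h \<in> L2_circle" using h by (auto simp: Sobolev_def)
  then have "periodic h" "h \<in> borel_measurable circ"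
    using L2_circle_square_integrable by (auto simp: L2_circle_def square_integrable_def)
  then show ?case by simp
next
  case (Suc k)
  let ?b = "\<lambda>\<theta>. inverse (speed c \<theta>)" and ?x = "\<lambda>j::nat. (weak_ddt ^^ j) h" and ?H = "\<lambda>k::nat. (arc_deriv weak_ddt c ^^ k) h"
  let ?q = "coef ?b ?b"
  have b: "?b \<in> Cinf" by (rule inverse_speed_Cinf(1)[OF c])
  have q: "?q i j \<in> Cinf" for i j by (rule coef_Cinf[OF b b])
  have w: "has_weak_derivative (?x j) (?x (Suc j))" if "j \<le> k" for j
    using h Suc.prems that by (auto simp: Sobolev_def)
  have "has_weak_derivative (\<lambda>\<theta>. \<Sum>j\<le>k. ?q k j \<theta> * ?x j \<theta>)
      (\<lambda>\<theta>. \<Sum>j\<le>k. ddt (?q k j) \<theta> * ?x j \<theta> + ?q k j \<theta> * ?x (Suc j) \<theta>)"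
    by (intro has_weak_derivative_sum has_weak_derivative_mult w q) auto
  moreover have IH: "periodic (?H k)" "?H k \<in> borel_measurable circ"
    "AE \<theta> in circ. ?H k \<theta> = (\<Sum>j\<le>k. ?q k j \<theta> * ?x j \<theta>)"
    using Suc by auto
  ultimately have w': "has_weak_derivative (?H k) (weak_ddt (?H k))"
    and ae: "AE \<theta> in circ. weak_ddt (?H k) \<theta> = (\<Sum>j\<le>k. ddt (?q k j) \<theta> * ?x j \<theta> + ?q k j \<theta> * ?x (Suc j) \<theta>)"
    using weak_ddt_AE_eq[OF _ IH(3,1,2)] by blast+
  have H: "?H (Suc k) = (\<lambda>\<theta>. ?b \<theta> * weak_ddt (?H k) \<theta>)"
    by (simp add: arc_deriv_def speed_def)
  have [measurable]: "?b \<in> borel_measurable circ" "weak_ddt (?H k) \<in> borel_measurable circ"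
    using Cinf_circ[OF b] w' by (auto simp: has_weak_derivative_iff)
  have "?H (Suc k) \<in> borel_measurable circ" unfolding H by measurable
  moreover have "periodic (?H (Suc k))"
    unfolding H using w' Cinf_periodic[OF b] by (simp add: has_weak_derivative_iff periodic_def)
  moreover have "AE \<theta> in circ. ?H (Suc k) \<theta> = (\<Sum>j\<le>Suc k. ?q (Suc k) j \<theta> * ?x j \<theta>)"
    using ae
  proof eventually_elim
    case (elim \<theta>)
    have "?H (Suc k) \<theta> = (\<Sum>j\<le>k. (?b \<theta> * ddt (?q k j) \<theta>) *\<^sub>R ?x j \<theta> + (?b \<theta> * ?q k j \<theta>) *\<^sub>R ?x (Suc j) \<theta>)"
      unfolding H elim sum_distrib_left by (intro sum.cong refl) (simp add: distrib_left mult.assoc)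
    also have "\<dots> = (\<Sum>j\<le>Suc k. ?q (Suc k) j \<theta> *\<^sub>R ?x j \<theta>)" by (rule coef_sum_Suc)
    finally show ?case by (simp only: real_scaleR_def)
  qed
  ultimately show ?case by blast
qed

lemma L2_tendsto_sum:
  fixes k :: nat
  assumes "\<And>j. j \<le> k \<Longrightarrow> q j \<in> Cinf" and "\<And>j. j \<le> k \<Longrightarrow> square_integrable (x j)"
    and "\<And>j m. j \<le> k \<Longrightarrow> square_integrable (y j m)"
    and "\<And>j. j \<le> k \<Longrightarrow> (\<lambda>m::nat. \<integral>\<theta>. (x j \<theta> - y j m \<theta>)\<^sup>2 \<partial>circ) \<longlonglongrightarrow> 0"
  shows "(\<lambda>m. \<integral>\<theta>. ((\<Sum>j\<le>k. q j \<theta> * x j \<theta>) - (\<Sum>j\<le>k. q j \<theta> * y j m \<theta>))\<^sup>2 \<partial>circ) \<longlonglongrightarrow> 0"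
proof -
  have d: "square_integrable (\<lambda>\<theta>. x j \<theta> - y j m \<theta>)" if "j \<le> k" for j m
    using assms(2,3) that by (intro square_integrable_diff) auto
  have dq: "square_integrable (\<lambda>\<theta>. q j \<theta> * (x j \<theta> - y j m \<theta>))" if "j \<le> k" for j m
    using assms(1) d that by (intro square_integrable_Cinf_mult) auto
  have i: "integrable circ (\<lambda>\<theta>. (q j \<theta> * (x j \<theta> - y j m \<theta>))\<^sup>2)" if "j \<le> k" for j m
    using dq[OF that] by (simp add: square_integrable_def)
  have bound: "(\<integral>\<theta>. ((\<Sum>j\<le>k. q j \<theta> * x j \<theta>) - (\<Sum>j\<le>k. q j \<theta> * y j m \<theta>))\<^sup>2 \<partial>circ) \<le>
      (\<Sum>j\<le>k. real (Suc k) * (\<integral>\<theta>. (x j \<theta> - y j m \<theta>)\<^sup>2 * (q j \<theta> * q j \<theta>) \<partial>circ))" for m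
  proof -
    have "((\<Sum>j\<le>k. q j \<theta> * x j \<theta>) - (\<Sum>j\<le>k. q j \<theta> * y j m \<theta>)) = (\<Sum>j\<le>k. q j \<theta> * (x j \<theta> - y j m \<theta>))" for \<theta>
      by (simp add: sum_subtractf right_diff_distrib)
    then have "(\<integral>\<theta>. ((\<Sum>j\<le>k. q j \<theta> * x j \<theta>) - (\<Sum>j\<le>k. q j \<theta> * y j m \<theta>))\<^sup>2 \<partial>circ) =
        (\<integral>\<theta>. (\<Sum>j\<le>k. q j \<theta> * (x j \<theta> - y j m \<theta>))\<^sup>2 \<partial>circ)" by simp
    also have "\<dots> \<le> (\<integral>\<theta>. (\<Sum>j\<le>k. real (Suc k) * (q j \<theta> * (x j \<theta> - y j m \<theta>))\<^sup>2) \<partial>circ)"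
    proof (rule integral_mono)
      show "integrable circ (\<lambda>\<theta>. (\<Sum>j\<le>k. q j \<theta> * (x j \<theta> - y j m \<theta>))\<^sup>2)"
        using square_integrable_sum[of "{..k}" "\<lambda>j \<theta>. q j \<theta> * (x j \<theta> - y j m \<theta>)"] dq
        by (simp add: square_integrable_def)
      show "integrable circ (\<lambda>\<theta>. \<Sum>j\<le>k. real (Suc k) * (q j \<theta> * (x j \<theta> - y j m \<theta>))\<^sup>2)"
        using i by (intro Bochner_Integration.integrable_sum) auto
      show "(\<Sum>j\<le>k. q j \<theta> * (x j \<theta> - y j m \<theta>))\<^sup>2 \<le> (\<Sum>j\<le>k. real (Suc k) * (q j \<theta> * (x j \<theta> - y j m \<theta>))\<^sup>2)" for \<theta>
        using sum_squared_le_sum_of_squares[of "\<lambda>j. q j \<theta> * (x j \<theta> - y j m \<theta>)" "{..k}"]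
        by (simp add: sum_distrib_left[symmetric] mult.commute)
    qed
    also have "\<dots> = (\<Sum>j\<le>k. real (Suc k) * (\<integral>\<theta>. (q j \<theta> * (x j \<theta> - y j m \<theta>))\<^sup>2 \<partial>circ))"
      using i by (subst Bochner_Integration.integral_sum) auto
    finally show ?thesis by (simp add: power2_eq_square mult_ac)
  qed
  \<comment> \<open>The differences are viewed as a sequence that converges to the zero function,
    with weight \<open>q j\<close> squared.\<close>
  have "(\<lambda>m. \<integral>\<theta>. (x j \<theta> - y j m \<theta>)\<^sup>2 * (q j \<theta> * q j \<theta>) \<partial>circ) \<longlonglongrightarrow> 0" if j: "j \<le> k" for j
    using L2_tendsto_weighted_square[of "\<lambda>\<theta>. 0" "\<lambda>m \<theta>. x j \<theta> - y j m \<theta>" "\<lambda>\<theta>. q j \<theta> * q j \<theta>"]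
      d[OF j] assms(4)[OF j] assms(1)[OF j] square_integrable_Cinf[OF const_Cinf[of 0]]
    by (auto simp: power2_commute)
  then have "(\<lambda>m. \<Sum>j\<le>k. real (Suc k) * (\<integral>\<theta>. (x j \<theta> - y j m \<theta>)\<^sup>2 * (q j \<theta> * q j \<theta>) \<partial>circ)) \<longlonglongrightarrow>
      (\<Sum>j\<le>k. real (Suc k) * 0)"
    by (intro tendsto_sum tendsto_mult tendsto_const) auto
  then have lim: "(\<lambda>m. \<Sum>j\<le>k. real (Suc k) * (\<integral>\<theta>. (x j \<theta> - y j m \<theta>)\<^sup>2 * (q j \<theta> * q j \<theta>) \<partial>circ)) \<longlonglongrightarrow> 0"
    by simp
  show ?thesis
    by (rule tendsto_sandwich[OF _ _ tendsto_const lim]) (rule always_eventually, simp, rule always_eventually, rule allI, rule bound)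
qed

text \<open>One sequence serves both norms: the n-th arc length derivative is a combination of weak
  derivatives with smooth coefficients fixed by c, so L2 convergence of all orders up to n carries
  over to it.\<close>

lemma Sobolev_approximation:
  fixes c :: "real \<Rightarrow> 'a::real_inner" and h :: "real \<Rightarrow> real"
  assumes c: "c \<in> Imm" and h: "h \<in> Sobolev n"
  shows "\<exists>p :: nat \<Rightarrow> real \<Rightarrow> real. (\<forall>m. p m \<in> Cinf) \<and>
    (\<lambda>m. \<integral>\<theta>. (norm (p m \<theta>))\<^sup>2 + (norm ((ddt ^^ n) (p m) \<theta>))\<^sup>2 \<partial>circ) \<longlonglongrightarrow>
      (\<integral>\<theta>. (h \<theta>)\<^sup>2 + ((weak_ddt ^^ n) h \<theta>)\<^sup>2 \<partial>circ) \<and>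
    (\<lambda>m. Hn_sq n c (p m)) \<longlonglongrightarrow>
      (\<integral>\<theta>. ((h \<theta>)\<^sup>2 + ((arc_deriv weak_ddt c ^^ n) h \<theta>)\<^sup>2) * speed c \<theta> \<partial>circ)"
proof -
  let ?x = "\<lambda>j. (weak_ddt ^^ j) h" and ?b = "\<lambda>\<theta>. inverse (speed c \<theta>)"
  have x: "square_integrable (?x k)" if "k \<le> n" for k
    using h that L2_circle_square_integrable by (auto simp: Sobolev_def)
  have x0: "square_integrable h" using x[of 0] by simp
  have sp: "speed c \<in> Cinf" by (rule speed_Cinf[OF c])
  have b: "?b \<in> Cinf" by (rule inverse_speed_Cinf(1)[OF c])
  have "\<exists>p. (\<forall>m::nat. p m \<in> Cinf) \<and>
    (\<forall>k\<le>n. (\<lambda>m. \<integral>\<theta>. (?x k \<theta> - (ddt ^^ k) (p m) \<theta>)\<^sup>2 \<partial>circ) \<longlonglongrightarrow> 0)"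
    using h by (intro weak_derivative_chain_approximation x) (auto simp: Sobolev_def)
  then obtain p where p: "\<And>m::nat. p m \<in> Cinf"
    and lim: "\<And>k. k \<le> n \<Longrightarrow> (\<lambda>m. \<integral>\<theta>. (?x k \<theta> - (ddt ^^ k) (p m) \<theta>)\<^sup>2 \<partial>circ) \<longlonglongrightarrow> 0" by blast
  have lim0: "(\<lambda>m. \<integral>\<theta>. (h \<theta> - p m \<theta>)\<^sup>2 \<partial>circ) \<longlonglongrightarrow> 0" using lim[of 0] by simp
  have ps: "square_integrable ((ddt ^^ k) (p m))" for k m by (intro square_integrable_Cinf ddt_pow_Cinf p)
  have ps0: "square_integrable (p m)" for m by (intro square_integrable_Cinf p)
  define q where "q = coef ?b ?b n"
  define F where "F = (\<lambda>\<theta>. \<Sum>j\<le>n. q j \<theta> * ?x j \<theta>)"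
  have q: "q j \<in> Cinf" for j unfolding q_def by (rule coef_Cinf[OF b b])
  have F: "square_integrable F"
    unfolding F_def by (intro square_integrable_sum square_integrable_Cinf_mult x q) auto
  have Dp: "(arc_deriv ddt c ^^ n) (p m) = (\<lambda>\<theta>. \<Sum>j\<le>n. q j \<theta> * (ddt ^^ j) (p m) \<theta>)" for m
    unfolding arc_deriv_ddt_eq_wder q_def
    using wder_pow_expand[OF b b const_Cinf[of 1] _ p[of m], of n] by (simp add: wder_one)
  have Dps: "square_integrable ((arc_deriv ddt c ^^ n) (p m))" for m
    by (intro square_integrable_Cinf arc_deriv_Cinf c p)
  have limF: "(\<lambda>m. \<integral>\<theta>. (F \<theta> - (arc_deriv ddt c ^^ n) (p m) \<theta>)\<^sup>2 \<partial>circ) \<longlonglongrightarrow> 0"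
    unfolding F_def Dp by (intro L2_tendsto_sum q x ps lim)
  have add: "(\<integral>\<theta>. ((f \<theta>)\<^sup>2 + (g \<theta>)\<^sup>2) * a \<theta> \<partial>circ) = (\<integral>\<theta>. (f \<theta>)\<^sup>2 * a \<theta> \<partial>circ) + (\<integral>\<theta>. (g \<theta>)\<^sup>2 * a \<theta> \<partial>circ)"
    if "square_integrable f" "square_integrable g" "a \<in> Cinf" for f g a :: "real \<Rightarrow> real"
    unfolding distrib_right using that
    by (intro Bochner_Integration.integral_add integrable_mult_Cinf) (auto simp: square_integrable_def)
  have "(\<lambda>m. (\<integral>\<theta>. (p m \<theta>)\<^sup>2 * 1 \<partial>circ) + (\<integral>\<theta>. ((ddt ^^ n) (p m) \<theta>)\<^sup>2 * 1 \<partial>circ)) \<longlonglongrightarrow>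
      (\<integral>\<theta>. (h \<theta>)\<^sup>2 * 1 \<partial>circ) + (\<integral>\<theta>. (?x n \<theta>)\<^sup>2 * 1 \<partial>circ)"
    by (intro tendsto_add L2_tendsto_weighted_square x0 x ps ps0 lim lim0 const_Cinf order_refl)
  then have 1: "(\<lambda>m. \<integral>\<theta>. (norm (p m \<theta>))\<^sup>2 + (norm ((ddt ^^ n) (p m) \<theta>))\<^sup>2 \<partial>circ) \<longlonglongrightarrow>
      (\<integral>\<theta>. (h \<theta>)\<^sup>2 + (?x n \<theta>)\<^sup>2 \<partial>circ)"
    using add[OF ps0 ps const_Cinf[of 1]] add[OF x0 x[OF order_refl] const_Cinf[of 1]] by simp
  have "(\<lambda>m. (\<integral>\<theta>. (p m \<theta>)\<^sup>2 * speed c \<theta> \<partial>circ) + (\<integral>\<theta>. ((arc_deriv ddt c ^^ n) (p m) \<theta>)\<^sup>2 * speed c \<theta> \<partial>circ)) \<longlonglongrightarrow>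
      (\<integral>\<theta>. (h \<theta>)\<^sup>2 * speed c \<theta> \<partial>circ) + (\<integral>\<theta>. (F \<theta>)\<^sup>2 * speed c \<theta> \<partial>circ)"
    by (intro tendsto_add L2_tendsto_weighted_square x0 F ps0 Dps lim0 limF sp)
  then have "(\<lambda>m. Hn_sq n c (p m)) \<longlonglongrightarrow> (\<integral>\<theta>. ((h \<theta>)\<^sup>2 + (F \<theta>)\<^sup>2) * speed c \<theta> \<partial>circ)"
    unfolding arc_integral_circ using add[OF ps0 Dps sp] add[OF x0 F sp] by simp
  moreover have "(\<integral>\<theta>. ((h \<theta>)\<^sup>2 + (F \<theta>)\<^sup>2) * speed c \<theta> \<partial>circ) =
      (\<integral>\<theta>. ((h \<theta>)\<^sup>2 + ((arc_deriv weak_ddt c ^^ n) h \<theta>)\<^sup>2) * speed c \<theta> \<partial>circ)"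
  proof -
    have [measurable]: "h \<in> borel_measurable circ" "F \<in> borel_measurable circ" "speed c \<in> borel_measurable circ"
      using x0 F Cinf_circ[OF sp] by (auto simp: square_integrable_def)
    have [measurable]: "(arc_deriv weak_ddt c ^^ n) h \<in> borel_measurable circ"
      and ae: "AE \<theta> in circ. (arc_deriv weak_ddt c ^^ n) h \<theta> = F \<theta>"
      using arc_deriv_weak_expand[OF c h order_refl] by (auto simp: F_def q_def)
    show ?thesis using ae by (intro integral_cong_AE) (auto elim: eventually_mono)
  qed
  ultimately show ?thesis using p 1 by (intro exI[of _ p]) simp
qed

section \<open>Equivalence of the norms on the Sobolev space\<close>

lemma Hn_norm_dtheta_circ:
  "Hn_norm_dtheta n h = sqrt (\<integral>\<theta>. (h \<theta>)\<^sup>2 + ((weak_ddt ^^ n) h \<theta>)\<^sup>2 \<partial>circ)"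
  unfolding Hn_norm_dtheta_def set_lebesgue_integral_circ by simp

lemma Hn_norm_ds_circ:
  "Hn_norm_ds n c h = sqrt (\<integral>\<theta>. ((h \<theta>)\<^sup>2 + ((arc_deriv weak_ddt c ^^ n) h \<theta>)\<^sup>2) * speed c \<theta> \<partial>circ)"
  unfolding Hn_norm_ds_def arc_integral_circ by simp

text \<open>The hypothesis concerns fields with values in the space of the curves and serves to
  control the curves; the comparison is then made for real-valued functions. The dimension is the
  size of the index type \<open>'d\<close>, which is never empty.\<close>

theorem proposition3p5:
  fixes n :: nat
    and G :: "(real \<Rightarrow> real ^ 'd) \<Rightarrow> (real \<Rightarrow> real ^ 'd) \<Rightarrow> (real \<Rightarrow> real ^ 'd) \<Rightarrow> real"
    and c0 :: "real \<Rightarrow> real ^ 'd" and r :: real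
  assumes n: "n \<ge> 2"
    and G: "weakly_continuous_metric G"
    and bound: "\<And>b \<rho>. b \<in> Imm \<Longrightarrow> \<rho> > 0 \<Longrightarrow>
      \<exists>C'::real. \<forall>c\<in>metric_ball G b \<rho>. \<forall>h\<in>Cinf.
        arc_integral c (\<lambda>\<theta>. (norm (h \<theta>))\<^sup>2 + (norm ((arc_deriv ddt c ^^ n) h \<theta>))\<^sup>2)
          \<le> C' * G c h h"
    and c0: "c0 \<in> Imm" and r: "r > 0"
  shows "\<exists>C>0. \<forall>c\<in>metric_ball G c0 r. \<forall>h\<in>Sobolev n.
      inverse C * Hn_norm_dtheta n h \<le> Hn_norm_ds n c h \<and>
      Hn_norm_ds n c h \<le> C * Hn_norm_dtheta n h"
proof -
  obtain C' where C': "\<And>c h. c \<in> metric_ball G c0 r \<Longrightarrow> h \<in> Cinf \<Longrightarrow> Hn_sq n c h \<le> C' * G c h h"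
    using bound[OF c0 r] by blast
  \<comment> \<open>The given constant carries no sign; as G is nonnegative it may be raised to a
    nonnegative one.\<close>
  have "Hn_sq n c h \<le> max C' 0 * G c h h" if "c \<in> metric_ball G c0 r" "h \<in> Cinf" for c h
  proof -
    have "c \<in> Imm" using that(1) by (simp add: metric_ball_def)
    then have "C' * G c h h \<le> max C' 0 * G c h h"
      using weakly_continuous_metric_nonneg(1)[OF G _ that(2)] by (intro mult_right_mono) auto
    then show ?thesis using C'[OF that] by linarith
  qed
  then obtain C where C: "0 < C" "\<And>c h. c \<in> metric_ball G c0 r \<Longrightarrow> h \<in> Cinf \<Longrightarrow>
      (\<integral>\<theta>. (norm (h \<theta> :: real))\<^sup>2 + (norm ((ddt ^^ n) h \<theta>))\<^sup>2 \<partial>circ) \<le> C * Hn_sq n c h \<and>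
      Hn_sq n c h \<le> C * (\<integral>\<theta>. (norm (h \<theta>))\<^sup>2 + (norm ((ddt ^^ n) h \<theta>))\<^sup>2 \<partial>circ)"
    using smooth_norms_equivalent[OF n G c0, of "max C' 0" r, where 'b = real] by auto
  \<comment> \<open>The estimates for smooth functions compare squared norms, hence the square
    root.\<close>
  have "inverse (sqrt C) * Hn_norm_dtheta n h \<le> Hn_norm_ds n c h \<and>
      Hn_norm_ds n c h \<le> sqrt C * Hn_norm_dtheta n h"
    if c: "c \<in> metric_ball G c0 r" and h: "h \<in> Sobolev n" for c h
  proof -
    have "c \<in> Imm" using c by (simp add: metric_ball_def)
    let ?A = "\<integral>\<theta>. (h \<theta>)\<^sup>2 + ((weak_ddt ^^ n) h \<theta>)\<^sup>2 \<partial>circ"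
      and ?B = "\<integral>\<theta>. ((h \<theta>)\<^sup>2 + ((arc_deriv weak_ddt c ^^ n) h \<theta>)\<^sup>2) * speed c \<theta> \<partial>circ"
    obtain p :: "nat \<Rightarrow> real \<Rightarrow> real" where p: "(\<forall>m. p m \<in> Cinf) \<and>
        (\<lambda>m. \<integral>\<theta>. (norm (p m \<theta>))\<^sup>2 + (norm ((ddt ^^ n) (p m) \<theta>))\<^sup>2 \<partial>circ) \<longlonglongrightarrow> ?A \<and>
        (\<lambda>m. Hn_sq n c (p m)) \<longlonglongrightarrow> ?B"
      using Sobolev_approximation[OF \<open>c \<in> Imm\<close> h] ..
    note lim1 = p[THEN conjunct2, THEN conjunct1] and lim2 = p[THEN conjunct2, THEN conjunct2]
    note smooth = C(2)[OF c p[THEN conjunct1, rule_format]]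
    have 1: "?A \<le> C * ?B"
      by (rule LIMSEQ_le[OF lim1 tendsto_mult_left[OF lim2]])
        (intro exI allI impI smooth[THEN conjunct1])
    have 2: "?B \<le> C * ?A"
      by (rule LIMSEQ_le[OF lim2 tendsto_mult_left[OF lim1]])
        (intro exI allI impI smooth[THEN conjunct2])
    have "sqrt ?A \<le> sqrt C * sqrt ?B" "sqrt ?B \<le> sqrt C * sqrt ?A"
      using real_sqrt_le_mono[OF 1] real_sqrt_le_mono[OF 2] by (simp_all only: real_sqrt_mult)
    then show ?thesis
      unfolding Hn_norm_dtheta_circ Hn_norm_ds_circ using C(1) by (simp add: field_simps)
  qed
  then show ?thesis using C(1) by (intro exI[of _ "sqrt C"]) simp
qed

end
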